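(* Let $x_{1}=f(x,u)$ be a sampled data system with $n$-dimensional state $x$ and $m$-dimensional input $u$, where $f$ is a surjective submersion and $\operatorname{rank}(\partial_u f)=m$. Let $U=\operatorname{span}\{\partial_{u^1},\dots,\partial_{u^m}\}\subset\mathcal T(\mathcal E)$, let $K$ be the distribution on $\mathcal E$ of all vector fields $v$ with $v(f^i)=0$, $i=1,\dots,n$, and let $1\le m_u\le m$, $m_v=m-m_u$. The existence of a subdistribution $U_{b_u}\subseteq U$ with $\dim U_{b_u}=m_u$ and $$[U_{b_u},\,U_{b_u}\oplus K]\subseteq U_{b_u}\oplus K$$ is necessary and locally sufficient for the system to be transformable to the form $$\begin{array}{rcl}\tilde x_{a,1}&=&\tilde f_a(\tilde x,\tilde v)\\ \tilde x_{b_v,1}&=&\tilde v\\ \tilde x_{b_u,1}&=&\tilde u\end{array}$$ with $\tilde x=(\tilde x_a,\tilde x_{b_v},\tilde x_{b_u})$, $\dim\tilde x_a=n-m$, $\dim\tilde x_{b_v}=\dim\tilde v=m_v$, $\dim\tilde x_{b_u}=\dim\tilde u=m_u$.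
   Context: All objects are smooth and all considerations are local; all distributions have constant rank near the points considered. System: $\mathcal X$ is the $n$-dimensional state manifold with coordinates $x$, $\mathcal E\to\mathcal X$ a bundle with coordinates $(x,u)$, $\dim u=m$, and $f:\mathcal E\to\mathcal X_1$ (a copy of $\mathcal X$ with coordinates $x_1$). The subscript $1$ denotes the forward time shift. The condition $\operatorname{rank}(\partial_u f)=m$ says there are no redundant inputs. Transformability: a system is transformable to a given form if there are local diffeomorphisms $\tilde x=\varphi_x(x)$ (used also at the shifted point, $\tilde x_1=\varphi_x(x_1)$) and $(x,u)\mapsto(\varphi_x(x),\varphi_u(x,u))$, with new inputs $(\tilde v,\tilde u)=\varphi_u(x,u)$, which bring the system equations to that form. $[A,B]$ denotes the span of all Lie brackets of vector fields in $A$ with vector fields in $B$. *)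

theory Defs
  imports "HOL-Analysis.Analysis"
begin

text \<open>Smooth maps on open subsets of normed spaces. The notion is meant for open \<^term>\<open>S\<close>, where
  it only depends on the values of \<^term>\<open>f\<close> on \<^term>\<open>S\<close>.\<close>

primrec Ck_on ::
  "nat \<Rightarrow> 'a::real_normed_vector set \<Rightarrow> ('a \<Rightarrow> 'b::real_normed_vector) \<Rightarrow> bool" where
  "Ck_on 0 S f \<longleftrightarrow> continuous_on S f"
| "Ck_on (Suc k) S f \<longleftrightarrow> (\<forall>x\<in>S. f differentiable (at x)) \<and>
     (\<forall>h. Ck_on k S (\<lambda>x. frechet_derivative f (at x) h))"

definition smooth_on ::
  "'a::real_normed_vector set \<Rightarrow> ('a \<Rightarrow> 'b::real_normed_vector) \<Rightarrow> bool" where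
  "smooth_on S f \<longleftrightarrow> (\<forall>k. Ck_on k S f)"

definition diffeo_on ::
  "'a::real_normed_vector set \<Rightarrow> ('a \<Rightarrow> 'b::real_normed_vector) \<Rightarrow> bool" where
  "diffeo_on S g \<longleftrightarrow> open S \<and> smooth_on S g \<and> inj_on g S \<and>
     open (g ` S) \<and> smooth_on (g ` S) (inv_into S g)"

text \<open>A distribution is given by its fibres \<^term>\<open>D p\<close>.\<close>

definition distribution_on ::
  "'a::euclidean_space set \<Rightarrow> nat \<Rightarrow> ('a \<Rightarrow> 'a set) \<Rightarrow> bool" where
  "distribution_on S r D \<longleftrightarrow>
     (\<forall>p\<in>S. dim (D p) = r) \<and>
     (\<forall>p\<in>S. \<exists>N (X :: nat \<Rightarrow> 'a \<Rightarrow> 'a). open N \<and> p \<in> N \<and> N \<subseteq> S \<and>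
        (\<forall>i<r. smooth_on N (X i)) \<and>
        (\<forall>q\<in>N. D q = span ((\<lambda>i. X i q) ` {..<r})))"

definition vector_field_in ::
  "'a::euclidean_space set \<Rightarrow> ('a \<Rightarrow> 'a set) \<Rightarrow> ('a \<Rightarrow> 'a) \<Rightarrow> bool" where
  "vector_field_in S D v \<longleftrightarrow> smooth_on S v \<and> (\<forall>p\<in>S. v p \<in> D p)"

definition lie_bracket ::
  "('a::euclidean_space \<Rightarrow> 'a) \<Rightarrow> ('a \<Rightarrow> 'a) \<Rightarrow> 'a \<Rightarrow> 'a" where
  "lie_bracket v w p = frechet_derivative w (at p) (v p) - frechet_derivative v (at p) (w p)"

text \<open>Fibre at \<^term>\<open>p\<close> of the span of all brackets \<^term>\<open>lie_bracket v w\<close>; the vector fields are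
  local ones, defined on some neighbourhood of \<^term>\<open>p\<close> inside \<^term>\<open>S\<close>.\<close>

definition bracket_dist ::
  "'a::euclidean_space set \<Rightarrow> ('a \<Rightarrow> 'a set) \<Rightarrow> ('a \<Rightarrow> 'a set) \<Rightarrow> 'a \<Rightarrow> 'a set" where
  "bracket_dist S A B p = span {lie_bracket v w p | v w N.
     open N \<and> p \<in> N \<and> N \<subseteq> S \<and> vector_field_in N A v \<and> vector_field_in N B w}"

definition sum_dist ::
  "('a::euclidean_space \<Rightarrow> 'a set) \<Rightarrow> ('a \<Rightarrow> 'a set) \<Rightarrow> 'a \<Rightarrow> 'a set" where
  "sum_dist A B p = {a + b | a b. a \<in> A p \<and> b \<in> B p}"

definition input_dist :: "(real^'n) \<times> (real^'m) \<Rightarrow> ((real^'n) \<times> (real^'m)) set" where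
  "input_dist p = span (range (\<lambda>j. (0, axis j 1)))"

text \<open>The vector fields in \<^term>\<open>kernel_dist f\<close> are those annihilating all components of
  \<^term>\<open>f\<close>. If the Jacobian of \<^term>\<open>f\<close> with respect to \<open>u\<close> has full column rank, then
  \<^term>\<open>kernel_dist f p\<close> and \<^term>\<open>input_dist p\<close> meet only in 0, so that for a
  subdistribution of \<^term>\<open>input_dist\<close> the sum with \<^term>\<open>kernel_dist f\<close> is direct.\<close>

definition kernel_dist ::
  "((real^'n) \<times> (real^'m) \<Rightarrow> real^'n) \<Rightarrow> (real^'n) \<times> (real^'m) \<Rightarrow> ((real^'n) \<times> (real^'m)) set" where
  "kernel_dist f p = {w. \<forall>i. frechet_derivative (\<lambda>q. f q $ i) (at p) w = 0}"

text \<open>The vector \<open>w\<close> with the components outside \<open>I\<close> set to 0: this represents a point of the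
  (possibly zero-dimensional) coordinate space indexed by \<open>I\<close>.\<close>

definition coord_part :: "'m set \<Rightarrow> real^'m \<Rightarrow> real^'m" where
  "coord_part I w = (\<chi> j. if j \<in> I then w $ j else 0)"

text \<open>The map \<open>g\<close> has on \<open>S\<close> the block form
  \<open>x\<^sub>a\<^sup>+ = f\<^sub>a(x, v)\<close>, \<open>x\<^sub>b\<^sub>v\<^sup>+ = v\<close>, \<open>x\<^sub>b\<^sub>u\<^sup>+ = u\<close>.
  Since the blocks \<open>x\<^sub>a\<close>, \<open>x\<^sub>b\<^sub>v\<close> and \<open>v\<close> may have dimension 0, they are given by sets of
  indices: the state indices are partitioned into \<open>Ia\<close>, \<open>Ibv\<close>, \<open>Ibu\<close>, the input indices
  into \<open>Iv\<close>, \<open>Iu\<close>, and \<open>\<sigma>\<close> pairs every input component with the corresponding component of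
  \<open>(x\<^sub>b\<^sub>v, x\<^sub>b\<^sub>u)\<close>. Only the components of \<open>fa\<close> in \<open>Ia\<close> matter.\<close>

definition in_block_form ::
  "nat \<Rightarrow> nat \<Rightarrow> ((real^'n) \<times> (real^'m)) set \<Rightarrow> ((real^'n) \<times> (real^'m) \<Rightarrow> real^'n) \<Rightarrow> bool" where
  "in_block_form mv mu S g \<longleftrightarrow>
     (\<exists>(Ia :: 'n set) Ibv Ibu (Iv :: 'm set) Iu \<sigma> T
        (fa :: (real^'n) \<times> (real^'m) \<Rightarrow> real^'n).
        Ia \<union> Ibv \<union> Ibu = UNIV \<and> Ia \<inter> Ibv = {} \<and> Ia \<inter> Ibu = {} \<and> Ibv \<inter> Ibu = {} \<and>
        Iv \<union> Iu = UNIV \<and> Iv \<inter> Iu = {} \<and>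
        card Ia = CARD('n) - CARD('m) \<and> card Iv = mv \<and> card Iu = mu \<and>
        bij_betw \<sigma> Iv Ibv \<and> bij_betw \<sigma> Iu Ibu \<and>
        open T \<and> smooth_on T fa \<and>
        (\<forall>(x, w)\<in>S. (x, coord_part Iv w) \<in> T \<and>
           (\<forall>i\<in>Ia. g (x, w) $ i = fa (x, coord_part Iv w) $ i) \<and>
           (\<forall>j\<in>Iv. g (x, w) $ \<sigma> j = w $ j) \<and>
           (\<forall>j\<in>Iu. g (x, w) $ \<sigma> j = w $ j)))"

text \<open>Transformability near the point \<open>p\<^sub>0 = (x\<^sub>0, u\<^sub>0)\<close>. The state transformation \<open>\<phi>x\<close> is used
  at \<open>x\<close> and at the shifted point \<open>f(x, u)\<close>, so its domain \<open>W\<close> is a neighbourhood of both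
  \<open>x\<^sub>0\<close> and \<open>f p\<^sub>0\<close>; no equilibrium is assumed.\<close>

definition transformable_near ::
  "nat \<Rightarrow> nat \<Rightarrow> (real^'n) set \<Rightarrow> ((real^'n) \<times> (real^'m)) set \<Rightarrow>
   ((real^'n) \<times> (real^'m) \<Rightarrow> real^'n) \<Rightarrow> (real^'n) \<times> (real^'m) \<Rightarrow> bool" where
  "transformable_near mv mu X E f p0 \<longleftrightarrow>
     (\<exists>W (\<phi>x :: real^'n \<Rightarrow> real^'n) G (\<phi>u :: (real^'n) \<times> (real^'m) \<Rightarrow> real^'m) \<Phi>.
        \<Phi> = (\<lambda>(x, u). (\<phi>x x, \<phi>u (x, u))) \<and>
        W \<subseteq> X \<and> fst p0 \<in> W \<and> f p0 \<in> W \<and> diffeo_on W \<phi>x \<and>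
        G \<subseteq> E \<and> p0 \<in> G \<and> fst ` G \<subseteq> W \<and> f ` G \<subseteq> W \<and> diffeo_on G \<Phi> \<and>
        in_block_form mv mu (\<Phi> ` G) (\<lambda>q. \<phi>x (f (inv_into G \<Phi> q))))"

end

theory Submission
  imports Defs
begin

text \<open>Put \<open>D = U\<^sub>b\<^sub>u \<oplus> K\<close>. The bracket condition together with \<open>[K, K] \<subseteq> K\<close> says that \<open>D\<close> is
  involutive. By the Frobenius theorem \<open>D\<close> is locally the kernel of the differential of a map \<open>h\<close>,
  and since \<open>K = ker df\<close> is contained in \<open>D\<close>, this map factors as \<open>h = \<eta> \<circ> f\<close>. The components of
  \<open>\<eta>\<close>, completed to a coordinate system of the state space near the shifted point, give the state
  transformation; the inputs are replaced by the components of the shifted state that correspond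
  to \<open>f\<^sub>*U\<close>. Conversely, in block form \<open>D\<close> is the common kernel of the differentials of the shifted
  coordinates outside \<open>x\<^sub>b\<^sub>u\<close>, hence closed under brackets.

  For the Frobenius theorem, \<open>D\<close> is written as a graph over \<open>D p0\<close>, which yields a commuting frame;
  the chart is the time-one map of the flows of constant combinations of this frame. It is obtained
  from a single integral equation on a ball, so that smooth dependence on initial values and on
  parameters is one induction on the order of differentiability.\<close>

section \<open>Calculus of finitely and infinitely differentiable maps\<close>

text \<open>The absence of redundant inputs enters twice: it makes \<open>Ubu\<close> and
  \<open>kernel_dist f\<close> meet in 0, so that their sum has the rank
  \<open>mu + CARD('m)\<close> expected by the Frobenius theorem, and it allows
  \<open>CARD('m)\<close> of the shifted coordinates to serve as new inputs. In the integral
  equation the contraction constant 1/2 comes from smallness of the ball, not of the time interval: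
  the field is linear in the parameter \<open>\<pi> q\<close>, so scaling the parameter replaces
  scaling the time. A ray that starts in the ball stays in it, hence the unknown can be a function
  on the ball instead of a family of curves, and the linearised equation is again posed on the same
  ball. The derivative of a solution is first produced as the solution of that linearised equation
  and only afterwards compared with increments. In the sufficiency direction the new coordinates are
  adapted linearly at one point, while the first integrals extend the adaptation to a neighbourhood;
  the final independence of the inputs is integrated along segments, which is why boxes
  appear.\<close>

abbreviation der :: "('a::real_normed_vector \<Rightarrow> 'b::real_normed_vector) \<Rightarrow> 'a \<Rightarrow> 'a \<Rightarrow> 'b" where
  "der f x \<equiv> frechet_derivative f (at x)"

lemma der_eq: "(f has_derivative f') (at x) \<Longrightarrow> der f x = f'"
  using frechet_derivative_at by metis

lemma has_derivative_der: "f differentiable at x \<Longrightarrow> (f has_derivative der f x) (at x)"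
  by (simp add: frechet_derivative_works)

lemma has_derivative_cong_open:
  assumes "open S" "x \<in> S" "\<And>y. y \<in> S \<Longrightarrow> f y = g y"
  shows "(f has_derivative F) (at x) \<longleftrightarrow> (g has_derivative F) (at x)"
  using has_derivative_transform_within_open[OF _ assms(1,2), of f F UNIV g]
    has_derivative_transform_within_open[OF _ assms(1,2), of g F UNIV f] assms(3) by auto

lemma der_cong:
  assumes "open S" "x \<in> S" "\<And>y. y \<in> S \<Longrightarrow> f y = g y"
  shows "der f x = der g x"
  using has_derivative_cong_open[OF assms] by (simp add: frechet_derivative_def)

text \<open>The derivative in \<open>Ck_on\<close> is taken in the whole space, so agreement on
  \<open>S\<close> passes to derivatives because \<open>S\<close> is open.\<close>

lemma Ck_on_cong:
  assumes "open S" "\<And>x. x \<in> S \<Longrightarrow> f x = g x"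
  shows "Ck_on k S f \<longleftrightarrow> Ck_on k S g"
  using assms(2)
proof (induction k arbitrary: f g)
  case 0
  then show ?case by (simp cong: continuous_on_cong)
next
  case (Suc k)
  have *: "(f has_derivative F) (at x) \<longleftrightarrow> (g has_derivative F) (at x)" if "x \<in> S" for F x
    using has_derivative_cong_open[OF \<open>open S\<close> that] Suc.prems by blast
  have "Ck_on k S (\<lambda>x. der f x h) \<longleftrightarrow> Ck_on k S (\<lambda>x. der g x h)" for h
    by (rule Suc.IH) (simp add: der_cong[OF \<open>open S\<close> _ Suc.prems])
  moreover have "f differentiable at x \<longleftrightarrow> g differentiable at x" if "x \<in> S" for x
    using *[OF that] by (simp add: differentiable_def)
  ultimately show ?case unfolding Ck_on.simps by blast
qed

lemma Ck_on_subset: "Ck_on k S f \<Longrightarrow> T \<subseteq> S \<Longrightarrow> Ck_on k T f"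
  by (induction k arbitrary: f) (auto intro: continuous_on_subset)

lemma Ck_on_SucD:
  assumes "Ck_on (Suc k) S f"
  shows "x \<in> S \<Longrightarrow> (f has_derivative der f x) (at x)"
    and "Ck_on k S (\<lambda>x. der f x h)"
  using assms has_derivative_der unfolding Ck_on.simps by blast+

lemma Ck_on_SucI:
  assumes "open S" "\<And>x. x \<in> S \<Longrightarrow> (f has_derivative f' x) (at x)"
    and "\<And>h. Ck_on k S (\<lambda>x. f' x h)"
  shows "Ck_on (Suc k) S f"
proof -
  have "der f x h = f' x h" if "x \<in> S" for x h
    using der_eq[OF assms(2)[OF that]] by simp
  then have "Ck_on k S (\<lambda>x. der f x h)" for h
    using assms(3)[of h] Ck_on_cong[OF assms(1), of "\<lambda>x. der f x h" "\<lambda>x. f' x h"]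
    by simp
  with assms(2) show ?thesis unfolding Ck_on.simps differentiable_def by blast
qed

lemma Ck_on_Suc_imp: "Ck_on (Suc k) S f \<Longrightarrow> Ck_on k S f"
proof (induction k arbitrary: f)
  case 0
  then show ?case
    by (auto intro!: continuous_at_imp_continuous_on differentiable_imp_continuous_within)
next
  case (Suc k)
  then show ?case by (metis Ck_on.simps(2))
qed

lemma Ck_on_imp_continuous_on: "Ck_on k S f \<Longrightarrow> continuous_on S f"
  by (induction k) (auto simp del: Ck_on.simps(2) intro: Ck_on_Suc_imp)

lemma Ck_on_local:
  assumes "\<And>x. x \<in> S \<Longrightarrow> \<exists>N. open N \<and> x \<in> N \<and> Ck_on k N f"
  shows "Ck_on k S f"
  using assms
proof (induction k arbitrary: f)
  case 0
  then show ?case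
    unfolding Ck_on.simps
    by (intro continuous_at_imp_continuous_on ballI) (metis continuous_on_eq_continuous_at)
next
  case (Suc k)
  have "Ck_on k S (\<lambda>x. der f x h)" for h
    by (rule Suc.IH) (metis Suc.prems Ck_on_SucD(2))
  moreover have "f differentiable at x" if "x \<in> S" for x
    using Suc.prems[OF that] unfolding Ck_on.simps by blast
  ultimately show ?case unfolding Ck_on.simps by blast
qed

section \<open>Closure properties of maps of finite order\<close>

lemma Ck_on_const: "open S \<Longrightarrow> Ck_on k S (\<lambda>x. c)"
  by (induction k arbitrary: c) (auto simp: frechet_derivative_const)

lemma Ck_on_bounded_linear:
  assumes "open S" "bounded_linear L"
  shows "Ck_on k S L"
proof (cases k)
  case 0
  then show ?thesis by (simp add: assms(2) linear_continuous_on)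
next
  case (Suc j)
  show ?thesis unfolding Suc
    by (rule Ck_on_SucI[where f' = "\<lambda>x. L"])
       (auto intro: assms Ck_on_const bounded_linear_imp_has_derivative)
qed

lemma Ck_on_id: "open S \<Longrightarrow> Ck_on k S (\<lambda>x. x)"
  by (rule Ck_on_bounded_linear) (auto simp: bounded_linear_ident)

lemma Ck_on_linear_image:
  assumes "bounded_linear L" "open S" "Ck_on k S f"
  shows "Ck_on k S (\<lambda>x. L (f x))"
  using assms(3)
proof (induction k arbitrary: f)
  case 0
  then show ?case by (simp add: assms(1) bounded_linear.continuous_on)
next
  case (Suc k)
  show ?case
    by (rule Ck_on_SucI[where f' = "\<lambda>x h. L (der f x h)"])
       (use Suc assms in \<open>auto intro!: bounded_linear.has_derivative[OF assms(1)] Ck_on_SucD\<close>)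
qed

lemma Ck_on_add:
  assumes "open S" "Ck_on k S f" "Ck_on k S g"
  shows "Ck_on k S (\<lambda>x. f x + g x)"
  using assms(2,3)
proof (induction k arbitrary: f g)
  case 0
  then show ?case by (simp add: continuous_on_add)
next
  case (Suc k)
  show ?case
    by (rule Ck_on_SucI[where f' = "\<lambda>x h. der f x h + der g x h"])
       (use Suc assms in \<open>auto intro!: has_derivative_add Ck_on_SucD\<close>)
qed

lemma Ck_on_minus: "open S \<Longrightarrow> Ck_on k S f \<Longrightarrow> Ck_on k S (\<lambda>x. - f x)"
  by (rule Ck_on_linear_image) (auto intro: bounded_linear_minus bounded_linear_ident)

lemma Ck_on_diff:
  "open S \<Longrightarrow> Ck_on k S f \<Longrightarrow> Ck_on k S g \<Longrightarrow> Ck_on k S (\<lambda>x. f x - g x)"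
  using Ck_on_add[of S k f "\<lambda>x. - g x"] Ck_on_minus[of S k g] by simp

lemma Ck_on_sum:
  assumes "open S" "\<And>i. i \<in> I \<Longrightarrow> Ck_on k S (f i)"
  shows "Ck_on k S (\<lambda>x. \<Sum>i\<in>I. f i x)"
  using assms(2)
proof (induction I rule: infinite_finite_induct)
  case (insert i I)
  then show ?case using Ck_on_add[OF assms(1), of k "f i" "\<lambda>x. \<Sum>i\<in>I. f i x"] by simp
qed (simp_all add: Ck_on_const assms(1))

lemma Ck_on_bilinear:
  assumes "bounded_bilinear P" "open S" "Ck_on k S f" "Ck_on k S g"
  shows "Ck_on k S (\<lambda>x. P (f x) (g x))"
  using assms(3,4)
proof (induction k arbitrary: f g)
  case 0
  then show ?case by (simp add: assms(1) bounded_bilinear.continuous_on)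
next
  case (Suc k)
  show ?case
  proof (rule Ck_on_SucI[where f' = "\<lambda>x h. P (f x) (der g x h) + P (der f x h) (g x)"])
    show "((\<lambda>x. P (f x) (g x)) has_derivative (\<lambda>h. P (f x) (der g x h) + P (der f x h) (g x))) (at x)"
      if "x \<in> S" for x
      using bounded_bilinear.FDERIV[OF assms(1)] Suc.prems[THEN Ck_on_SucD(1)] that by blast
    \<comment> \<open>Both Leibniz terms are products of the same kind, of one order less; this is
      why the induction runs over both factors.\<close>
    show "Ck_on k S (\<lambda>x. P (f x) (der g x h) + P (der f x h) (g x))" for h
      using Suc.prems by (intro Ck_on_add Suc.IH assms(2)) (auto intro: Ck_on_Suc_imp Ck_on_SucD)
  qed (rule assms(2))
qed

lemmas Ck_on_scaleR = Ck_on_bilinear[OF bounded_bilinear_scaleR]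

lemma Ck_on_Pair:
  assumes "open S" "Ck_on k S f" "Ck_on k S g"
  shows "Ck_on k S (\<lambda>x. (f x, g x))"
proof -
  have "Ck_on k S (\<lambda>x. (f x, 0) + (0, g x))"
    using assms
    by (intro Ck_on_add Ck_on_linear_image[where L = "\<lambda>x. (x, 0)"]
         Ck_on_linear_image[where L = "\<lambda>x. (0, x)"])
       (auto intro!: bounded_linear_intros)
  then show ?thesis by simp
qed

lemma linear_eq_sum_Basis:
  fixes L :: "'a::euclidean_space \<Rightarrow> 'b::real_vector"
  assumes "linear L"
  shows "L v = (\<Sum>b\<in>Basis. (v \<bullet> b) *\<^sub>R L b)"
proof -
  have "L v = L (\<Sum>b\<in>Basis. (v \<bullet> b) *\<^sub>R b)" by (simp add: euclidean_representation)
  also have "\<dots> = (\<Sum>b\<in>Basis. (v \<bullet> b) *\<^sub>R L b)"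
    by (simp add: linear_sum[OF assms] linear_cmul[OF assms])
  finally show ?thesis .
qed

text \<open>In finite dimension \<open>L x\<close> is determined by its values on the basis, so
  regularity of \<open>L\<close> in each fixed direction suffices although the argument
  \<open>v x\<close> moves as well. This makes the directionwise definition of \<open>Ck_on\<close>
  usable in the chain rule.\<close>

lemma Ck_on_linear_apply:
  fixes L :: "'a::real_normed_vector \<Rightarrow> 'b::euclidean_space \<Rightarrow> 'c::real_normed_vector"
  assumes "open S" "\<And>x. x \<in> S \<Longrightarrow> linear (L x)" "\<And>w. Ck_on k S (\<lambda>x. L x w)" "Ck_on k S v"
  shows "Ck_on k S (\<lambda>x. L x (v x))"
proof -
  have "Ck_on k S (\<lambda>x. \<Sum>b\<in>Basis. (v x \<bullet> b) *\<^sub>R L x b)"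
    using assms
    by (intro Ck_on_sum Ck_on_scaleR Ck_on_linear_image[where L = "\<lambda>x. x \<bullet> b" for b])
       (auto intro: bounded_linear_inner_left)
  then show ?thesis
    by (subst Ck_on_cong[where g = "\<lambda>x. \<Sum>b\<in>Basis. (v x \<bullet> b) *\<^sub>R L x b"])
       (auto simp: assms linear_eq_sum_Basis[symmetric])
qed

lemma Ck_on_der_linear: "Ck_on (Suc k) S f \<Longrightarrow> x \<in> S \<Longrightarrow> linear (der f x)"
  using Ck_on_SucD(1) has_derivative_linear by blast

lemma Ck_on_compose:
  fixes f :: "'a::real_normed_vector \<Rightarrow> 'b::euclidean_space"
  assumes "open S" "open T" "f ` S \<subseteq> T" "Ck_on k S f" "Ck_on k T g"
  shows "Ck_on k S (\<lambda>x. g (f x))"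
  using assms(4,5)
proof (induction k arbitrary: g)
  case 0
  then show ?case using assms(3) by (auto intro: continuous_on_compose2)
next
  case (Suc k)
  show ?case
  proof (rule Ck_on_SucI[where f' = "\<lambda>x h. der g (f x) (der f x h)"])
    show "((\<lambda>x. g (f x)) has_derivative (\<lambda>h. der g (f x) (der f x h))) (at x)" if "x \<in> S" for x
      using has_derivative_compose[of f "der f x" x UNIV g "der g (f x)"]
        Suc.prems[THEN Ck_on_SucD(1)] that assms(3) by blast
    show "Ck_on k S (\<lambda>x. der g (f x) (der f x h))" for h
    proof (rule Ck_on_linear_apply)
      \<comment> \<open>The induction varies \<open>g\<close> with \<open>f\<close> fixed: a
        directional derivative of \<open>g\<close> has one order less and is composed with the same
        \<open>f\<close>.\<close>
      show "Ck_on k S (\<lambda>x. der g (f x) w)" for w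
        using Suc.prems by (intro Suc.IH[where g = "\<lambda>y. der g y w"]) (auto intro: Ck_on_SucD Ck_on_Suc_imp)
    qed (use Suc.prems assms in \<open>auto intro: Ck_on_der_linear Ck_on_SucD simp del: Ck_on.simps\<close>)
  qed (rule assms(1))
qed

section \<open>The same rules for smooth maps\<close>

lemma smooth_onD: "smooth_on S f \<Longrightarrow> Ck_on k S f"
  by (simp add: smooth_on_def)

lemma smooth_on_cong:
  assumes "open S" "\<And>x. x \<in> S \<Longrightarrow> f x = g x"
  shows "smooth_on S f \<longleftrightarrow> smooth_on S g"
  using Ck_on_cong[OF assms] by (simp add: smooth_on_def)

lemma smooth_on_subset: "smooth_on S f \<Longrightarrow> T \<subseteq> S \<Longrightarrow> smooth_on T f"
  using Ck_on_subset by (metis smooth_on_def)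

lemma smooth_on_Un: "open S \<Longrightarrow> open T \<Longrightarrow> smooth_on S f \<Longrightarrow> smooth_on T f \<Longrightarrow> smooth_on (S \<union> T) f"
  unfolding smooth_on_def by (metis Ck_on_local UnE)

lemma smooth_on_has_derivative: "smooth_on S f \<Longrightarrow> x \<in> S \<Longrightarrow> (f has_derivative der f x) (at x)"
  using Ck_on_SucD(1) smooth_on_def by blast

lemma smooth_on_der: "smooth_on S f \<Longrightarrow> smooth_on S (\<lambda>x. der f x h)"
  using Ck_on_SucD(2) smooth_on_def by blast

lemma smooth_on_linear_der: "smooth_on S f \<Longrightarrow> x \<in> S \<Longrightarrow> linear (der f x)"
  using smooth_on_has_derivative has_derivative_linear by blast

lemma smooth_on_imp_continuous_on: "smooth_on S f \<Longrightarrow> continuous_on S f"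
  using smooth_on_def Ck_on_imp_continuous_on by blast

lemma smooth_on_const: "open S \<Longrightarrow> smooth_on S (\<lambda>x. c)"
  by (simp add: smooth_on_def Ck_on_const)

lemma smooth_on_bounded_linear: "open S \<Longrightarrow> bounded_linear L \<Longrightarrow> smooth_on S L"
  by (simp add: smooth_on_def Ck_on_bounded_linear)

lemma smooth_on_id: "open S \<Longrightarrow> smooth_on S (\<lambda>x. x)"
  by (simp add: smooth_on_def Ck_on_id)

lemma smooth_on_linear_image:
  "bounded_linear L \<Longrightarrow> open S \<Longrightarrow> smooth_on S f \<Longrightarrow> smooth_on S (\<lambda>x. L (f x))"
  by (simp add: smooth_on_def Ck_on_linear_image)

lemma smooth_on_add: "open S \<Longrightarrow> smooth_on S f \<Longrightarrow> smooth_on S g \<Longrightarrow> smooth_on S (\<lambda>x. f x + g x)"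
  by (simp add: smooth_on_def Ck_on_add)

lemma smooth_on_diff: "open S \<Longrightarrow> smooth_on S f \<Longrightarrow> smooth_on S g \<Longrightarrow> smooth_on S (\<lambda>x. f x - g x)"
  by (simp add: smooth_on_def Ck_on_diff)

lemma smooth_on_sum:
  "open S \<Longrightarrow> (\<And>i. i \<in> I \<Longrightarrow> smooth_on S (f i)) \<Longrightarrow> smooth_on S (\<lambda>x. \<Sum>i\<in>I. f i x)"
  by (simp add: smooth_on_def Ck_on_sum)

lemma smooth_on_scaleR:
  "open S \<Longrightarrow> smooth_on S f \<Longrightarrow> smooth_on S g \<Longrightarrow> smooth_on S (\<lambda>x. f x *\<^sub>R g x)"
  by (simp add: smooth_on_def Ck_on_scaleR)

lemma smooth_on_Pair: "open S \<Longrightarrow> smooth_on S f \<Longrightarrow> smooth_on S g \<Longrightarrow> smooth_on S (\<lambda>x. (f x, g x))"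
  by (simp add: smooth_on_def Ck_on_Pair)

lemma smooth_on_linear_apply:
  fixes L :: "'a::real_normed_vector \<Rightarrow> 'b::euclidean_space \<Rightarrow> 'c::real_normed_vector"
  assumes "open S" "\<And>x. x \<in> S \<Longrightarrow> linear (L x)" "\<And>w. smooth_on S (\<lambda>x. L x w)" "smooth_on S v"
  shows "smooth_on S (\<lambda>x. L x (v x))"
  using assms by (simp add: smooth_on_def Ck_on_linear_apply)

lemma smooth_on_compose:
  fixes f :: "'a::real_normed_vector \<Rightarrow> 'b::euclidean_space"
  assumes "open S" "open T" "f ` S \<subseteq> T" "smooth_on S f" "smooth_on T g"
  shows "smooth_on S (\<lambda>x. g (f x))"
  using assms by (auto simp: smooth_on_def intro: Ck_on_compose[of S T])

section \<open>Second derivatives and the smooth inverse function theorem\<close>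

lemma second_difference_mvt:
  fixes f :: "'a::real_normed_vector \<Rightarrow> real"
  assumes C2: "Ck_on (Suc (Suc 0)) S f" and S: "ball x e \<subseteq> S"
    and t: "0 < t" "t * (norm h + norm k) < e"
  shows "\<exists>y. dist x y \<le> t * (norm h + norm k) \<and>
     f (x + t *\<^sub>R h + t *\<^sub>R k) - f (x + t *\<^sub>R h) - f (x + t *\<^sub>R k) + f x
       = t * t * der (\<lambda>z. der f z h) y k"
proof -
  \<comment> \<open>All points of the parallelogram over which the mean value theorem is applied
    stay inside the ball.\<close>
  have near: "dist x (x + a *\<^sub>R h + b *\<^sub>R k) \<le> t * (norm h + norm k)"
    if "0 \<le> a" "a \<le> t" "0 \<le> b" "b \<le> t" for a b
  proof -
    have "norm (a *\<^sub>R h + b *\<^sub>R k) \<le> a * norm h + b * norm k"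
      using that norm_triangle_ineq[of "a *\<^sub>R h" "b *\<^sub>R k"] by simp
    also have "\<dots> \<le> t * norm h + t * norm k"
      using that by (intro add_mono mult_right_mono) auto
    finally show ?thesis by (simp add: dist_norm algebra_simps norm_minus_commute)
  qed
  then have inS: "x + a *\<^sub>R h + b *\<^sub>R k \<in> S" if "0 \<le> a" "a \<le> t" "0 \<le> b" "b \<le> t" for a b
    using that S t(2) by (smt (verit, best) mem_ball subset_eq)
  have line: "((\<lambda>s. x + s *\<^sub>R h + b *\<^sub>R k) has_derivative (\<lambda>s. s *\<^sub>R h)) (at s)" for s b
    by (auto intro!: derivative_eq_intros)
  have line': "((\<lambda>s. x + a *\<^sub>R h + s *\<^sub>R k) has_derivative (\<lambda>s. s *\<^sub>R k)) (at s)" for s a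
    by (auto intro!: derivative_eq_intros)
  have D1: "((\<lambda>s. f (x + s *\<^sub>R h + b *\<^sub>R k)) has_real_derivative der f (x + s *\<^sub>R h + b *\<^sub>R k) h) (at s)"
    if "0 \<le> s" "s \<le> t" "0 \<le> b" "b \<le> t" for s b
    using has_derivative_compose[OF line Ck_on_SucD(1)[OF C2 inS[OF that]]]
      Ck_on_der_linear[OF C2 inS[OF that]]
    by (simp add: has_field_derivative_def linear_cmul mult_commute_abs)
  have C1: "Ck_on (Suc 0) S (\<lambda>z. der f z h)"
    using C2 by (rule Ck_on_SucD(2))
  have D2: "((\<lambda>s. der f (x + a *\<^sub>R h + s *\<^sub>R k) h) has_real_derivative
      der (\<lambda>z. der f z h) (x + a *\<^sub>R h + s *\<^sub>R k) k) (at s)"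
    if "0 \<le> a" "a \<le> t" "0 \<le> s" "s \<le> t" for s a
    using has_derivative_compose[OF line' Ck_on_SucD(1)[OF C1 inS[OF that]]]
      Ck_on_der_linear[OF C1 inS[OF that]]
    by (simp add: has_field_derivative_def linear_cmul mult_commute_abs)
  \<comment> \<open>The second difference is the increment along \<open>h\<close> of the first
    difference along \<open>k\<close>; another mean value step along \<open>k\<close> then produces
    the mixed derivative.\<close>
  have "\<exists>z>0. z < t \<and> (f (x + t *\<^sub>R h + t *\<^sub>R k) - f (x + t *\<^sub>R h + 0 *\<^sub>R k)) -
      (f (x + 0 *\<^sub>R h + t *\<^sub>R k) - f (x + 0 *\<^sub>R h + 0 *\<^sub>R k)) =
      (t - 0) * (der f (x + z *\<^sub>R h + t *\<^sub>R k) h - der f (x + z *\<^sub>R h + 0 *\<^sub>R k) h)"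
    using t by (intro MVT2[where f = "\<lambda>s. f (x + s *\<^sub>R h + t *\<^sub>R k) - f (x + s *\<^sub>R h + 0 *\<^sub>R k)"] DERIV_diff D1) auto
  then obtain z where z: "0 < z" "z < t"
    "f (x + t *\<^sub>R h + t *\<^sub>R k) - f (x + t *\<^sub>R h) - f (x + t *\<^sub>R k) + f x =
      t * (der f (x + z *\<^sub>R h + t *\<^sub>R k) h - der f (x + z *\<^sub>R h + 0 *\<^sub>R k) h)"
    by auto
  have "\<exists>w>0. w < t \<and> der f (x + z *\<^sub>R h + t *\<^sub>R k) h - der f (x + z *\<^sub>R h + 0 *\<^sub>R k) h =
      (t - 0) * der (\<lambda>z. der f z h) (x + z *\<^sub>R h + w *\<^sub>R k) k"
    using t z by (intro MVT2 D2) auto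
  then obtain w where "0 < w" "w < t"
    "der f (x + z *\<^sub>R h + t *\<^sub>R k) h - der f (x + z *\<^sub>R h + 0 *\<^sub>R k) h =
      t * der (\<lambda>z. der f z h) (x + z *\<^sub>R h + w *\<^sub>R k) k"
    by auto
  with z near[of z w] show ?thesis by (intro exI[of _ "x + z *\<^sub>R h + w *\<^sub>R k"]) auto
qed

text \<open>The second difference is symmetric in \<open>h\<close> and \<open>k\<close>, so the two
  mixed derivatives share a value, attained at two points near \<open>x\<close>; continuity at
  \<open>x\<close> does the rest.\<close>

lemma second_derivative_symmetric_real:
  fixes f :: "'a::real_normed_vector \<Rightarrow> real"
  assumes "open S" "Ck_on (Suc (Suc 0)) S f" "x \<in> S"
  shows "der (\<lambda>z. der f z h) x k = der (\<lambda>z. der f z k) x h"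
proof (rule ccontr)
  define G where "G h k y = der (\<lambda>z. der f z h) y k" for h k y
  assume "\<not> ?thesis"
  then have ne: "G h k x \<noteq> G k h x" by (simp add: G_def)
  \<comment> \<open>Half the supposed gap: values at distance less than \<open>d\<close> from
    \<open>G h k x\<close> and from \<open>G k h x\<close> cannot coincide.\<close>
  define d where "d = \<bar>G h k x - G k h x\<bar> / 2"
  have "d > 0" using ne by (simp add: d_def)
  have "continuous_on S (G h k)" for h k
    using assms(2) unfolding G_def Ck_on.simps by blast
  then have cont: "isCont (G h k) x" for h k
    using assms continuous_on_eq_continuous_at by blast
  obtain e1 where e1: "e1 > 0" "\<And>y. dist y x < e1 \<Longrightarrow> dist (G h k y) (G h k x) < d"
    using cont \<open>d > 0\<close> unfolding continuous_at_eps_delta by blast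
  obtain e2 where e2: "e2 > 0" "\<And>y. dist y x < e2 \<Longrightarrow> dist (G k h y) (G k h x) < d"
    using cont \<open>d > 0\<close> unfolding continuous_at_eps_delta by blast
  obtain e3 where e3: "e3 > 0" "ball x e3 \<subseteq> S"
    using assms open_contains_ball by blast
  define e where "e = min e1 (min e2 e3)"
  \<comment> \<open>The summand 1 keeps the denominator positive when \<open>h\<close> and
    \<open>k\<close> vanish; the factor 2 makes the bound by \<open>e\<close> strict.\<close>
  define t where "t = e / (2 * (norm h + norm k + 1))"
  have e: "e > 0" "e \<le> e1" "e \<le> e2" "ball x e \<subseteq> S" using e1 e2 e3 by (auto simp: e_def)
  have "t > 0" using e(1) by (auto simp: t_def intro!: divide_pos_pos add_nonneg_pos mult_pos_pos)
  moreover have "t * (norm h + norm k) < e"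
  proof -
    have "t * (norm h + norm k) \<le> t * (norm h + norm k + 1)" using \<open>t > 0\<close> by simp
    also have "\<dots> = e / 2"
      using add_nonneg_pos[of "norm h + norm k" 1] by (simp add: t_def field_simps)
    finally show ?thesis using e(1) by simp
  qed
  moreover have "t * (norm k + norm h) < e"
    using calculation by (simp add: add.commute)
  ultimately obtain y z where
    y: "dist x y < e" "f (x + t *\<^sub>R h + t *\<^sub>R k) - f (x + t *\<^sub>R h) - f (x + t *\<^sub>R k) + f x = t * t * G h k y"
    and z: "dist x z < e" "f (x + t *\<^sub>R k + t *\<^sub>R h) - f (x + t *\<^sub>R k) - f (x + t *\<^sub>R h) + f x = t * t * G k h z"
    using second_difference_mvt[OF assms(2) e(4), of t h k] second_difference_mvt[OF assms(2) e(4), of t k h]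
    unfolding G_def by (meson order_le_less_trans)
  have "x + t *\<^sub>R k + t *\<^sub>R h = x + t *\<^sub>R h + t *\<^sub>R k" by simp
  then have "f (x + t *\<^sub>R k + t *\<^sub>R h) = f (x + t *\<^sub>R h + t *\<^sub>R k)" by (rule arg_cong)
  then have "t * t * G h k y = t * t * G k h z" using y(2) z(2) by linarith
  then have "G h k y = G k h z" using \<open>t > 0\<close> by simp
  moreover have "dist (G h k y) (G h k x) < d" "dist (G k h z) (G k h x) < d"
    using e1(2)[of y] e2(2)[of z] y(1) z(1) e(2,3) by (simp_all add: dist_commute[of x])
  ultimately show False unfolding d_def dist_real_def by (smt (verit) field_sum_of_halves)
qed

lemma second_derivative_symmetric:
  fixes f :: "'a::real_normed_vector \<Rightarrow> 'b::euclidean_space"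
  assumes "open S" "Ck_on (Suc (Suc 0)) S f" "x \<in> S"
  shows "der (\<lambda>z. der f z h) x k = der (\<lambda>z. der f z k) x h"
proof (rule euclidean_eqI)
  fix b :: 'b assume "b \<in> Basis"
  have C2: "Ck_on (Suc (Suc 0)) S (\<lambda>x. f x \<bullet> b)"
    using assms by (intro Ck_on_linear_image[where L = "\<lambda>v. v \<bullet> b"] bounded_linear_inner_left)
  have 1: "der (\<lambda>x. f x \<bullet> b) y h = der f y h \<bullet> b" if "y \<in> S" for y h
    using der_eq[OF bounded_linear.has_derivative[OF bounded_linear_inner_left[of b] Ck_on_SucD(1)[OF assms(2) that]]] by simp
  have 2: "der (\<lambda>z. der f z h \<bullet> b) x k = der (\<lambda>z. der f z h) x k \<bullet> b" for h k
    using der_eq[OF bounded_linear.has_derivative[OF bounded_linear_inner_left[of b] Ck_on_SucD(1)[OF Ck_on_SucD(2)[OF assms(2)] assms(3)]]]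
    by simp
  have "der (\<lambda>z. der (\<lambda>x. f x \<bullet> b) z h) x = der (\<lambda>z. der f z h \<bullet> b) x" for h
    using 1 by (intro der_cong[OF assms(1,3)]) auto
  then show "der (\<lambda>z. der f z h) x k \<bullet> b = der (\<lambda>z. der f z k) x h \<bullet> b"
    using second_derivative_symmetric_real[OF assms(1) C2 assms(3), of h k] by (simp add: 2)
qed

section \<open>Inverses of families of linear isomorphisms\<close>

lemma has_derivative_scaleR_vanishing:
  fixes \<phi> :: "'a::real_normed_vector \<Rightarrow> real" and m :: "'a \<Rightarrow> 'b::real_normed_vector"
  assumes \<phi>: "(\<phi> has_derivative A) (at x)" "\<phi> x = 0" and m: "isCont m x"
  shows "((\<lambda>y. \<phi> y *\<^sub>R m y) has_derivative (\<lambda>h. A h *\<^sub>R m x)) (at x)"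
proof -
  interpret A: bounded_linear A using \<phi>(1) has_derivative_bounded_linear by blast
  obtain B where B: "B > 0" "\<And>h. norm (A h) \<le> norm h * B" using A.pos_bounded by blast
  obtain d where d: "d > 0" "\<And>y. norm (y - x) < d \<Longrightarrow> norm (\<phi> y - \<phi> x - A (y - x)) \<le> 1 * norm (y - x)"
    using \<phi>(1) unfolding has_derivative_at_alt by (metis zero_less_one)
  \<comment> \<open>Here \<open>\<phi> y\<close> is bounded by a multiple of
    \<open>norm (y - x)\<close> while \<open>m y - m x\<close> tends to 0, so the product is
    negligible as soon as \<open>m\<close> is continuous.\<close>
  have "((\<lambda>y. \<phi> y *\<^sub>R (m y - m x)) has_derivative (\<lambda>h. 0)) (at x)"
    unfolding has_derivative_at_alt
  proof (intro conjI allI impI bounded_linear_zero)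
    fix e :: real assume "e > 0"
    then obtain d' where d': "d' > 0" "\<And>y. dist y x < d' \<Longrightarrow> dist (m y) (m x) < e / (B + 1)"
      using m B(1) unfolding continuous_at_eps_delta by (metis add_pos_pos divide_pos_pos zero_less_one)
    have "norm (\<phi> y *\<^sub>R (m y - m x)) \<le> e * norm (y - x)" if "norm (y - x) < min d d'" for y
    proof -
      \<comment> \<open>\<open>B\<close> bounds \<open>A\<close>, and the extra 1 is the tolerance
        with which \<open>d\<close> was chosen.\<close>
      have "\<bar>\<phi> y\<bar> \<le> (B + 1) * norm (y - x)"
        using d(2)[of y] B(2)[of "y - x"] that \<phi>(2) by (simp add: algebra_simps)
      moreover have "norm (m y - m x) \<le> e / (B + 1)"
        using d'(2)[of y] that by (simp add: dist_norm)
      ultimately have "\<bar>\<phi> y\<bar> * norm (m y - m x) \<le> ((B + 1) * norm (y - x)) * (e / (B + 1))"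
        using B(1) by (intro mult_mono) auto
      then show ?thesis using B(1) by (simp add: mult.commute)
    qed
    then show "\<exists>d>0. \<forall>y. norm (y - x) < d \<longrightarrow>
        norm (\<phi> y *\<^sub>R (m y - m x) - \<phi> x *\<^sub>R (m x - m x) - 0) \<le> e * norm (y - x)"
      using d(1) d'(1) by (intro exI[of _ "min d d'"]) auto
  qed
  from has_derivative_add[OF this has_derivative_scaleR_left[OF \<phi>(1), of "m x"]]
  show ?thesis by (simp add: algebra_simps)
qed

text \<open>For \<open>u = M x w - M x0 w\<close> the bound on \<open>M x0\<close> makes
  \<open>norm u\<close> at most \<open>C * norm (L x0 u)\<close>; replacing \<open>L x0\<close> by
  \<open>L x\<close> costs a small multiple of \<open>norm u\<close>, which is absorbed on the
  left.\<close>

lemma continuous_on_inverse_linear: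
  fixes L :: "'a::real_normed_vector \<Rightarrow> 'b::euclidean_space \<Rightarrow> 'c::euclidean_space"
  assumes "open S" "\<And>x. x \<in> S \<Longrightarrow> linear (L x)" "\<And>x. x \<in> S \<Longrightarrow> linear (M x)"
    and left_inv: "\<And>x v. x \<in> S \<Longrightarrow> M x (L x v) = v" and right_inv: "\<And>x w. x \<in> S \<Longrightarrow> L x (M x w) = w"
    and cont: "\<And>v. continuous_on S (\<lambda>x. L x v)"
  shows "continuous_on S (\<lambda>x. M x w)"
proof (intro continuous_at_imp_continuous_on ballI)
  fix x0 assume x0: "x0 \<in> S"
  \<comment> \<open>\<open>g x\<close> dominates the operator norm of \<open>L x - L x0\<close>, and
    it is continuous because it involves finitely many directions.\<close>
  define g where "g x = (\<Sum>b\<in>Basis. norm (L x b - L x0 b))" for x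
  have g: "norm (L x v - L x0 v) \<le> g x * norm v" if "x \<in> S" for x v
  proof -
    have "L x v - L x0 v = (\<Sum>b\<in>Basis. (v \<bullet> b) *\<^sub>R (L x b - L x0 b))"
      using linear_eq_sum_Basis[OF assms(2)[OF that], of v] linear_eq_sum_Basis[OF assms(2)[OF x0], of v]
      by (simp add: sum_subtractf scaleR_diff_right)
    also have "norm \<dots> \<le> (\<Sum>b\<in>Basis. norm v * norm (L x b - L x0 b))"
      by (rule sum_norm_le) (simp add: Basis_le_norm mult_right_mono)
    finally show ?thesis by (simp add: g_def sum_distrib_left mult.commute)
  qed
  have g0: "(g \<longlongrightarrow> 0) (at x0)"
  proof -
    have "continuous_on S g" unfolding g_def by (intro continuous_intros cont)
    then have "isCont g x0" using \<open>open S\<close> x0 continuous_on_eq_continuous_at by blast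
    then show ?thesis by (simp add: isCont_def g_def)
  qed
  obtain C where C: "C > 0" "\<And>v. norm (M x0 v) \<le> C * norm v"
    using linear_bounded_pos[OF assms(3)[OF x0]] by blast
  \<comment> \<open>Below the threshold \<open>1 / (2 * C)\<close> the absorbed term is at most half
    of the left-hand side.\<close>
  have ev: "\<forall>\<^sub>F x in at x0. x \<in> S \<and> g x < 1 / (2 * C)"
    using order_tendstoD(2)[OF g0, of "1 / (2 * C)"] C(1)
    by (intro eventually_conj eventually_at_in_open'[OF \<open>open S\<close> x0]) simp
  have bound: "norm (M x w - M x0 w) \<le> 2 * C * g x * norm (M x0 w)"
    if x: "x \<in> S" "g x < 1 / (2 * C)" for x
  proof -
    let ?u = "M x w - M x0 w"
    have "norm ?u = norm (M x0 (L x0 ?u))" using left_inv[OF x0] by simp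
    also have "\<dots> \<le> C * norm (L x0 ?u)" by (rule C)
    also have "\<dots> \<le> C * (norm (L x ?u) + g x * norm ?u)"
      using g[OF x(1), of ?u] C(1) norm_triangle_ineq2[of "L x0 ?u" "L x ?u"] norm_minus_commute[of "L x0 ?u" "L x ?u"]
      by (intro mult_left_mono) auto
    also have "\<dots> = C * norm (L x ?u) + (C * g x) * norm ?u" by (simp add: algebra_simps)
    also have "(C * g x) * norm ?u \<le> 1 / 2 * norm ?u"
      using x(2) C(1) by (intro mult_right_mono) (auto simp: field_simps)
    finally have "norm ?u \<le> 2 * C * norm (L x ?u)" by simp
    \<comment> \<open>Both \<open>L x (M x w)\<close> and \<open>L x0 (M x0 w)\<close> equal
      \<open>w\<close>, so only the variation of \<open>L\<close> on the fixed vector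
      \<open>M x0 w\<close> remains.\<close>
    also have "L x ?u = - (L x (M x0 w) - L x0 (M x0 w))"
      using right_inv[OF x(1)] right_inv[OF x0] assms(2)[OF x(1)] by (simp add: linear_diff)
    also have "norm \<dots> \<le> g x * norm (M x0 w)" using g[OF x(1)] by (simp del: minus_diff_eq)
    finally show ?thesis using C(1) by (simp add: mult_left_mono mult.assoc)
  qed
  have lim: "((\<lambda>x. 2 * C * g x * norm (M x0 w)) \<longlongrightarrow> 0) (at x0)"
    using tendsto_mult_left[OF g0, of "2 * C * norm (M x0 w)"] by (simp add: mult_ac)
  have "\<forall>\<^sub>F x in at x0. norm (M x w - M x0 w) \<le> 2 * C * g x * norm (M x0 w)"
    using ev by (rule eventually_mono) (simp add: bound)
  then have "((\<lambda>x. M x w - M x0 w) \<longlongrightarrow> 0) (at x0)"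
    using lim by (rule Lim_null_comparison)
  then show "isCont (\<lambda>x. M x w) x0" unfolding isCont_def by (rule LIM_zero_cancel)
qed

text \<open>From \<open>M y w - M x w = - M y (L y (M x w) - L x (M x w))\<close> the derivative is
  read off with \<open>M\<close> merely continuous at \<open>x\<close>. The resulting formula
  contains only \<open>M\<close> and derivatives of \<open>L\<close>, so each order of
  \<open>M\<close> yields the next.\<close>

lemma Ck_on_inverse_linear:
  fixes L :: "'a::real_normed_vector \<Rightarrow> 'b::euclidean_space \<Rightarrow> 'c::euclidean_space"
  assumes "open S" "\<And>x. x \<in> S \<Longrightarrow> linear (L x)" "\<And>x. x \<in> S \<Longrightarrow> linear (M x)"
    and left_inv: "\<And>x v. x \<in> S \<Longrightarrow> M x (L x v) = v" and right_inv: "\<And>x w. x \<in> S \<Longrightarrow> L x (M x w) = w"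
    and Ck: "\<And>v. Ck_on k S (\<lambda>x. L x v)"
  shows "Ck_on k S (\<lambda>x. M x w)"
  using Ck
proof (induction k arbitrary: w)
  case 0
  then show ?case using continuous_on_inverse_linear[OF assms(1-5)] by simp
next
  case (Suc k)
  let ?\<Lambda> = "\<lambda>h x u. der (\<lambda>y. L y u) x h"
  have IH: "Ck_on k S (\<lambda>x. M x w)" for w
    using Suc.IH[OF Ck_on_Suc_imp] Suc.prems by blast
  have Lder: "((\<lambda>y. L y u) has_derivative (\<lambda>h. ?\<Lambda> h x u)) (at x)" if "x \<in> S" for x u
    using Ck_on_SucD(1)[OF Suc.prems that] .
  have lin\<Lambda>: "linear (?\<Lambda> h x)" if "x \<in> S" for h x
  proof (rule linearI)
    fix u v c
    have "((\<lambda>y. L y u + L y v) has_derivative (\<lambda>h. ?\<Lambda> h x u + ?\<Lambda> h x v)) (at x)"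
      by (intro has_derivative_add Lder that)
    then have "((\<lambda>y. L y (u + v)) has_derivative (\<lambda>h. ?\<Lambda> h x u + ?\<Lambda> h x v)) (at x)"
      using has_derivative_cong_open[OF assms(1) that, of "\<lambda>y. L y (u + v)" "\<lambda>y. L y u + L y v"]
      by (simp add: assms(2) linear_add)
    from der_eq[OF this] show "?\<Lambda> h x (u + v) = ?\<Lambda> h x u + ?\<Lambda> h x v" by simp
    have "((\<lambda>y. c *\<^sub>R L y u) has_derivative (\<lambda>h. c *\<^sub>R ?\<Lambda> h x u)) (at x)"
      by (intro has_derivative_scaleR_right Lder that)
    then have "((\<lambda>y. L y (c *\<^sub>R u)) has_derivative (\<lambda>h. c *\<^sub>R ?\<Lambda> h x u)) (at x)"
      using has_derivative_cong_open[OF assms(1) that, of "\<lambda>y. L y (c *\<^sub>R u)" "\<lambda>y. c *\<^sub>R L y u"]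
      by (simp add: assms(2) linear_cmul)
    from der_eq[OF this] show "?\<Lambda> h x (c *\<^sub>R u) = c *\<^sub>R ?\<Lambda> h x u" by simp
  qed
  show ?case
  proof (rule Ck_on_SucI[where f' = "\<lambda>x h. - M x (?\<Lambda> h x (M x w))"])
    fix x assume x: "x \<in> S"
    let ?u = "M x w"
    \<comment> \<open>The coordinates of \<open>L y ?u - L x ?u\<close> vanish at
      \<open>y = x\<close>; they are the scalar factors in
      \<open>has_derivative_scaleR_vanishing\<close>, with \<open>M y b\<close> as the continuous
      factor.\<close>
    have "((\<lambda>y. M x w - (\<Sum>b\<in>Basis. ((L y ?u - L x ?u) \<bullet> b) *\<^sub>R M y b)) has_derivative
        (\<lambda>h. - (\<Sum>b\<in>Basis. (?\<Lambda> h x ?u \<bullet> b) *\<^sub>R M x b))) (at x)"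
    proof -
      have "isCont (\<lambda>y. M y b) x" for b
        using Ck_on_imp_continuous_on[OF IH] assms(1) x continuous_on_eq_continuous_at by blast
      moreover have "((\<lambda>y. (L y ?u - L x ?u) \<bullet> b) has_derivative (\<lambda>h. ?\<Lambda> h x ?u \<bullet> b)) (at x)" for b
        using bounded_linear.has_derivative[OF bounded_linear_inner_left[of b] has_derivative_diff[OF Lder[OF x] has_derivative_const[of "L x ?u"]]]
        by simp
      ultimately have "((\<lambda>y. ((L y ?u - L x ?u) \<bullet> b) *\<^sub>R M y b) has_derivative
          (\<lambda>h. (?\<Lambda> h x ?u \<bullet> b) *\<^sub>R M x b)) (at x)" for b
        by (intro has_derivative_scaleR_vanishing) auto
      from has_derivative_diff[OF has_derivative_const[of "M x w"] has_derivative_sum[OF this, where I = Basis]]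
      show ?thesis by simp
    qed
    moreover have "M x w - (\<Sum>b\<in>Basis. ((L y ?u - L x ?u) \<bullet> b) *\<^sub>R M y b) = M y w" if "y \<in> S" for y
    proof -
      have "(\<Sum>b\<in>Basis. ((L y ?u - L x ?u) \<bullet> b) *\<^sub>R M y b) = M y (L y ?u - L x ?u)"
        by (rule linear_eq_sum_Basis[OF assms(3)[OF that], symmetric])
      also have "\<dots> = M x w - M y w" using assms(3)[OF that] left_inv[OF that] right_inv[OF x] by (simp add: linear_diff)
      finally show ?thesis by simp
    qed
    moreover have "(\<Sum>b\<in>Basis. (?\<Lambda> h x ?u \<bullet> b) *\<^sub>R M x b) = M x (?\<Lambda> h x ?u)" for h
      by (rule linear_eq_sum_Basis[OF assms(3)[OF x], symmetric])
    ultimately show "((\<lambda>x. M x w) has_derivative (\<lambda>h. - M x (?\<Lambda> h x (M x w)))) (at x)"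
      using has_derivative_cong_open[OF assms(1) x, of "\<lambda>y. M x w - (\<Sum>b\<in>Basis. ((L y ?u - L x ?u) \<bullet> b) *\<^sub>R M y b)" "\<lambda>x. M x w"]
      by simp
  next
    fix h
    have "Ck_on k S (\<lambda>x. ?\<Lambda> h x (M x w))"
      by (rule Ck_on_linear_apply[where L = "?\<Lambda> h"])
         (rule assms(1) IH lin\<Lambda> Ck_on_SucD(2)[OF Suc.prems] | assumption)+
    then have "Ck_on k S (\<lambda>x. M x (?\<Lambda> h x (M x w)))"
      using Ck_on_linear_apply[where L = M and v = "\<lambda>x. ?\<Lambda> h x (M x w)", OF assms(1) assms(3) IH]
      by blast
    then show "Ck_on k S (\<lambda>x. - M x (?\<Lambda> h x (M x w)))"
      by (rule Ck_on_minus[OF assms(1)])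
  qed (rule assms(1))
qed

text \<open>On a finite-dimensional domain, continuity on basis vectors is continuity in the
  operator norm. The inverse function theorem and the uniform estimates below are phrased in that
  norm.\<close>

lemma Ck_on_imp_continuous_on_Blinfun:
  fixes g :: "'a::euclidean_space \<Rightarrow> 'b::real_normed_vector"
  assumes "Ck_on (Suc 0) S g"
  shows "continuous_on S (\<lambda>x. Blinfun (der g x))"
proof (rule continuous_on_blinfun_componentwise)
  fix i :: 'a
  have "bounded_linear (der g x)" if "x \<in> S" for x
    using Ck_on_SucD(1)[OF assms that] has_derivative_bounded_linear by blast
  moreover have "continuous_on S (\<lambda>x. der g x i)"
    using Ck_on_SucD(2)[OF assms] by simp
  ultimately show "continuous_on S (\<lambda>x. blinfun_apply (Blinfun (der g x)) i)"
    by (simp add: bounded_linear_Blinfun_apply cong: continuous_on_cong)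
qed

section \<open>Smooth inverse function theorem and local diffeomorphisms\<close>

lemma smooth_local_diffeo:
  fixes g :: "'a::euclidean_space \<Rightarrow> 'a"
  assumes "open S" and g: "smooth_on S g" and x0: "x0 \<in> S" and inj: "inj (der g x0)"
  obtains U where "open U" "x0 \<in> U" "U \<subseteq> S" "diffeo_on U g"
proof -
  have bl: "bounded_linear (der g x)" if "x \<in> S" for x
    using smooth_on_has_derivative[OF g that] has_derivative_bounded_linear by blast
  have lin: "linear (der g x)" if "x \<in> S" for x
    using smooth_on_linear_der[OF g that] .
  obtain L where L: "linear L" "\<And>v. L (der g x0 v) = v"
    using linear_injective_left_inverse[OF lin[OF x0] inj] by (auto simp: fun_eq_iff)
  obtain U V h h' where U: "open U" "U \<subseteq> S" "x0 \<in> U" "open V" "g x0 \<in> V"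
    and hom: "homeomorphism U V g h"
    and h: "\<And>y. y \<in> V \<Longrightarrow> (h has_derivative h' y) (at y)"
      "\<And>y. y \<in> V \<Longrightarrow> h' y = inv (Blinfun (der g (h y)))"
      "\<And>y. y \<in> V \<Longrightarrow> bij (Blinfun (der g (h y)))"
  proof (rule inverse_function_theorem[of S g "\<lambda>x. Blinfun (der g x)" x0 "Blinfun L"])
    show "(g has_derivative blinfun_apply (Blinfun (der g x))) (at x)" if "x \<in> S" for x
      using smooth_on_has_derivative[OF g that] bl[OF that] by (simp add: bounded_linear_Blinfun_apply)
    show "continuous_on S (\<lambda>x. Blinfun (der g x))"
      using smooth_onD[OF g] by (rule Ck_on_imp_continuous_on_Blinfun)
    show "Blinfun L o\<^sub>L Blinfun (der g x0) = id_blinfun"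
      using L bl[OF x0] by (intro blinfun_eqI) (simp add: bounded_linear_Blinfun_apply linear_conv_bounded_linear)
  qed (use assms in auto)
  have hV: "h y \<in> S" if "y \<in> V" for y
    using hom that U(2) by (auto simp: homeomorphism_def)
  have h': "h' y = inv (der g (h y))" "bij (der g (h y))" if "y \<in> V" for y
    using h(2,3)[OF that] bl[OF hV[OF that]] by (simp_all add: bounded_linear_Blinfun_apply)
  \<comment> \<open>Bootstrapping: the derivative of \<open>h\<close> at \<open>y\<close> is the
    inverse of \<open>der g (h y)\<close>, so the order already known for \<open>h\<close> passes to
    its derivative, which raises the order of \<open>h\<close> by one.\<close>
  have "Ck_on k V h" for k
  proof (induction k)
    case 0
    then show ?case using hom by (simp add: homeomorphism_def)
  next
    case (Suc k)
    show ?case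
    proof (rule Ck_on_SucI[OF U(4) h(1)])
      fix w
      show "Ck_on k V (\<lambda>y. h' y w)"
      proof (rule Ck_on_inverse_linear[where L = "\<lambda>y. der g (h y)"])
        show "linear (h' y)" if "y \<in> V" for y
          using h(1)[OF that] has_derivative_linear by blast
        show "h' y (der g (h y) v) = v" "der g (h y) (h' y v) = v" if "y \<in> V" for y v
          using h'[OF that] by (simp_all add: bij_is_inj bij_is_surj surj_f_inv_f)
        show "Ck_on k V (\<lambda>y. der g (h y) v)" for v
          by (rule Ck_on_compose[OF U(4) \<open>open S\<close>])
             (use hV Suc smooth_onD[OF smooth_on_der[OF g]] in auto)
      qed (use U hV lin in auto)
    qed
  qed
  moreover have "g ` U = V" using hom by (simp add: homeomorphism_def)
  moreover have "inj_on g U" using hom by (auto simp: homeomorphism_def inj_on_def) metis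
  moreover have "inv_into U g y = h y" if "y \<in> V" for y
    using hom that \<open>inj_on g U\<close> by (auto simp: homeomorphism_def intro!: inv_into_f_eq)
  ultimately have "diffeo_on U g"
    using U smooth_on_subset[OF g U(2)] smooth_on_cong[OF U(4), of "inv_into U g" h]
    by (auto simp: diffeo_on_def smooth_on_def)
  with that U show ?thesis by blast
qed

lemma diffeo_on_subset:
  fixes g :: "'a::euclidean_space \<Rightarrow> 'b::euclidean_space"
  assumes "diffeo_on U g" "open V" "V \<subseteq> U"
  shows "diffeo_on V g"
proof -
  have U: "open U" "smooth_on U g" "inj_on g U" "open (g ` U)" "smooth_on (g ` U) (inv_into U g)"
    using assms(1) by (auto simp: diffeo_on_def)
  have *: "inv_into V g y = inv_into U g y" if "y \<in> g ` V" for y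
    using that assms(3) U(3) by (auto simp: inv_into_f_f inj_on_subset subset_iff)
  \<comment> \<open>The image is open because it is a preimage under the continuous inverse.\<close>
  have "g ` V = inv_into U g -` V \<inter> g ` U"
    using assms(3) U(3) by (auto simp: inv_into_f_f subset_iff image_iff)
  moreover have "open (inv_into U g -` V \<inter> g ` U)"
    using continuous_open_preimage[OF smooth_on_imp_continuous_on[OF U(5)] U(4) assms(2)]
    by (simp add: Int_commute)
  ultimately have "open (g ` V)" by simp
  then show ?thesis
    using assms U smooth_on_cong[of "g ` V", OF _ *] smooth_on_subset[OF U(5), of "g ` V"]
      smooth_on_subset[OF U(2) assms(3)] inj_on_subset[OF U(3) assms(3)]
    by (auto simp: diffeo_on_def)
qed

lemma diffeo_on_derivative_inverse:
  fixes g :: "'a::euclidean_space \<Rightarrow> 'b::euclidean_space"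
  assumes "diffeo_on U g" "x \<in> U"
  shows "der (inv_into U g) (g x) (der g x v) = v"
    and "der g x (der (inv_into U g) (g x) w) = w"
proof -
  let ?h = "inv_into U g"
  have U: "open U" "smooth_on U g" "inj_on g U" "open (g ` U)" "smooth_on (g ` U) (inv_into U g)"
    using assms(1) by (auto simp: diffeo_on_def)
  have dg: "(g has_derivative der g x) (at x)" and dh: "(?h has_derivative der ?h (g x)) (at (g x))"
    using smooth_on_has_derivative[OF U(2) assms(2)] smooth_on_has_derivative[OF U(5)] assms(2) by auto
  have "((\<lambda>y. ?h (g y)) has_derivative (\<lambda>v. der ?h (g x) (der g x v))) (at x)"
    using has_derivative_compose[OF dg dh] .
  then have "((\<lambda>y. y) has_derivative (\<lambda>v. der ?h (g x) (der g x v))) (at x)"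
    using has_derivative_cong_open[OF U(1) assms(2), of "\<lambda>y. ?h (g y)" "\<lambda>y. y"] U(3)
    by (simp add: inv_into_f_f)
  from has_derivative_unique[OF this has_derivative_ident]
  show "der ?h (g x) (der g x v) = v" by (simp add: fun_eq_iff)
  have hgx: "?h (g x) = x" using U(3) assms(2) by simp
  have "((\<lambda>y. g (?h y)) has_derivative (\<lambda>v. der g x (der ?h (g x) v))) (at (g x))"
    using has_derivative_compose[OF dh, of g "der g x"] dg hgx by simp
  then have "((\<lambda>y. y) has_derivative (\<lambda>v. der g x (der ?h (g x) v))) (at (g x))"
    using has_derivative_cong_open[OF U(4), of "g x" "\<lambda>y. g (?h y)" "\<lambda>y. y"] assms(2)
    by (simp add: f_inv_into_f)
  from has_derivative_unique[OF this has_derivative_ident]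
  show "der g x (der ?h (g x) w) = w" by (simp add: fun_eq_iff)
qed

section \<open>Integral equations along rays\<close>

lemma norm_has_integral_unit_le:
  fixes f :: "real \<Rightarrow> 'a::real_normed_vector"
  assumes "(f has_integral i) {0..1}" "\<And>t. t \<in> {0..1} \<Longrightarrow> norm (f t) \<le> B"
  shows "norm i \<le> B"
proof -
  have "0 \<le> norm (f 0)" "norm (f 0) \<le> B" using assms(2)[of 0] by simp_all
  then have "0 \<le> B" by (rule order_trans)
  then show ?thesis using has_integral_bound[of B f i 0 1] assms by simp
qed

lemma norm_integral_unit_le:
  fixes f :: "real \<Rightarrow> 'a::banach"
  assumes "continuous_on {0..1} f" "\<And>t. t \<in> {0..1} \<Longrightarrow> norm (f t) \<le> B"
  shows "norm (integral {0..1} f) \<le> B"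
  using norm_has_integral_unit_le[OF integrable_integral[OF integrable_continuous_interval[OF assms(1)]]]
    assms(2) .

lemma norm_le_of_diff: "norm (a - b) \<le> x \<Longrightarrow> norm b \<le> y \<Longrightarrow> norm a \<le> x + y"
  using norm_triangle_sub[of a b] by simp

text \<open>At a maximum point the hypothesis bounds the maximum by \<open>a\<close> plus
  \<open>c\<close> times itself. This takes the place of Gronwall's inequality: for a quantity given
  by an integral along rays, the integrand involves the same quantity at other points of
  \<open>K\<close>.\<close>

lemma sup_contraction_bound:
  fixes \<phi> :: "'a::topological_space \<Rightarrow> real"
  assumes "compact K" "continuous_on K \<phi>" "c < 1" "x \<in> K"
    and "\<And>M y. (\<And>z. z \<in> K \<Longrightarrow> \<phi> z \<le> M) \<Longrightarrow> y \<in> K \<Longrightarrow> \<phi> y \<le> a + c * M"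
  shows "\<phi> x \<le> a / (1 - c)"
proof -
  obtain y where y: "y \<in> K" "\<And>z. z \<in> K \<Longrightarrow> \<phi> z \<le> \<phi> y"
    using continuous_attains_sup[of K \<phi>] assms(1,2,4) by blast
  then have "\<phi> y \<le> a + c * \<phi> y" by (intro assms(5)) auto
  then have "\<phi> y \<le> a / (1 - c)" using assms(3) by (simp add: field_simps)
  with y(2)[OF assms(4)] show ?thesis by simp
qed

text \<open>Only the base point \<open>x\<close> lies in \<open>K\<close>. Uniformity comes from
  uniform continuity of the derivative on a compact neighbourhood of \<open>K\<close>, fed into the
  mean value inequality on balls.\<close>

lemma C1_uniformly_differentiable:
  fixes H :: "'a::euclidean_space \<Rightarrow> 'b::real_normed_vector"
  assumes "open S" "Ck_on (Suc 0) S H" "compact K" "K \<subseteq> S" "\<epsilon> > 0"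
  obtains \<delta> where "\<delta> > 0"
    "\<And>x y. x \<in> K \<Longrightarrow> norm (y - x) \<le> \<delta> \<Longrightarrow> norm (H y - H x - der H x (y - x)) \<le> \<epsilon> * norm (y - x)"
proof -
  obtain e where e: "e > 0" "(\<Union>x\<in>K. cball x e) \<subseteq> S"
    using compact_subset_open_imp_cball_epsilon_subset assms by metis
  define K' where "K' = {x + y | x y. x \<in> K \<and> y \<in> cball 0 e}"
  have "compact K'" unfolding K'_def using assms(3) by (intro compact_sums) auto
  have K'e: "y \<in> K'" if "x \<in> K" "norm (y - x) \<le> e" for x y
    unfolding K'_def by (rule CollectI, rule exI[of _ x], rule exI[of _ "y - x"]) (use that in auto)
  have "K' \<subseteq> S" using e(2) unfolding K'_def by (force simp: dist_norm)
  let ?B = "\<lambda>x. Blinfun (der H x)"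
  have "uniformly_continuous_on K' ?B"
    using Ck_on_imp_continuous_on_Blinfun[OF assms(2)] \<open>K' \<subseteq> S\<close> \<open>compact K'\<close>
    by (intro compact_uniformly_continuous) (auto intro: continuous_on_subset)
  then obtain d where d: "d > 0"
    "\<And>x y. x \<in> K' \<Longrightarrow> y \<in> K' \<Longrightarrow> dist y x < d \<Longrightarrow> dist (?B y) (?B x) < \<epsilon>"
    unfolding uniformly_continuous_on_def using assms(5) by metis
  \<comment> \<open>The minimum with \<open>e\<close> keeps balls around points of \<open>K\<close>
    inside \<open>K'\<close>; halving \<open>d\<close> turns the bound for a closed ball into a
    strict one.\<close>
  define \<delta> where "\<delta> = min e (d / 2)"
  have bl: "bounded_linear (der H x)" if "x \<in> S" for x
    using Ck_on_SucD(1)[OF assms(2) that] has_derivative_bounded_linear by blast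
  have "norm (H y - H x - der H x (y - x)) \<le> \<epsilon> * norm (y - x)"
    if x: "x \<in> K" and y: "norm (y - x) \<le> \<delta>" for x y
  proof -
    have inK': "z \<in> K'" if "z \<in> cball x \<delta>" for z
      using that x by (intro K'e[of x]) (auto simp: \<delta>_def dist_norm norm_minus_commute)
    have "\<delta> > 0" using e d by (simp add: \<delta>_def)
    have "norm (H y - H x - der H x (y - x)) \<le> norm (y - x) * \<epsilon>"
    proof (rule differentiable_bound_linearization[where S = "cball x \<delta>"])
      fix t :: real assume t: "t \<in> {0..1}"
      have "t * norm (y - x) \<le> norm (y - x)" using t by (simp add: mult_left_le_one_le)
      then show "x + t *\<^sub>R (y - x) \<in> cball x \<delta>" using y t by (simp add: dist_norm)
    next
      fix z assume z: "z \<in> cball x \<delta>"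
      show "(H has_derivative der H z) (at z within cball x \<delta>)"
        using Ck_on_SucD(1)[OF assms(2)] inK'[OF z] \<open>K' \<subseteq> S\<close> has_derivative_at_withinI by blast
      have xz: "x \<in> K'" "z \<in> K'" using inK'[of x] inK'[OF z] \<open>\<delta> > 0\<close> by auto
      have "dist z x < d" using z d(1) by (auto simp: \<delta>_def dist_commute)
      then have "norm (?B z - ?B x) < \<epsilon>" using d(2)[OF xz] by (simp add: dist_norm)
      moreover have "blinfun_apply (?B z - ?B x) = der H z - der H x"
        using bl xz \<open>K' \<subseteq> S\<close> by (auto simp: fun_eq_iff blinfun.diff_left bounded_linear_Blinfun_apply subset_iff)
      ultimately show "onorm (der H z - der H x) \<le> \<epsilon>" by (simp add: norm_blinfun.rep_eq)
    qed (use \<open>\<delta> > 0\<close> in auto)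
    then show ?thesis by (simp add: mult.commute)
  qed
  moreover have "\<delta> > 0" using e d by (simp add: \<delta>_def)
  ultimately show ?thesis using that by blast
qed

lemma open_Collect_mem_continuous:
  assumes "open T" "continuous_on UNIV f"
  shows "open {x. f x \<in> T}"
  using open_vimage[OF assms] by (simp add: vimage_def)

text \<open>Serves to read off a single directional derivative where the map is affine on a line,
  without differentiating the whole expression.\<close>

lemma has_derivative_affine_direction:
  assumes "(f has_derivative f') (at x)" "open S" "x \<in> S"
    and affine: "\<And>t::real. x + t *\<^sub>R w \<in> S \<Longrightarrow> f (x + t *\<^sub>R w) = f x + t *\<^sub>R b"
  shows "f' w = b"
proof -
  have "((\<lambda>t::real. x + t *\<^sub>R w) has_derivative (\<lambda>t. t *\<^sub>R w)) (at 0)"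
    by (auto intro!: derivative_eq_intros)
  from has_derivative_compose[OF this, of f f'] assms(1)
  have "((\<lambda>t. f (x + t *\<^sub>R w)) has_derivative (\<lambda>t. f' (t *\<^sub>R w))) (at 0)" by simp
  moreover have "open {t::real. x + t *\<^sub>R w \<in> S}"
    using assms(2) by (intro open_Collect_mem_continuous continuous_intros)
  ultimately have "((\<lambda>t. f x + t *\<^sub>R b) has_derivative (\<lambda>t. f' (t *\<^sub>R w))) (at 0)"
    using has_derivative_cong_open[of "{t. x + t *\<^sub>R w \<in> S}" 0 "\<lambda>t. f (x + t *\<^sub>R w)" "\<lambda>t. f x + t *\<^sub>R b"]
      assms(3) affine by auto
  moreover have "((\<lambda>t::real. f x + t *\<^sub>R b) has_derivative (\<lambda>t. t *\<^sub>R b)) (at 0)"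
    by (auto intro!: derivative_eq_intros)
  ultimately have "(\<lambda>t. f' (t *\<^sub>R w)) = (\<lambda>t. t *\<^sub>R b)" by (rule has_derivative_unique)
  from fun_cong[OF this, of 1] show ?thesis by simp
qed

lemma Ck_on_mono: "j \<le> k \<Longrightarrow> Ck_on k S f \<Longrightarrow> Ck_on j S f"
  by (induction k rule: dec_induct) (auto intro: Ck_on_Suc_imp simp del: Ck_on.simps(2))

text \<open>An orthogonal projection in abstract form: its kernel carries initial values, its range
  carries parameters. The two norm conditions make balls around 0 stable under rays.\<close>

locale splitting =
  fixes \<pi> :: "'p::euclidean_space \<Rightarrow> 'p"
  assumes linear_proj: "linear \<pi>"
    and proj_proj: "\<pi> (\<pi> q) = \<pi> q"
    and norm_proj_le: "norm (\<pi> q) \<le> norm q"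
    and norm_compl_le: "norm (q - \<pi> q) \<le> norm q"
begin

text \<open>For \<open>s\<close> from 0 to 1, \<open>\<sigma> s q\<close> runs from the component of \<open>q\<close> in the kernel of \<open>\<pi>\<close> to \<open>q\<close>. A curve
  \<open>s \<mapsto> Z (\<sigma> s q)\<close> is thus an integral curve whose initial value and parameters are both encoded in \<open>q\<close>.\<close>

definition \<sigma> :: "real \<Rightarrow> 'p \<Rightarrow> 'p" where
  "\<sigma> s q = q - \<pi> q + s *\<^sub>R \<pi> q"

lemma bounded_linear_proj: "bounded_linear \<pi>"
  using linear_proj linear_conv_bounded_linear by blast

lemma linear_ray: "linear (\<sigma> s)"
  unfolding \<sigma>_def
  by (rule linearI) (simp_all add: linear_add[OF linear_proj] linear_cmul[OF linear_proj] algebra_simps)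

lemma ray_add: "\<sigma> s (p + q) = \<sigma> s p + \<sigma> s q"
  using linear_ray linear_add by blast

lemma proj_ray: "\<pi> (\<sigma> s q) = s *\<^sub>R \<pi> q"
  unfolding \<sigma>_def by (simp add: linear_add[OF linear_proj] linear_diff[OF linear_proj] linear_cmul[OF linear_proj] proj_proj)

lemma ray_one: "\<sigma> 1 q = q"
  by (simp add: \<sigma>_def)

lemma norm_ray_le: "s \<in> {0..1} \<Longrightarrow> norm (\<sigma> s q) \<le> norm q"
proof -
  assume s: "s \<in> {0..1}"
  \<comment> \<open>A convex combination of \<open>q\<close> and \<open>q - \<pi> q\<close>, neither
    of which is longer than \<open>q\<close>.\<close>
  have "\<sigma> s q = s *\<^sub>R q + (1 - s) *\<^sub>R (q - \<pi> q)" by (simp add: \<sigma>_def algebra_simps)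
  also have "norm \<dots> \<le> s * norm q + (1 - s) * norm (q - \<pi> q)"
    using s norm_triangle_ineq[of "s *\<^sub>R q" "(1 - s) *\<^sub>R (q - \<pi> q)"] by simp
  also have "\<dots> \<le> s * norm q + (1 - s) * norm q"
    using s norm_compl_le by (intro add_left_mono mult_left_mono) auto
  finally show ?thesis by (simp add: algebra_simps)
qed

lemma ray_in_cball: "s \<in> {0..1} \<Longrightarrow> q \<in> cball 0 r \<Longrightarrow> \<sigma> s q \<in> cball 0 r"
  using norm_ray_le[of s q] by simp

lemma ray_in_ball: "s \<in> {0..1} \<Longrightarrow> q \<in> ball 0 r \<Longrightarrow> \<sigma> s q \<in> ball 0 r"
  using norm_ray_le[of s q] by simp

lemma continuous_on_ray [continuous_intros]:
  assumes "continuous_on S f" "continuous_on S g"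
  shows "continuous_on S (\<lambda>x. \<sigma> (f x) (g x))"
  unfolding \<sigma>_def
  by (intro continuous_intros bounded_linear.continuous_on[OF bounded_linear_proj] assms)

lemma ray_fixpoint_exists:
  fixes G :: "real \<Rightarrow> 'p \<Rightarrow> 'w::banach \<Rightarrow> 'w"
  assumes "0 \<le> r" "0 \<le> \<rho>"
    and cont: "continuous_on ({0..1} \<times> cball 0 r \<times> cball w0 \<rho>) (\<lambda>(s, q, w). G s q w)"
    and bound: "\<And>s q w. s \<in> {0..1} \<Longrightarrow> q \<in> cball 0 r \<Longrightarrow> w \<in> cball w0 \<rho> \<Longrightarrow> norm (G s q w - w0) \<le> \<rho>"
    and lip: "\<And>s q w w'. s \<in> {0..1} \<Longrightarrow> q \<in> cball 0 r \<Longrightarrow> w \<in> cball w0 \<rho> \<Longrightarrow> w' \<in> cball w0 \<rho> \<Longrightarrow>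
        norm (G s q w - G s q w') \<le> norm (w - w') / 2"
  obtains V where "continuous_on (cball 0 r) V" "\<And>q. q \<in> cball 0 r \<Longrightarrow> V q \<in> cball w0 \<rho>"
    "\<And>q. q \<in> cball 0 r \<Longrightarrow> V q = integral {0..1} (\<lambda>s. G s q (V (\<sigma> s q)))"
proof -
  \<comment> \<open>Bounded continuous functions live on the whole space; the retraction
    \<open>c\<close> onto the ball lets \<open>G\<close> be evaluated only where its hypotheses
    hold.\<close>
  define c where "c = closest_point (cball (0::'p) r)"
  have c: "continuous_on UNIV c" "\<And>q. c q \<in> cball 0 r" "\<And>q. q \<in> cball 0 r \<Longrightarrow> c q = q"
    unfolding c_def using assms(1) continuous_on_closest_point[of "cball (0::'p) r"]
      closest_point_in_set[of "cball (0::'p) r"] closest_point_self[of _ "cball (0::'p) r"]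
    by (auto simp del: mem_cball)
  define A where "A = {V :: 'p \<Rightarrow>\<^sub>C 'w. \<forall>q. V q \<in> cball w0 \<rho>}"
  define I where "I V q s = G s (c q) (apply_bcontfun V (\<sigma> s (c q)))" for V q s
  define F where "F V q = integral {0..1} (I V q)" for V q
  have contI2: "continuous_on (UNIV \<times> cbox 0 1) (\<lambda>(q, s). I V q s)" if "V \<in> A" for V
  proof -
    have "continuous_on (UNIV \<times> {0..1}) (\<lambda>x. (\<lambda>(s, q, w). G s q w) (snd x, c (fst x), V (\<sigma> (snd x) (c (fst x)))))"
      by (rule continuous_on_compose2[OF cont])
         (use c that in \<open>auto intro!: continuous_intros continuous_on_compose2[OF continuous_on_apply_bcontfun]
            continuous_on_compose2[OF c(1)] simp: A_def simp del: mem_cball\<close>)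
    then show ?thesis by (simp add: I_def case_prod_unfold)
  qed
  have contI: "continuous_on {0..1} (I V q)" if "V \<in> A" for V q
  proof -
    have "continuous_on {0..1} (\<lambda>s. (\<lambda>(q, s). I V q s) (q, s))"
      by (rule continuous_on_compose2[OF contI2[OF that]]) (auto intro!: continuous_intros)
    then show ?thesis by simp
  qed
  have intI: "I V q integrable_on {0..1}" if "V \<in> A" for V q
    using contI[OF that] integrable_continuous_interval by blast
  have FA: "F V q \<in> cball w0 \<rho>" if "V \<in> A" for V q
  proof -
    have "norm (integral {0..1} (\<lambda>s. I V q s - w0)) \<le> \<rho>"
      using that c by (intro norm_integral_unit_le continuous_intros contI)
        (auto simp: I_def A_def intro!: bound simp del: mem_cball)
    also have "integral {0..1} (\<lambda>s. I V q s - w0) = F V q - w0"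
      using intI[OF that] by (subst integral_diff) (auto simp: F_def)
    finally show ?thesis by (simp add: dist_norm norm_minus_commute)
  qed
  have Fb: "F V \<in> bcontfun" if "V \<in> A" for V
  proof -
    have "continuous_on UNIV (F V)"
      unfolding F_def using integral_continuous_on_param[OF contI2[OF that]] by simp
    moreover have "bounded (range (F V))"
      using FA[OF that] bounded_subset[OF bounded_cball] by (metis image_subsetI)
    ultimately show ?thesis by (simp add: bcontfun_def)
  qed
  define T where "T V = Bcontfun (F V)" for V
  have T: "apply_bcontfun (T V) = F V" if "V \<in> A" for V
    unfolding T_def using Fb[OF that] by (rule Bcontfun_inverse)
  \<comment> \<open>The constraint is pointwise, and evaluation at a point is continuous in the sup
    metric.\<close>
  have "closed A"
  proof -
    have "closed ((\<lambda>V. apply_bcontfun V q) -` cball w0 \<rho>)" for q :: 'p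
    proof (intro continuous_closed_vimage closed_cball)
      show "isCont (\<lambda>V. apply_bcontfun V q) V" for V :: "'p \<Rightarrow>\<^sub>C 'w"
        unfolding continuous_at_eps_delta using dist_bounded order_le_less_trans by blast
    qed
    moreover have "A = (\<Inter>q. (\<lambda>V. apply_bcontfun V q) -` cball w0 \<rho>)"
      unfolding A_def by auto
    ultimately show ?thesis by (auto intro!: closed_INT)
  qed
  then have "complete A" by (simp add: complete_eq_closed)
  moreover have "const_bcontfun w0 \<in> A" using assms(2) by (simp add: A_def)
  moreover have "T ` A \<subseteq> A" using T FA by (auto simp: A_def)
  moreover have "dist (T V) (T V') \<le> 1 / 2 * dist V V'" if "V \<in> A" "V' \<in> A" for V V'
  proof (rule dist_bound)
    fix q
    have "norm (integral {0..1} (\<lambda>s. I V q s - I V' q s)) \<le> 1 / 2 * dist V V'"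
    proof (intro norm_integral_unit_le continuous_intros contI that)
      fix s :: real assume s: "s \<in> {0..1}"
      have "norm (I V q s - I V' q s) \<le> norm (V (\<sigma> s (c q)) - V' (\<sigma> s (c q))) / 2"
        unfolding I_def using s c that by (intro lip) (auto simp: A_def simp del: mem_cball)
      also have "\<dots> \<le> 1 / 2 * dist V V'" using dist_bounded[of V _ V'] by (simp add: dist_norm)
      finally show "norm (I V q s - I V' q s) \<le> 1 / 2 * dist V V'" .
    qed
    also have "integral {0..1} (\<lambda>s. I V q s - I V' q s) = T V q - T V' q"
      using intI that by (subst integral_diff) (auto simp: F_def T)
    finally show "dist (T V q) (T V' q) \<le> 1 / 2 * dist V V'" by (simp add: dist_norm)
  qed
  ultimately have "\<exists>!V\<in>A. T V = V"
    by (intro Banach_fix[where c = "1 / 2"]) auto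
  then obtain V where V: "V \<in> A" "T V = V" by blast
  show ?thesis
  proof (rule that[of "apply_bcontfun V"])
    show "apply_bcontfun V q = integral {0..1} (\<lambda>s. G s q (V (\<sigma> s q)))" if "q \<in> cball 0 r" for q
    proof -
      have "apply_bcontfun V q = F V q" using T[OF V(1)] V(2) by metis
      also have "\<dots> = integral {0..1} (\<lambda>s. G s q (V (\<sigma> s q)))"
        unfolding F_def I_def c(3)[OF that] ..
      finally show ?thesis .
    qed
  qed (use V in \<open>auto simp: A_def simp del: mem_cball\<close>)
qed


text \<open>The set \<open>\<Omega>\<close> is an open domain of \<open>H\<close>, so that
  derivatives over the closed ball make sense. The last clause keeps the linearised equations
  contractions with the same constant 1/2. The slot \<open>s\<close> serves these linearised
  equations, whose coefficients depend on the point of the ray.\<close>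

definition ray_solution ::
  "real \<Rightarrow> (real \<times> 'p \<times> 'z::euclidean_space) set \<Rightarrow> (real \<times> 'p \<times> 'z \<Rightarrow> 'z) \<Rightarrow> ('p \<Rightarrow> 'z) \<Rightarrow> bool" where
  "ray_solution r \<Omega> H Z \<longleftrightarrow> open \<Omega> \<and> continuous_on (cball 0 r) Z \<and>
     (\<forall>s\<in>{0..1}. \<forall>q\<in>cball 0 r. (s, q, Z (\<sigma> s q)) \<in> \<Omega>) \<and>
     (\<forall>q\<in>cball 0 r. Z q = integral {0..1} (\<lambda>s. H (s, q, Z (\<sigma> s q)))) \<and>
     (\<forall>s\<in>{0..1}. \<forall>q\<in>cball 0 r. \<forall>v. norm (der H (s, q, Z (\<sigma> s q)) (0, 0, v)) \<le> norm v / 2)"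

text \<open>The candidate \<open>V\<close> is the fixed point of the formally differentiated
  equation. To see that it is the derivative, first the increment \<open>\<Delta> q h\<close> and
  then the error \<open>\<Delta> q h - V q h\<close> are bounded by their own suprema over a compact
  set of pairs that is stable under rays.\<close>

lemma ray_solution_C1:
  fixes Z :: "'p \<Rightarrow> 'z::euclidean_space"
  assumes sol: "ray_solution r \<Omega> H Z" and C1: "Ck_on (Suc 0) \<Omega> H" and "0 \<le> r"
  obtains V :: "'p \<Rightarrow> 'p \<Rightarrow>\<^sub>L 'z" where "continuous_on (cball 0 r) V"
    "\<And>q. q \<in> ball 0 r \<Longrightarrow> (Z has_derivative V q) (at q)"
    "\<And>q h. q \<in> cball 0 r \<Longrightarrow>
       ((\<lambda>s. der H (s, q, Z (\<sigma> s q)) (0, h, V (\<sigma> s q) (\<sigma> s h))) has_integral V q h) {0..1}"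
proof -
  let ?x = "\<lambda>s q. (s, q, Z (\<sigma> s q))"
  have \<Omega>: "open \<Omega>" and Zc: "continuous_on (cball 0 r) Z"
    and x\<Omega>: "\<And>s q. s \<in> {0..1} \<Longrightarrow> q \<in> cball 0 r \<Longrightarrow> ?x s q \<in> \<Omega>"
    and eq: "\<And>q. q \<in> cball 0 r \<Longrightarrow> Z q = integral {0..1} (\<lambda>s. H (?x s q))"
    and con: "\<And>s q v. s \<in> {0..1} \<Longrightarrow> q \<in> cball 0 r \<Longrightarrow> norm (der H (?x s q) (0, 0, v)) \<le> norm v / 2"
    using sol unfolding ray_solution_def by blast+
  let ?Q = "{0..1} \<times> cball (0::'p) r"
  have xc: "continuous_on ?Q (\<lambda>(s, q). ?x s q)"
    unfolding case_prod_unfold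
    by (intro continuous_intros continuous_on_compose2[OF Zc]) (auto intro!: norm_ray_le[THEN order_trans])
  define K where "K = (\<lambda>(s, q). ?x s q) ` ?Q"
  have K: "compact K" "K \<subseteq> \<Omega>"
    unfolding K_def using x\<Omega> by (auto intro!: compact_continuous_image[OF xc] compact_Times simp del: mem_cball)
  have xK: "?x s q \<in> K" if "s \<in> {0..1}" "q \<in> cball 0 r" for s q
    using that unfolding K_def by force
  define B where "B x = Blinfun (der H x)" for x
  have B: "blinfun_apply (B x) = der H x" if "x \<in> \<Omega>" for x
    unfolding B_def using Ck_on_SucD(1)[OF C1 that] has_derivative_bounded_linear
    by (blast intro: bounded_linear_Blinfun_apply)
  have lin: "linear (der H x)" if "x \<in> \<Omega>" for x
    using Ck_on_der_linear[OF C1 that] .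
  have Bc: "continuous_on \<Omega> B"
    unfolding B_def by (rule Ck_on_imp_continuous_on_Blinfun[OF C1])
  have Bxc: "continuous_on ?Q (\<lambda>(s, q). B (?x s q))"
  proof -
    have "(\<lambda>(s, q). ?x s q) ` ?Q \<subseteq> \<Omega>" using x\<Omega> by force
    from continuous_on_compose2[OF Bc xc this] show ?thesis by (simp add: case_prod_unfold)
  qed
  have "bounded (B ` K)"
    using K Bc by (intro compact_imp_bounded compact_continuous_image) (auto intro: continuous_on_subset)
  then obtain L where L: "0 < L" "\<And>x. x \<in> K \<Longrightarrow> norm (B x) \<le> L"
    unfolding bounded_pos by auto
  have derL: "norm (der H (?x s q) w) \<le> L * norm w" if "s \<in> {0..1}" "q \<in> cball 0 r" for s q w
  proof -
    have "norm (blinfun_apply (B (?x s q)) w) \<le> norm (B (?x s q)) * norm w" by (rule norm_blinfun)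
    also have "\<dots> \<le> L * norm w" using L(2)[OF xK[OF that]] by (intro mult_right_mono) auto
    finally show ?thesis using B[OF x\<Omega>[OF that]] by simp
  qed
  \<comment> \<open>Writing the integrand as a composition of bounded operators gives its continuity
    in the operator norm, as \<open>ray_fixpoint_exists\<close> demands.\<close>
  define i1 :: "'p \<Rightarrow>\<^sub>L (real \<times> 'p \<times> 'z)" where "i1 = Blinfun (\<lambda>h. (0, h, 0))"
  define i2 :: "'z \<Rightarrow>\<^sub>L (real \<times> 'p \<times> 'z)" where "i2 = Blinfun (\<lambda>v. (0, 0, v))"
  define P where "P = Blinfun \<pi>"
  define R where "R s = id_blinfun - P + s *\<^sub>R P" for s
  have i1: "blinfun_apply i1 = (\<lambda>h. (0, h, 0))" and i2: "blinfun_apply i2 = (\<lambda>v. (0, 0, v))"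
    unfolding i1_def i2_def by (auto intro!: bounded_linear_Blinfun_apply bounded_linear_intros)
  have R: "blinfun_apply (R s) h = \<sigma> s h" for s h
    unfolding R_def P_def \<sigma>_def using bounded_linear_proj
    by (simp add: blinfun.bilinear_simps bounded_linear_Blinfun_apply)
  define G where "G s q V = B (?x s q) o\<^sub>L (i1 + (i2 o\<^sub>L (V o\<^sub>L R s)))" for s q and V :: "'p \<Rightarrow>\<^sub>L 'z"
  have Gapp: "blinfun_apply (G s q V) h = der H (?x s q) (0, h, V (\<sigma> s h))"
    if "s \<in> {0..1}" "q \<in> cball 0 r" for s q V h
    using B[OF x\<Omega>[OF that]] by (simp add: G_def i1 i2 R blinfun.add_left)
  have Glip: "norm (G s q V - G s q V') \<le> norm (V - V') / 2" if "s \<in> {0..1}" "q \<in> cball 0 r" for s q V V'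
  proof (rule norm_blinfun_bound)
    fix h
    have "blinfun_apply (G s q V - G s q V') h = der H (?x s q) (0, 0, (V - V') (\<sigma> s h))"
      using lin[OF x\<Omega>[OF that]] by (simp add: blinfun.diff_left Gapp[OF that] linear_diff[symmetric])
    also have "norm \<dots> \<le> norm ((V - V') (\<sigma> s h)) / 2" using con[OF that] .
    also have "\<dots> \<le> norm (V - V') * norm (\<sigma> s h) / 2" by (simp add: norm_blinfun)
    also have "\<dots> \<le> norm (V - V') * norm h / 2"
      using norm_ray_le[OF that(1), of h] by (simp add: mult_left_mono)
    finally show "norm (blinfun_apply (G s q V - G s q V') h) \<le> norm (V - V') / 2 * norm h" by simp
  qed simp
  have G0: "norm (G s q 0) \<le> L" if "s \<in> {0..1}" "q \<in> cball 0 r" for s q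
  proof (rule norm_blinfun_bound)
    show "norm (blinfun_apply (G s q 0) h) \<le> L * norm h" for h
      using derL[OF that, of "(0, h, 0)"] by (simp add: Gapp[OF that] norm_Pair)
  qed (use L in simp)
  obtain V :: "'p \<Rightarrow> 'p \<Rightarrow>\<^sub>L 'z" where V: "continuous_on (cball 0 r) V"
    "\<And>q. q \<in> cball 0 r \<Longrightarrow> V q = integral {0..1} (\<lambda>s. G s q (V (\<sigma> s q)))"
  \<comment> \<open>Because \<open>norm (G s q w)\<close> is at most \<open>L + norm w / 2\<close>,
    the ball of radius \<open>2 * L\<close> is mapped into itself.\<close>
  proof (rule ray_fixpoint_exists[of r "2 * L" 0 G])
    have "continuous_on ({0..1} \<times> cball 0 r \<times> cball 0 (2 * L)) (\<lambda>x. B (?x (fst x) (fst (snd x))))"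
    proof -
      have "continuous_on ({0..1} \<times> cball 0 r \<times> cball 0 (2 * L)) (\<lambda>x. (\<lambda>(s, q). B (?x s q)) (fst x, fst (snd x)))"
        by (rule continuous_on_compose2[OF Bxc]) (auto intro!: continuous_intros)
      then show ?thesis by simp
    qed
    then show "continuous_on ({0..1} \<times> cball 0 r \<times> cball 0 (2 * L)) (\<lambda>(s, q, w). G s q w)"
      unfolding G_def R_def case_prod_unfold
      by (intro bounded_bilinear.continuous_on[OF bounded_bilinear_blinfun_compose] continuous_intros)
    fix s :: real and q :: 'p and w :: "'p \<Rightarrow>\<^sub>L 'z" assume sq: "s \<in> {0..1}" "q \<in> cball 0 r" and w: "w \<in> cball 0 (2 * L)"
    have "norm (G s q w) \<le> norm (G s q 0) + norm (G s q w - G s q 0)" by norm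
    also have "\<dots> \<le> L + norm w / 2" using G0[OF sq] Glip[OF sq, of w 0] by simp
    also have "\<dots> \<le> 2 * L" using w by simp
    finally show "norm (G s q w - 0) \<le> 2 * L" by simp
    show "norm (G s q w - G s q w') \<le> norm (w - w') / 2" for w'
      by (rule Glip[OF sq])
  qed (use \<open>0 \<le> r\<close> L in auto)
  have Veq: "V q h = integral {0..1} (\<lambda>s. der H (?x s q) (0, h, V (\<sigma> s q) (\<sigma> s h)))"
    and Vcont: "continuous_on {0..1} (\<lambda>s. der H (?x s q) (0, h, V (\<sigma> s q) (\<sigma> s h)))"
    if q: "q \<in> cball 0 r" for q h
  proof -
    have "continuous_on {0..1} (\<lambda>s. B (?x s q))"
    proof -
      have "continuous_on {0..1} (\<lambda>s. (\<lambda>(s, q). B (?x s q)) (s, q))"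
        by (rule continuous_on_compose2[OF Bxc]) (use q in \<open>auto intro!: continuous_intros\<close>)
      then show ?thesis by simp
    qed
    moreover have "continuous_on {0..1} (\<lambda>s. V (\<sigma> s q))"
      using ray_in_cball[OF _ q] by (intro continuous_on_compose2[OF V(1)] continuous_intros) auto
    ultimately have cG: "continuous_on {0..1} (\<lambda>s. G s q (V (\<sigma> s q)))"
      unfolding G_def R_def
      by (intro bounded_bilinear.continuous_on[OF bounded_bilinear_blinfun_compose] continuous_intros)
    then have int: "(\<lambda>s. G s q (V (\<sigma> s q))) integrable_on {0..1}"
      by (rule integrable_continuous_interval)
    have "V q h = integral {0..1} (\<lambda>s. blinfun_apply (G s q (V (\<sigma> s q))) h)"
      using integral_linear[OF int blinfun.bounded_linear_left[of h]] V(2)[OF q] by (simp add: o_def)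
    also have "\<dots> = integral {0..1} (\<lambda>s. der H (?x s q) (0, h, V (\<sigma> s q) (\<sigma> s h)))"
      using q by (intro integral_cong Gapp) auto
    finally show "V q h = \<dots>" .
    have "continuous_on {0..1} (\<lambda>s. blinfun_apply (G s q (V (\<sigma> s q))) h)"
      using cG by (intro continuous_intros)
    then show "continuous_on {0..1} (\<lambda>s. der H (?x s q) (0, h, V (\<sigma> s q) (\<sigma> s h)))"
      by (rule continuous_on_eq) (rule Gapp[OF _ q])
  qed
  have Hc: "continuous_on {0..1} (\<lambda>s. H (?x s q))" if "q \<in> cball 0 r" for q
  proof -
    have "continuous_on {0..1} (\<lambda>s. ?x s q)"
    proof -
      have "continuous_on {0..1} (\<lambda>s. (\<lambda>(s, q). ?x s q) (s, q))"
        by (rule continuous_on_compose2[OF xc]) (use that in \<open>auto intro!: continuous_intros\<close>)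
      then show ?thesis by simp
    qed
    then show ?thesis
      using continuous_on_compose2[OF Ck_on_imp_continuous_on[OF C1]] x\<Omega>[OF _ that] by blast
  qed
  \<comment> \<open>Pairs of a base point and an increment of size at most \<open>\<eta>\<close>.
    Replacing \<open>(q, h)\<close> by \<open>(\<sigma> s q, \<sigma> s h)\<close> does not leave
    the set, so a supremum over it also bounds the integrands.\<close>
  define N where "N \<eta> = {(q, h). q \<in> cball 0 r \<and> q + h \<in> cball 0 r \<and> h \<in> cball (0::'p) \<eta>}" for \<eta>
  have N: "compact (N \<eta>)" for \<eta>
  proof -
    have "N \<eta> = (cball 0 r \<times> cball 0 \<eta>) \<inter> (\<lambda>(q, h). q + h) -` cball 0 r"
      by (auto simp: N_def)
    moreover have "closed ((\<lambda>(q, h). q + h) -` cball (0::'p) r)"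
      unfolding case_prod_unfold by (intro continuous_closed_vimage closed_cball) (intro continuous_intros)
    ultimately show ?thesis by (simp add: compact_Int_closed compact_Times)
  qed
  have Nray: "(\<sigma> s q, \<sigma> s h) \<in> N \<eta>" if "(q, h) \<in> N \<eta>" "s \<in> {0..1}" for q h s \<eta>
    using that ray_in_cball[OF that(2)] by (auto simp: N_def ray_add[symmetric] simp del: mem_cball)
  define \<Delta> where "\<Delta> q h = Z (q + h) - Z q" for q h
  have \<Delta>c: "continuous_on (N \<eta>) (\<lambda>(q, h). \<Delta> q h)" for \<eta>
    unfolding \<Delta>_def case_prod_unfold
    by (intro continuous_intros continuous_on_compose2[OF Zc]) (auto simp: N_def)
  have diff: "?x s (q + h) - ?x s q = (0, h, \<Delta> (\<sigma> s q) (\<sigma> s h))" for s q h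
    by (simp add: \<Delta>_def ray_add)
  have \<Delta>eq: "\<Delta> q h = integral {0..1} (\<lambda>s. H (?x s (q + h)) - H (?x s q))" if "(q, h) \<in> N \<eta>" for q h \<eta>
    using that unfolding \<Delta>_def N_def
    by (subst integral_diff) (auto simp: eq intro!: integrable_continuous_interval Hc)
  \<comment> \<open>With linearisation error 1/4 the increment of \<open>H\<close> is at most
    \<open>(L + 1/4) * \<eta>\<close> plus \<open>1/2 + 1/4\<close> times the supremum; division by
    \<open>1 - 3/4\<close> gives the constant \<open>4 * L + 1\<close>.\<close>
  obtain \<eta>0 where \<eta>0: "\<eta>0 > 0" and lipZ: "\<And>\<eta> q h. \<eta> \<le> \<eta>0 \<Longrightarrow> (q, h) \<in> N \<eta> \<Longrightarrow> norm (\<Delta> q h) \<le> (4 * L + 1) * \<eta>"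
  proof -
    obtain \<delta> where \<delta>: "\<delta> > 0" "\<And>x y. x \<in> K \<Longrightarrow> norm (y - x) \<le> \<delta> \<Longrightarrow>
        norm (H y - H x - der H x (y - x)) \<le> 1/4 * norm (y - x)"
      using C1_uniformly_differentiable[OF \<Omega> C1 K, of "1/4"] by auto
    have "uniformly_continuous_on (cball 0 r) Z"
      using Zc by (intro compact_uniformly_continuous) auto
    then obtain d where d: "d > 0" "\<And>x y. x \<in> cball 0 r \<Longrightarrow> y \<in> cball 0 r \<Longrightarrow> dist y x < d \<Longrightarrow> dist (Z y) (Z x) < \<delta> / 2"
      using \<delta>(1) unfolding uniformly_continuous_on_def by (metis half_gt_zero)
    \<comment> \<open>One half of \<open>\<delta>\<close> is reserved for \<open>h\<close>, the
      other, through uniform continuity, for the increment of \<open>Z\<close>.\<close>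
    define \<eta>0 where "\<eta>0 = min (d / 2) (\<delta> / 2)"
    have "norm (\<Delta> q h) \<le> (4 * L + 1) * \<eta>" if "\<eta> \<le> \<eta>0" "(q, h) \<in> N \<eta>" for \<eta> q h
    proof -
      have "(\<lambda>(q, h). norm (\<Delta> q h)) (q, h) \<le> ((L + 1/4) * \<eta>) / (1 - 3/4)"
      proof (rule sup_contraction_bound[OF N[of \<eta>]])
        show "continuous_on (N \<eta>) (\<lambda>(q, h). norm (\<Delta> q h))"
          using continuous_on_norm[OF \<Delta>c] by (simp add: case_prod_unfold)
        fix M qh assume M: "\<And>z. z \<in> N \<eta> \<Longrightarrow> (case z of (q, h) \<Rightarrow> norm (\<Delta> q h)) \<le> M" and "qh \<in> N \<eta>"
        then obtain q h where qh: "qh = (q, h)" "(q, h) \<in> N \<eta>" by (cases qh) auto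
        have q: "q \<in> cball 0 r" "q + h \<in> cball 0 r" "norm h \<le> \<eta>" using qh by (auto simp: N_def)
        have "norm (integral {0..1} (\<lambda>s. H (?x s (q + h)) - H (?x s q))) \<le> (L + 1/4) * \<eta> + 3/4 * M"
        proof (intro norm_integral_unit_le continuous_intros Hc q)
          fix s :: real assume s: "s \<in> {0..1}"
          let ?d = "\<Delta> (\<sigma> s q) (\<sigma> s h)" and ?w = "?x s (q + h) - ?x s q"
          have n: "(\<sigma> s q, \<sigma> s h) \<in> N \<eta>" using Nray[OF qh(2) s] .
          then have dM: "norm ?d \<le> M" using M by force
          have "norm ?d < \<delta> / 2"
            using n d(2)[of "\<sigma> s q" "\<sigma> s q + \<sigma> s h"] d(1) \<open>\<eta> \<le> \<eta>0\<close>
            by (auto simp: N_def \<Delta>_def dist_norm \<eta>0_def)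
          moreover have nw: "norm ?w \<le> norm h + norm ?d"
            unfolding diff using norm_Pair_le[of h ?d] by (simp add: norm_Pair)
          ultimately have "norm ?w \<le> \<delta>" using q(3) \<open>\<eta> \<le> \<eta>0\<close> by (simp add: \<eta>0_def)
          then have "norm (H (?x s (q + h)) - H (?x s q) - der H (?x s q) ?w) \<le> 1/4 * norm ?w"
            by (intro \<delta>(2) xK s q)
          moreover have "der H (?x s q) ?w = der H (?x s q) (0, h, 0) + der H (?x s q) (0, 0, ?d)"
            unfolding diff using lin[OF x\<Omega>[OF s q(1)]] by (simp add: linear_add[symmetric])
          moreover have "norm (der H (?x s q) (0, h, 0)) \<le> L * norm h"
            using derL[OF s q(1), of "(0, h, 0)"] by (simp add: norm_Pair)
          moreover have "norm (der H (?x s q) (0, 0, ?d)) \<le> norm ?d / 2" by (rule con[OF s q(1)])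
          ultimately have "norm (H (?x s (q + h)) - H (?x s q)) \<le> 1/4 * norm ?w + (L * norm h + norm ?d / 2)"
            by (intro norm_le_of_diff) (auto intro: order_trans[OF norm_triangle_ineq add_mono])
          also have "\<dots> \<le> L * norm h + norm ?d / 2 + 1/4 * (norm h + norm ?d)"
            by (rule order_trans[OF add_right_mono[OF mult_left_mono[OF nw]]]) simp_all
          also have "\<dots> \<le> (L + 1/4) * \<eta> + 3/4 * M"
          proof -
            have "a + d / 2 + 1/4 * (b + d) \<le> a' + 1/4 * b' + 3/4 * d'"
              if "a \<le> a'" "b \<le> b'" "d \<le> d'" for a a' b b' d d' :: real
              using that by argo
            from this[OF mult_left_mono[OF q(3) less_imp_le[OF L(1)]] q(3) dM]
            show ?thesis unfolding distrib_right .
          qed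
          finally show "norm (H (?x s (q + h)) - H (?x s q)) \<le> (L + 1/4) * \<eta> + 3/4 * M" .
        qed
        then show "(case qh of (q, h) \<Rightarrow> norm (\<Delta> q h)) \<le> (L + 1/4) * \<eta> + 3/4 * M"
          using \<Delta>eq[OF qh(2)] qh(1) by simp
      qed (use that in auto)
      then show ?thesis by (simp add: algebra_simps)
    qed
    moreover have "\<eta>0 > 0" using d \<delta> by (simp add: \<eta>0_def)
    ultimately show ?thesis using that by blast
  qed
  have "(Z has_derivative V q) (at q)" if q0: "q \<in> ball 0 r" for q
    unfolding has_derivative_at_alt
  proof (intro conjI allI impI)
    fix e :: real assume "e > 0"
    \<comment> \<open>The increment of the triple is at most \<open>(4 * L + 2) * \<eta>\<close>,
      and \<open>sup_contraction_bound\<close> with factor 1/2 doubles the error; this choice makes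
      the outcome \<open>e * \<eta>\<close>.\<close>
    define \<epsilon> where "\<epsilon> = e / (2 * (4 * L + 2))"
    have c: "2 * (4 * L + 2) > 0" using L(1) by simp
    then have \<epsilon>: "\<epsilon> > 0" using \<open>e > 0\<close> by (simp add: \<epsilon>_def)
    have \<epsilon>e: "2 * (\<epsilon> * (4 * L + 2)) = e"
      using nonzero_eq_divide_eq[of "2 * (4 * L + 2)" \<epsilon> e] c unfolding mult.left_commute[of 2]
      by (simp only: \<epsilon>_def) simp
    obtain \<delta> where \<delta>: "\<delta> > 0" "\<And>x y. x \<in> K \<Longrightarrow> norm (y - x) \<le> \<delta> \<Longrightarrow>
        norm (H y - H x - der H x (y - x)) \<le> \<epsilon> * norm (y - x)"
      using C1_uniformly_differentiable[OF \<Omega> C1 K \<epsilon>] by auto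
    define E where "E q h = \<Delta> q h - V q h" for q h
    have Ebound: "norm (E q h) \<le> e * \<eta>" if \<eta>: "\<eta> \<le> \<eta>0" "(4 * L + 2) * \<eta> \<le> \<delta>" and "(q, h) \<in> N \<eta>" for \<eta> q h
    proof -
      have "(\<lambda>(q, h). norm (E q h)) (q, h) \<le> (\<epsilon> * ((4 * L + 2) * \<eta>)) / (1 - 1/2)"
      proof (rule sup_contraction_bound[OF N[of \<eta>]])
        have "continuous_on (N \<eta>) (\<lambda>x. blinfun_apply (V (fst x)) (snd x))"
          by (intro continuous_intros continuous_on_compose2[OF V(1)]) (auto simp: N_def)
        then show "continuous_on (N \<eta>) (\<lambda>(q, h). norm (E q h))"
          unfolding E_def case_prod_unfold using \<Delta>c[of \<eta>]
          by (intro continuous_on_norm continuous_on_diff) (auto simp: case_prod_unfold)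
        fix M qh assume M: "\<And>z. z \<in> N \<eta> \<Longrightarrow> (case z of (q, h) \<Rightarrow> norm (E q h)) \<le> M" and "qh \<in> N \<eta>"
        then obtain q h where qh: "qh = (q, h)" "(q, h) \<in> N \<eta>" by (cases qh) auto
        have q: "q \<in> cball 0 r" "q + h \<in> cball 0 r" "norm h \<le> \<eta>" using qh by (auto simp: N_def)
        let ?D = "\<lambda>s. der H (?x s q) (0, h, V (\<sigma> s q) (\<sigma> s h))"
        have "norm (integral {0..1} (\<lambda>s. (H (?x s (q + h)) - H (?x s q)) - ?D s)) \<le> \<epsilon> * ((4 * L + 2) * \<eta>) + 1/2 * M"
        proof (intro norm_integral_unit_le continuous_intros Hc Vcont q)
          fix s :: real assume s: "s \<in> {0..1}"
          let ?d = "\<Delta> (\<sigma> s q) (\<sigma> s h)" and ?w = "?x s (q + h) - ?x s q"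
          have n: "(\<sigma> s q, \<sigma> s h) \<in> N \<eta>" using Nray[OF qh(2) s] .
          then have eM: "norm (E (\<sigma> s q) (\<sigma> s h)) \<le> M" using M by force
          have "norm ?w \<le> norm h + norm ?d"
            unfolding diff using norm_Pair_le[of h ?d] by (simp add: norm_Pair)
          also have "\<dots> \<le> (4 * L + 2) * \<eta>" using lipZ[OF \<eta>(1) n] q(3) by (simp add: algebra_simps)
          finally have nw: "norm ?w \<le> (4 * L + 2) * \<eta>" .
          have "norm (H (?x s (q + h)) - H (?x s q) - der H (?x s q) ?w) \<le> \<epsilon> * norm ?w"
            using nw \<eta>(2) by (intro \<delta>(2) xK s q) auto
          also have "\<dots> \<le> \<epsilon> * ((4 * L + 2) * \<eta>)" using nw \<epsilon> by (intro mult_left_mono) auto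
          finally have 1: "norm (H (?x s (q + h)) - H (?x s q) - der H (?x s q) ?w) \<le> \<epsilon> * ((4 * L + 2) * \<eta>)" .
          \<comment> \<open>Linearity splits off the integrand of \<open>V q h\<close>; what remains
            is the error at the ray point, halved by the contraction condition.\<close>
          have 2: "der H (?x s q) ?w = ?D s + der H (?x s q) (0, 0, E (\<sigma> s q) (\<sigma> s h))"
            unfolding diff E_def using lin[OF x\<Omega>[OF s q(1)]] by (simp add: linear_add[symmetric])
          have 3: "norm (der H (?x s q) (0, 0, E (\<sigma> s q) (\<sigma> s h))) \<le> norm (E (\<sigma> s q) (\<sigma> s h)) / 2"
            by (rule con[OF s q(1)])
          show "norm (H (?x s (q + h)) - H (?x s q) - ?D s) \<le> \<epsilon> * ((4 * L + 2) * \<eta>) + 1/2 * M"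
            using 3 eM by (intro norm_le_of_diff[OF 1[unfolded 2 diff_diff_add[symmetric]]]) simp
        qed
        also have "integral {0..1} (\<lambda>s. (H (?x s (q + h)) - H (?x s q)) - ?D s) = E q h"
          unfolding E_def \<Delta>eq[OF qh(2)] Veq[OF q(1)]
          by (intro integral_diff integrable_continuous_interval continuous_intros Hc Vcont q)
        finally show "(case qh of (q, h) \<Rightarrow> norm (E q h)) \<le> \<epsilon> * ((4 * L + 2) * \<eta>) + 1/2 * M"
          using qh(1) by simp
      qed (use that in auto)
      also have "(\<epsilon> * ((4 * L + 2) * \<eta>)) / (1 - 1/2) = e * \<eta>"
        unfolding \<epsilon>e[symmetric] by simp
      finally show ?thesis by simp
    qed
    define d where "d = min (r - norm q) (min \<eta>0 (\<delta> / (4 * L + 2)))"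
    have "d > 0" using q0 \<eta>0 \<delta>(1) L(1) by (simp add: d_def add_pos_pos)
    \<comment> \<open>The estimate is used with \<open>\<eta>\<close> equal to
      \<open>norm (y - q)\<close>, which turns \<open>e * \<eta>\<close> into the required
      bound.\<close>
    moreover have "norm (Z y - Z q - V q (y - q)) \<le> e * norm (y - q)" if "norm (y - q) < d" for y
    proof -
      have "norm y \<le> norm q + norm (y - q)" by norm
      then have "(q, y - q) \<in> N (norm (y - q))" using that q0 by (simp add: N_def d_def)
      moreover have "(4 * L + 2) * norm (y - q) \<le> \<delta>"
        using that L(1) by (simp add: d_def pos_less_divide_eq mult.commute)
      ultimately show ?thesis using Ebound[of "norm (y - q)" q "y - q"] that
        by (simp add: E_def \<Delta>_def d_def)
    qed
    ultimately show "\<exists>d>0. \<forall>y. norm (y - q) < d \<longrightarrow> norm (Z y - Z q - V q (y - q)) \<le> e * norm (y - q)"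
      by blast
  qed (rule blinfun.bounded_linear_right)
  moreover have "((\<lambda>s. der H (?x s q) (0, h, V (\<sigma> s q) (\<sigma> s h))) has_integral V q h) {0..1}"
    if "q \<in> cball 0 r" for q h
    unfolding Veq[OF that]
    by (intro integrable_integral integrable_continuous_interval Vcont that)
  ultimately show ?thesis using that V(1) by blast
qed


text \<open>If \<open>h\<close> lies in the range or in the kernel of \<open>\<pi>\<close>, then the derivative of a solution in direction
  \<open>h\<close> solves an equation of the same kind, whose data are of class \<open>C\<^sup>k\<close> when those of the original
  equation are of class \<open>C\<^sup>k\<^sup>+\<^sup>1\<close> and the solution is of class \<open>C\<^sup>k\<close>.\<close>

lemma ray_solution_Ck:
  fixes Z :: "'p \<Rightarrow> 'z::euclidean_space"
  assumes "ray_solution r \<Omega> H Z" "Ck_on k \<Omega> H"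
  shows "Ck_on k (ball 0 r) Z"
  using assms
proof (induction k arbitrary: r \<Omega> H Z)
  case 0
  then show ?case by (auto simp: ray_solution_def intro: continuous_on_subset)
next
  case (Suc k)
  note sol = Suc.prems(1)
  show ?case
  proof (cases "0 \<le> r")
    case False
    then have "ball (0::'p) r = {}" by simp
    then show ?thesis using Ck_on_local[of "{}"] by (metis empty_iff)
  next
    case True
    have C1: "Ck_on (Suc 0) \<Omega> H" by (rule Ck_on_mono[OF _ Suc.prems(2)]) simp
    have \<Omega>: "open \<Omega>" and x\<Omega>: "\<And>s q. s \<in> {0..1} \<Longrightarrow> q \<in> cball 0 r \<Longrightarrow> (s, q, Z (\<sigma> s q)) \<in> \<Omega>"
      and con: "\<And>s q v. s \<in> {0..1} \<Longrightarrow> q \<in> cball 0 r \<Longrightarrow>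
        norm (der H (s, q, Z (\<sigma> s q)) (0, 0, v)) \<le> norm v / 2"
      using sol unfolding ray_solution_def by blast+
    obtain V :: "'p \<Rightarrow> 'p \<Rightarrow>\<^sub>L 'z" where V: "continuous_on (cball 0 r) V"
      "\<And>q. q \<in> ball 0 r \<Longrightarrow> (Z has_derivative V q) (at q)"
      "\<And>q h. q \<in> cball 0 r \<Longrightarrow>
         ((\<lambda>s. der H (s, q, Z (\<sigma> s q)) (0, h, V (\<sigma> s q) (\<sigma> s h))) has_integral V q h) {0..1}"
      using ray_solution_C1[OF sol C1 True] by blast
    have Z: "Ck_on k (ball 0 r) Z" by (rule Suc.IH[OF sol Ck_on_Suc_imp[OF Suc.prems(2)]])
    \<comment> \<open>The factor \<open>c s\<close> comes out of
      \<open>V (\<sigma> s q) (\<sigma> s h)\<close>, so the equation involves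
      \<open>q \<mapsto> V q h\<close> for this one direction only.\<close>
    have pure: "Ck_on k (ball 0 r) (\<lambda>q. V q h)"
      if ch: "\<And>s. \<sigma> s h = c s *\<^sub>R h" and c: "Ck_on k UNIV c" "\<And>s. s \<in> {0..1} \<Longrightarrow> \<bar>c s\<bar> \<le> 1" for h c
    proof (cases k)
      case 0
      have "continuous_on (ball 0 r) V" using V(1) by (rule continuous_on_subset) auto
      then show ?thesis using 0 by (auto intro!: continuous_intros)
    next
      case (Suc j)
      \<comment> \<open>\<open>g\<close> puts the known solution \<open>Z\<close> in the third slot,
        while the new unknown occupies that slot of \<open>H'\<close>; \<open>A\<close> restricts to
        the region where the order of \<open>Z\<close> is known.\<close>
      define g where "g x = (fst x, fst (snd x), Z (\<sigma> (fst x) (fst (snd x))))" for x :: "real \<times> 'p \<times> 'z"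
      define A where "A = {x :: real \<times> 'p \<times> 'z. fst (snd x) \<in> ball 0 r} \<inter>
        {x. \<sigma> (fst x) (fst (snd x)) \<in> ball 0 r}"
      define \<Omega>' where "\<Omega>' = A \<inter> g -` \<Omega>"
      define H' where "H' x = der H (g x) (0, h, c (fst x) *\<^sub>R snd (snd x))" for x :: "real \<times> 'p \<times> 'z"
      have "open A" unfolding A_def
        by (intro open_Int open_Collect_mem_continuous open_ball continuous_intros)
      have ray: "Ck_on k S (\<lambda>x :: real \<times> 'p \<times> 'z. \<sigma> (fst x) (fst (snd x)))" if "open S" for S
        unfolding \<sigma>_def
        by (intro Ck_on_add Ck_on_diff Ck_on_scaleR that Ck_on_bounded_linear
             Ck_on_linear_image[OF bounded_linear_proj] bounded_linear_intros)
      have gA: "Ck_on k A g" unfolding g_def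
        by (intro Ck_on_Pair \<open>open A\<close> Ck_on_bounded_linear bounded_linear_intros
             Ck_on_compose[OF \<open>open A\<close> open_ball _ ray Z]) (auto simp: A_def)
      have "open \<Omega>'" unfolding \<Omega>'_def
        using Ck_on_imp_continuous_on[OF gA] \<open>open A\<close> \<Omega> by (rule continuous_open_preimage)
      have "Ck_on k \<Omega>' H'" unfolding H'_def
      proof (rule Ck_on_linear_apply[where L = "\<lambda>x. der H (g x)"])
        show "linear (der H (g x))" if "x \<in> \<Omega>'" for x
          using that by (intro Ck_on_der_linear[OF C1]) (auto simp: \<Omega>'_def)
        show "Ck_on k \<Omega>' (\<lambda>x. der H (g x) w)" for w
          by (rule Ck_on_compose[OF \<open>open \<Omega>'\<close> \<Omega> _ Ck_on_subset[OF gA] Ck_on_SucD(2)[OF Suc.prems(2)]])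
             (auto simp: \<Omega>'_def)
        show "Ck_on k \<Omega>' (\<lambda>x. (0, h, c (fst x) *\<^sub>R snd (snd x)))"
          by (intro Ck_on_Pair Ck_on_scaleR Ck_on_const \<open>open \<Omega>'\<close> Ck_on_bounded_linear
               bounded_linear_intros Ck_on_compose[OF \<open>open \<Omega>'\<close> open_UNIV _ _ c(1)]) auto
      qed (rule \<open>open \<Omega>'\<close>)
      \<comment> \<open>The set \<open>\<Omega>'\<close> lies over the open ball, whereas
        \<open>ray_solution\<close> speaks of a closed one; smaller radii are used and glued by
        \<open>Ck_on_local\<close>.\<close>
      have "Ck_on k (ball 0 r') (\<lambda>q. V q h)" if r': "r' < r" for r'
      proof (rule Suc.IH[OF _ \<open>Ck_on k \<Omega>' H'\<close>])
        have sub: "cball 0 r' \<subseteq> cball (0::'p) r" using r' by auto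
        have in\<Omega>': "(s, q, v) \<in> \<Omega>'" if "s \<in> {0..1}" "q \<in> cball 0 r'" for s q v
          using x\<Omega>[of s q] norm_ray_le[of s q] that r' by (auto simp: \<Omega>'_def A_def g_def)
        have "V q h = integral {0..1} (\<lambda>s. H' (s, q, V (\<sigma> s q) h))" if "q \<in> cball 0 r'" for q
          using integral_unique[OF V(3)[of q h]] that sub by (simp add: H'_def g_def ch blinfun.scaleR_right subset_iff)
        moreover have "norm (der H' (s, q, w) (0, 0, v)) \<le> norm v / 2"
          if sq: "s \<in> {0..1}" "q \<in> cball 0 r'" for s q v w
        proof -
          have "(H' has_derivative der H' (s, q, w)) (at (s, q, w))"
            using \<open>Ck_on k \<Omega>' H'\<close> in\<Omega>'[OF sq] unfolding Suc by (rule Ck_on_SucD)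
          \<comment> \<open>\<open>H'\<close> is affine in its third slot, so its partial derivative
            there is that of \<open>H\<close> applied to a vector scaled by \<open>c s\<close>, and
            it inherits the bound 1/2.\<close>
          moreover have "H' ((s, q, w) + t *\<^sub>R (0, 0, v)) =
              H' (s, q, w) + t *\<^sub>R der H (s, q, Z (\<sigma> s q)) (0, 0, c s *\<^sub>R v)" for t
          proof -
            have "linear (der H (s, q, Z (\<sigma> s q)))"
              using x\<Omega>[of s q] sq sub by (intro Ck_on_der_linear[OF C1]) auto
            then show ?thesis
              by (simp add: H'_def g_def linear_cmul[symmetric] linear_add[symmetric] algebra_simps)
          qed
          ultimately have "der H' (s, q, w) (0, 0, v) = der H (s, q, Z (\<sigma> s q)) (0, 0, c s *\<^sub>R v)"
            by (rule has_derivative_affine_direction[OF _ open_UNIV UNIV_I])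
          also have "norm \<dots> \<le> norm (c s *\<^sub>R v) / 2" using sq sub by (intro con) auto
          also have "\<dots> \<le> norm v / 2" using c(2)[OF sq(1)] by (simp add: mult_left_le_one_le)
          finally show ?thesis .
        qed
        moreover have "continuous_on (cball 0 r') (\<lambda>q. V q h)"
          using continuous_on_subset[OF V(1) sub] by (intro continuous_intros)
        ultimately show "ray_solution r' \<Omega>' H' (\<lambda>q. V q h)"
          using \<open>open \<Omega>'\<close> in\<Omega>' by (auto simp: ray_solution_def simp del: mem_cball)
      qed
      then have "\<exists>N. open N \<and> q \<in> N \<and> Ck_on k N (\<lambda>q. V q h)" if "q \<in> ball 0 r" for q
        using that dense[of "norm q" r] by (metis mem_ball_0 open_ball)
      then show ?thesis by (rule Ck_on_local)
    qed
    show ?thesis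
    proof (rule Ck_on_SucI[OF open_ball V(2)])
      fix h
      \<comment> \<open>Every \<open>h\<close> is the sum of a part scaled by \<open>s\<close> and a
        part fixed by all rays.\<close>
      have "Ck_on k (ball 0 r) (\<lambda>q. V q (\<pi> h))"
        by (rule pure[of "\<pi> h" "\<lambda>s. s"]) (auto simp: \<sigma>_def proj_proj Ck_on_id)
      moreover have "Ck_on k (ball 0 r) (\<lambda>q. V q (h - \<pi> h))"
        by (rule pure[of "h - \<pi> h" "\<lambda>s. 1"])
           (auto simp: \<sigma>_def proj_proj linear_diff[OF linear_proj] Ck_on_const)
      ultimately have "Ck_on k (ball 0 r) (\<lambda>q. V q (\<pi> h) + V q (h - \<pi> h))"
        by (intro Ck_on_add) auto
      then show "Ck_on k (ball 0 r) (\<lambda>q. V q h)" by (simp add: blinfun.add_right[symmetric])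
    qed
  qed
qed

end

section \<open>The Frobenius theorem\<close>

context splitting
begin

text \<open>\<open>\<Gamma> q\<close> is the time-one value of the integral curve of \<open>\<lambda>z. Y z (\<pi> q)\<close> that starts at
  \<open>p0 + (q - \<pi> q)\<close>. For \<open>h\<close> in the range of \<open>\<pi>\<close> both \<open>der \<Gamma> q h\<close> and \<open>Y (\<Gamma> q) h\<close> solve the
  linearised equation, the second one because the frame commutes.\<close>

lemma commuting_frame_chart:
  fixes Y :: "'p \<Rightarrow> 'p \<Rightarrow> 'p"
  assumes "open N" "p0 \<in> N" and linY: "\<And>p. p \<in> N \<Longrightarrow> linear (Y p)"
    and smY: "\<And>w. smooth_on N (\<lambda>p. Y p w)"
    and comm: "\<And>p h w. p \<in> N \<Longrightarrow> \<pi> h = h \<Longrightarrow> \<pi> w = w \<Longrightarrow>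
        der (\<lambda>z. Y z h) p (Y p w) = der (\<lambda>z. Y z w) p (Y p h)"
  obtains r \<Gamma> where "r > 0" "smooth_on (ball 0 r) \<Gamma>" "\<Gamma> ` ball 0 r \<subseteq> N"
    "\<And>q. q \<in> ball 0 r \<Longrightarrow> \<pi> q = 0 \<Longrightarrow> \<Gamma> q = p0 + q"
    "\<And>q h. q \<in> ball 0 r \<Longrightarrow> \<pi> h = h \<Longrightarrow> der \<Gamma> q h = Y (\<Gamma> q) h"
proof -
  obtain \<rho> where \<rho>: "\<rho> > 0" "cball p0 \<rho> \<subseteq> N"
    using assms(1,2) open_contains_cball by blast
  define \<Omega> where "\<Omega> = {x :: real \<times> 'p \<times> 'p. snd (snd x) \<in> N}"
  \<comment> \<open>Constants integrate over the unit interval to themselves. For a solution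
    \<open>Z\<close>, inserting \<open>\<sigma> t q\<close> for \<open>q\<close> and rescaling time
    gives the usual integral equation on the interval from 0 to \<open>t\<close>.\<close>
  define H where "H x = p0 + (fst (snd x) - \<pi> (fst (snd x))) + Y (snd (snd x)) (\<pi> (fst (snd x)))"
    for x :: "real \<times> 'p \<times> 'p"
  have "open \<Omega>" unfolding \<Omega>_def
    by (intro open_Collect_mem_continuous \<open>open N\<close> continuous_intros)
  have smYpi: "smooth_on \<Omega> (\<lambda>x. Y (snd (snd x)) (\<pi> (fst (snd x))))"
  proof (rule smooth_on_linear_apply[where L = "\<lambda>x. Y (snd (snd x))"])
    show "smooth_on \<Omega> (\<lambda>x. Y (snd (snd x)) w)" for w
      by (rule smooth_on_compose[OF \<open>open \<Omega>\<close> \<open>open N\<close> _ smooth_on_bounded_linear[OF \<open>open \<Omega>\<close>] smY])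
         (auto simp: \<Omega>_def intro!: bounded_linear_intros)
    show "smooth_on \<Omega> (\<lambda>x. \<pi> (fst (snd x)))"
      by (intro smooth_on_bounded_linear \<open>open \<Omega>\<close> bounded_linear_compose[OF bounded_linear_proj] bounded_linear_intros)
  qed (use \<open>open \<Omega>\<close> linY in \<open>auto simp: \<Omega>_def\<close>)
  have "smooth_on \<Omega> (\<lambda>x. p0 + (fst (snd x) - \<pi> (fst (snd x))))"
    by (intro smooth_on_add[OF \<open>open \<Omega>\<close> smooth_on_const[OF \<open>open \<Omega>\<close>]] smooth_on_bounded_linear \<open>open \<Omega>\<close>
         bounded_linear_sub bounded_linear_compose[OF bounded_linear_proj] bounded_linear_intros)
  from smooth_on_add[OF \<open>open \<Omega>\<close> this smYpi] have smH: "smooth_on \<Omega> H"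
    by (simp add: H_def[abs_def])
  have derH2: "der H (s, q, z) (0, 0, v) = der (\<lambda>z. Y z (\<pi> q)) z v" if "z \<in> N" for s q z v
  proof -
    have "((\<lambda>z. (s, q, z)) has_derivative (\<lambda>v. (0, 0, v))) (at z)"
      by (auto intro!: derivative_eq_intros)
    moreover have "(H has_derivative der H (s, q, z)) (at (s, q, z))"
      by (rule smooth_on_has_derivative[OF smH]) (simp add: \<Omega>_def that)
    ultimately have "((\<lambda>z. H (s, q, z)) has_derivative (\<lambda>v. der H (s, q, z) (0, 0, v))) (at z)"
      by (rule has_derivative_compose)
    moreover have "((\<lambda>z. H (s, q, z)) has_derivative (\<lambda>v. der (\<lambda>z. Y z (\<pi> q)) z v)) (at z)"
      unfolding H_def using smooth_on_has_derivative[OF smY that, of "\<pi> q"]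
      by (auto intro!: derivative_eq_intros)
    ultimately show ?thesis using has_derivative_unique by metis
  qed
  have derH1: "der H (s, q, z) (0, b, v) = (b - \<pi> b) + Y z (\<pi> b) + der (\<lambda>z. Y z (\<pi> q)) z v"
    if "z \<in> N" for s q z b v
  proof -
    have dH: "(H has_derivative der H (s, q, z)) (at (s, q, z))"
      by (rule smooth_on_has_derivative[OF smH]) (simp add: \<Omega>_def that)
    have "H ((s, q, z) + t *\<^sub>R (0, b, 0)) = H (s, q, z) + t *\<^sub>R ((b - \<pi> b) + Y z (\<pi> b))" for t
      using linY[OF that]
      by (simp add: H_def linear_add[OF linear_proj] linear_cmul[OF linear_proj] linear_add linear_cmul algebra_simps)
    from has_derivative_affine_direction[OF dH open_UNIV UNIV_I this]
    have "der H (s, q, z) (0, b, 0) = (b - \<pi> b) + Y z (\<pi> b)" .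
    moreover have "der H (s, q, z) (0, b, v) = der H (s, q, z) (0, b, 0) + der H (s, q, z) (0, 0, v)"
      using has_derivative_linear[OF dH] by (simp add: linear_add[symmetric])
    ultimately show ?thesis by (simp add: derH2[OF that])
  qed
  let ?K = "{0..1::real} \<times> cball (0::'p) 1 \<times> cball p0 \<rho>"
  have K\<Omega>: "?K \<subseteq> \<Omega>" using \<rho>(2) by (auto simp: \<Omega>_def)
  have "compact ?K" by (intro compact_Times) auto
  define B where "B x = Blinfun (der H x)" for x
  have B: "blinfun_apply (B x) = der H x" if "x \<in> \<Omega>" for x
    unfolding B_def using smooth_on_has_derivative[OF smH that] has_derivative_bounded_linear
    by (blast intro: bounded_linear_Blinfun_apply)
  define i2 :: "'p \<Rightarrow>\<^sub>L (real \<times> 'p \<times> 'p)" where "i2 = Blinfun (\<lambda>v. (0, 0, v))"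
  have i2: "blinfun_apply i2 = (\<lambda>v. (0, 0, v))"
    unfolding i2_def by (auto intro!: bounded_linear_Blinfun_apply bounded_linear_intros)
  have "continuous_on ?K (\<lambda>x. B x o\<^sub>L i2)"
    using continuous_on_subset[OF Ck_on_imp_continuous_on_Blinfun[OF smooth_onD[OF smH]] K\<Omega>]
    unfolding B_def
    by (intro bounded_bilinear.continuous_on[OF bounded_bilinear_blinfun_compose] continuous_intros)
  then have "uniformly_continuous_on ?K (\<lambda>x. B x o\<^sub>L i2)"
    using \<open>compact ?K\<close> by (rule compact_uniformly_continuous)
  then obtain d1 where d1: "d1 > 0" "\<And>x y. x \<in> ?K \<Longrightarrow> y \<in> ?K \<Longrightarrow> dist y x < d1 \<Longrightarrow>
      dist (B y o\<^sub>L i2) (B x o\<^sub>L i2) < 1/2"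
    unfolding uniformly_continuous_on_def by (meson half_gt_zero zero_less_one)
  have "uniformly_continuous_on ?K H"
    using \<open>compact ?K\<close> continuous_on_subset[OF smooth_on_imp_continuous_on[OF smH] K\<Omega>]
    by (intro compact_uniformly_continuous)
  then obtain d2 where d2: "d2 > 0" "\<And>x y. x \<in> ?K \<Longrightarrow> y \<in> ?K \<Longrightarrow> dist y x < d2 \<Longrightarrow>
      dist (H y) (H x) < \<rho>"
    unfolding uniformly_continuous_on_def using \<rho>(1) by meson
  \<comment> \<open>At \<open>q = 0\<close> the map \<open>H\<close> is constantly \<open>p0\<close>
    in \<open>z\<close>, because \<open>Y z\<close> is linear. By uniform continuity a small radius
    therefore gives both the contraction constant 1/2 and the invariance of the ball around
    \<open>p0\<close>.\<close>
  define r where "r = min 1 (min d1 d2 / 2)"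
  have r: "0 < r" "r \<le> 1" "r < d1" "r < d2" using d1(1) d2(1) by (auto simp: r_def)
  have dist0: "dist (s, q, z) (s, 0, z) = norm q" for s :: real and q z :: 'p
    by (simp add: dist_Pair_Pair)
  have half: "norm (der H (s, q, z) (0, 0, v)) \<le> norm v / 2"
    and near: "dist (H (s, q, z)) p0 \<le> \<rho>"
    if s: "s \<in> {0..1}" and q: "q \<in> cball 0 r" and z: "z \<in> cball p0 \<rho>" for s q z v
  proof -
    have xy: "(s, q, z) \<in> ?K" "(s, 0, z) \<in> ?K" using s q z r by auto
    have zN: "z \<in> N" using z \<rho>(2) by blast
    have "der (\<lambda>z. Y z (\<pi> 0)) z = der (\<lambda>z. 0) z"
      using linY by (intro der_cong[OF \<open>open N\<close> zN]) (simp add: linear_0[OF linear_proj] linear_0)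
    then have "B (s, 0, z) o\<^sub>L i2 = 0"
      using B[OF subsetD[OF K\<Omega> xy(2)]]
      by (intro blinfun_eqI) (simp add: i2 derH2[OF zN] frechet_derivative_const)
    with d1(2)[OF xy(2,1)] q r have "norm (B (s, q, z) o\<^sub>L i2) \<le> 1/2"
      by (simp add: dist0)
    then have "norm (blinfun_apply (B (s, q, z) o\<^sub>L i2) v) \<le> 1/2 * norm v"
      using norm_blinfun[of "B (s, q, z) o\<^sub>L i2" v] mult_right_mono[of _ "1/2" "norm v"] by fastforce
    then show "norm (der H (s, q, z) (0, 0, v)) \<le> norm v / 2"
      using B[OF subsetD[OF K\<Omega> xy(1)]] by (simp add: i2)
    have "H (s, 0, z) = p0"
      using linY[OF zN] by (simp add: H_def linear_0[OF linear_proj] linear_0)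
    with d2(2)[OF xy(2,1)] q r show "dist (H (s, q, z)) p0 \<le> \<rho>" by (simp add: dist0)
  qed
  obtain Z where Z: "continuous_on (cball 0 r) Z" "\<And>q. q \<in> cball 0 r \<Longrightarrow> Z q \<in> cball p0 \<rho>"
    "\<And>q. q \<in> cball 0 r \<Longrightarrow> Z q = integral {0..1} (\<lambda>s. H (s, q, Z (\<sigma> s q)))"
  proof (rule ray_fixpoint_exists[of r \<rho> p0 "\<lambda>s q z. H (s, q, z)"])
    have "continuous_on ?K (\<lambda>(s, q, w). H (s, q, w))"
      using continuous_on_subset[OF smooth_on_imp_continuous_on[OF smH] K\<Omega>] by simp
    then show "continuous_on ({0..1} \<times> cball 0 r \<times> cball p0 \<rho>) (\<lambda>(s, q, w). H (s, q, w))"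
      by (rule continuous_on_subset) (use r in auto)
    fix s :: real and q w w' :: 'p
    assume sq: "s \<in> {0..1}" "q \<in> cball 0 r" and w: "w \<in> cball p0 \<rho>"
    show "norm (H (s, q, w) - p0) \<le> \<rho>" using near[OF sq w] by (simp add: dist_norm)
    assume w': "w' \<in> cball p0 \<rho>"
    have "norm (H (s, q, w) - H (s, q, w')) \<le> 1/2 * norm (w - w')"
    proof (rule differentiable_bound[where S = "cball p0 \<rho>"])
      fix z assume z: "z \<in> cball p0 \<rho>"
      have "((\<lambda>z. (s, q, z)) has_derivative (\<lambda>v. (0, 0, v))) (at z)"
        by (auto intro!: derivative_eq_intros)
      moreover have "(H has_derivative der H (s, q, z)) (at (s, q, z))"
        by (rule smooth_on_has_derivative[OF smH]) (use z \<rho> in \<open>auto simp: \<Omega>_def\<close>)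
      ultimately have "((\<lambda>z. H (s, q, z)) has_derivative (\<lambda>v. der H (s, q, z) (0, 0, v))) (at z)"
        by (rule has_derivative_compose)
      then show "((\<lambda>z. H (s, q, z)) has_derivative (\<lambda>v. der H (s, q, z) (0, 0, v))) (at z within cball p0 \<rho>)"
        by (rule has_derivative_at_withinI)
      show "onorm (\<lambda>v. der H (s, q, z) (0, 0, v)) \<le> 1/2"
        using half[OF sq z] by (intro onorm_bound) auto
    qed (use w w' in auto)
    then show "norm (H (s, q, w) - H (s, q, w')) \<le> norm (w - w') / 2" by simp
  qed (use r \<rho> in auto)
  have ZN: "Z q \<in> N" if "q \<in> cball 0 r" for q using Z(2)[OF that] \<rho>(2) by blast
  have half': "norm (der (\<lambda>z. Y z (\<pi> q)) (Z (\<sigma> s q)) v) \<le> norm v / 2"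
    if "s \<in> {0..1}" "q \<in> cball 0 r" for s q v
    using half[OF that Z(2)[OF ray_in_cball[OF that]]] derH2[OF ZN[OF ray_in_cball[OF that]]] by simp
  have sol: "ray_solution r \<Omega> H Z"
    unfolding ray_solution_def
    using \<open>open \<Omega>\<close> Z ZN[OF ray_in_cball] half[OF _ _ Z(2)[OF ray_in_cball]] by (auto simp: \<Omega>_def simp del: mem_cball)
  have smZ: "smooth_on (ball 0 r) Z"
    using ray_solution_Ck[OF sol smooth_onD[OF smH]] by (simp add: smooth_on_def)
  obtain V :: "'p \<Rightarrow> 'p \<Rightarrow>\<^sub>L 'p" where V: "continuous_on (cball 0 r) V"
      "\<And>q. q \<in> ball 0 r \<Longrightarrow> (Z has_derivative V q) (at q)"
      "\<And>q h. q \<in> cball 0 r \<Longrightarrow>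
         ((\<lambda>s. der H (s, q, Z (\<sigma> s q)) (0, h, V (\<sigma> s q) (\<sigma> s h))) has_integral V q h) {0..1}"
    using ray_solution_C1[OF sol smooth_onD[OF smH] less_imp_le[OF r(1)]] by blast
  have dY: "((\<lambda>z. Y z w) has_derivative der (\<lambda>z. Y z w) z) (at z)" if "z \<in> N" for z w
    using smooth_on_has_derivative[OF smY that] .
  have linear_dY: "linear (der (\<lambda>z. Y z w) z)" if "z \<in> N" for z w
    using has_derivative_linear[OF dY[OF that]] .
  \<comment> \<open>Fundamental theorem of calculus for
    \<open>s \<mapsto> s *\<^sub>R Y (Z (\<sigma> s q)) w\<close>, which is 0 at 0 and
    \<open>Y (Z q) w\<close> at 1. The factor \<open>s\<close> gives the identity the shape of the
    linearised equation.\<close>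
  have integral_Y: "((\<lambda>s. Y (Z (\<sigma> s q)) w + der (\<lambda>z. Y z w) (Z (\<sigma> s q)) (s *\<^sub>R V (\<sigma> s q) (\<pi> q)))
      has_integral Y (Z q) w) {0..1}" if q: "q \<in> ball 0 r" for q w
  proof -
    have "((\<lambda>s. s *\<^sub>R Y (Z (\<sigma> s q)) w) has_vector_derivative
        (Y (Z (\<sigma> s q)) w + der (\<lambda>z. Y z w) (Z (\<sigma> s q)) (s *\<^sub>R V (\<sigma> s q) (\<pi> q)))) (at s within {0..1})"
      if s: "s \<in> {0..1}" for s
    proof -
      have \<sigma>q: "\<sigma> s q \<in> ball 0 r" using ray_in_ball[OF s q] .
      then have zN: "Z (\<sigma> s q) \<in> N" by (intro ZN) auto
      have "((\<lambda>s. \<sigma> s q) has_derivative (\<lambda>t. t *\<^sub>R \<pi> q)) (at s)"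
        unfolding \<sigma>_def by (auto intro!: derivative_eq_intros)
      from has_derivative_compose[OF this V(2)[OF \<sigma>q]]
      have "((\<lambda>s. Z (\<sigma> s q)) has_derivative (\<lambda>t. V (\<sigma> s q) (t *\<^sub>R \<pi> q))) (at s)" .
      from has_derivative_compose[OF this dY[OF zN]]
      have "((\<lambda>s. Y (Z (\<sigma> s q)) w) has_derivative
          (\<lambda>t. der (\<lambda>z. Y z w) (Z (\<sigma> s q)) (V (\<sigma> s q) (t *\<^sub>R \<pi> q)))) (at s)" .
      from has_derivative_scaleR[OF has_derivative_ident this]
      have "((\<lambda>s. s *\<^sub>R Y (Z (\<sigma> s q)) w) has_derivative
          (\<lambda>t. s *\<^sub>R der (\<lambda>z. Y z w) (Z (\<sigma> s q)) (V (\<sigma> s q) (t *\<^sub>R \<pi> q)) + t *\<^sub>R Y (Z (\<sigma> s q)) w)) (at s)" .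
      then have "((\<lambda>s. s *\<^sub>R Y (Z (\<sigma> s q)) w) has_derivative
          (\<lambda>t. t *\<^sub>R (Y (Z (\<sigma> s q)) w + der (\<lambda>z. Y z w) (Z (\<sigma> s q)) (s *\<^sub>R V (\<sigma> s q) (\<pi> q))))) (at s)"
        using linear_dY[OF zN] by (simp add: blinfun.scaleR_right linear_cmul algebra_simps)
      then show ?thesis
        unfolding has_vector_derivative_def by (rule has_derivative_at_withinI)
    qed
    from fundamental_theorem_of_calculus[OF _ this] show ?thesis by (simp add: ray_one)
  qed
  have der_integral: "((\<lambda>s. Y (Z (\<sigma> s q)) h + der (\<lambda>z. Y z (\<pi> q)) (Z (\<sigma> s q)) (s *\<^sub>R V (\<sigma> s q) h))
      has_integral V q h) {0..1}" if q: "q \<in> ball 0 r" and h: "\<pi> h = h" for q h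
  proof -
    have q': "q \<in> cball 0 r" using q by simp
    have "\<sigma> s h = s *\<^sub>R h" for s using h by (simp add: \<sigma>_def)
    then have eq: "Y (Z (\<sigma> s q)) h + der (\<lambda>z. Y z (\<pi> q)) (Z (\<sigma> s q)) (s *\<^sub>R V (\<sigma> s q) h) =
        der H (s, q, Z (\<sigma> s q)) (0, h, V (\<sigma> s q) (\<sigma> s h))" if "s \<in> {0..1}" for s
      using derH1[OF ZN[OF ray_in_cball[OF that q']]] h by (simp add: blinfun.scaleR_right)
    show ?thesis by (rule has_integral_eq[OF eq[symmetric] V(3)[OF q', of h]])
  qed
  \<comment> \<open>For \<open>h = w = \<pi> q\<close> the two integrands above coincide, so their
    integrals do.\<close>
  have radial: "V q (\<pi> q) = Y (Z q) (\<pi> q)" if "q \<in> ball 0 r" for q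
    by (rule has_integral_unique[OF der_integral[OF that proj_proj] integral_Y[OF that, of "\<pi> q"]])
  have main: "V q h = Y (Z q) h" if q: "q \<in> ball 0 r" and h: "\<pi> h = h" for q h
  proof -
    \<comment> \<open>A closed ball inside the open one supplies a compact set that is stable under
      rays.\<close>
    obtain r' where r': "norm q < r'" "r' < r" using q dense[of "norm q" r] by auto
    \<comment> \<open>The difference solves a homogeneous linear equation with factor 1/2, hence
      vanishes.\<close>
    define J where "J q = V q h - Y (Z q) h" for q
    have sub: "cball 0 r' \<subseteq> ball (0::'p) r" using r' by auto
    have "norm (J q) \<le> 0 / (1 - 1/2)"
    proof (rule sup_contraction_bound[of "cball 0 r'" "\<lambda>q. norm (J q)" "1/2" q 0])
      have "continuous_on (ball 0 r) (\<lambda>q. Y (Z q) h)"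
        using ZN by (intro continuous_on_compose2[OF smooth_on_imp_continuous_on[OF smY]]
            smooth_on_imp_continuous_on[OF smZ]) auto
      moreover have "continuous_on (ball 0 r) V" using V(1) by (rule continuous_on_subset) auto
      ultimately have "continuous_on (ball 0 r) (\<lambda>q. norm (J q))"
        unfolding J_def by (intro continuous_on_norm continuous_on_diff) (auto intro!: continuous_intros)
      then show "continuous_on (cball 0 r') (\<lambda>q. norm (J q))" using sub by (rule continuous_on_subset)
    next
      fix M :: real and q :: 'p assume M: "\<And>z. z \<in> cball 0 r' \<Longrightarrow> norm (J z) \<le> M" and q': "q \<in> cball 0 r'"
      have q: "q \<in> ball 0 r" using q' sub by blast
      have "norm (J q) \<le> 1/2 * M"
        unfolding J_def
      proof (rule norm_has_integral_unit_le[OF has_integral_diff[OF der_integral[OF q h] integral_Y[OF q]]])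
        fix s :: real assume s: "s \<in> {0..1}"
        let ?z = "Z (\<sigma> s q)"
        have \<sigma>q: "\<sigma> s q \<in> ball 0 r" "\<sigma> s q \<in> cball 0 r'" using ray_in_ball[OF s q] ray_in_cball[OF s q'] by auto
        have zN: "?z \<in> N" using \<sigma>q by (intro ZN) auto
        have sV: "s *\<^sub>R V (\<sigma> s q) (\<pi> q) = s *\<^sub>R Y ?z (\<pi> q)"
          using radial[OF \<sigma>q(1)] linY[OF zN] by (simp add: proj_ray blinfun.scaleR_right linear_cmul)
        \<comment> \<open>Once \<open>radial\<close> has replaced the velocity along the ray by a
          frame vector, commutation exchanges the directions \<open>h\<close> and
          \<open>\<pi> q\<close>.\<close>
        have "der (\<lambda>z. Y z h) ?z (s *\<^sub>R V (\<sigma> s q) (\<pi> q)) = der (\<lambda>z. Y z (\<pi> q)) ?z (s *\<^sub>R Y ?z h)"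
          unfolding sV using comm[OF zN h proj_proj, of q] linear_dY[OF zN] by (simp add: linear_cmul)
        then have "Y ?z h + der (\<lambda>z. Y z (\<pi> q)) ?z (s *\<^sub>R V (\<sigma> s q) h) -
            (Y ?z h + der (\<lambda>z. Y z h) ?z (s *\<^sub>R V (\<sigma> s q) (\<pi> q))) =
            der (\<lambda>z. Y z (\<pi> q)) ?z (s *\<^sub>R J (\<sigma> s q))"
          using linear_dY[OF zN] by (simp add: J_def scaleR_diff_right linear_diff)
        also have "norm \<dots> \<le> norm (s *\<^sub>R J (\<sigma> s q)) / 2"
          using q by (intro half' s) auto
        also have "\<dots> \<le> norm (J (\<sigma> s q)) / 2" using s by (simp add: mult_left_le_one_le)
        also have "\<dots> \<le> 1/2 * M" using M[OF \<sigma>q(2)] by simp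
        finally show "norm (Y ?z h + der (\<lambda>z. Y z (\<pi> q)) ?z (s *\<^sub>R V (\<sigma> s q) h) -
            (Y ?z h + der (\<lambda>z. Y z h) ?z (s *\<^sub>R V (\<sigma> s q) (\<pi> q)))) \<le> 1/2 * M" .
      qed
      then show "norm (J q) \<le> 0 + 1/2 * M" by simp
    qed (use r' in auto)
    then show ?thesis by (simp add: J_def)
  qed
  show ?thesis
  proof (rule that[of r Z])
    show "Z q = p0 + q" if "q \<in> ball 0 r" "\<pi> q = 0" for q
    proof -
      have q': "q \<in> cball 0 r" using that(1) by simp
      have "integral {0..1} (\<lambda>s. H (s, q, Z (\<sigma> s q))) = integral {0..1::real} (\<lambda>s. p0 + q)"
        using linY[OF ZN[OF ray_in_cball[OF _ q']]] that(2) by (intro integral_cong) (simp add: H_def linear_0)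
      with Z(3)[OF q'] show ?thesis by simp
    qed
    show "der Z q h = Y (Z q) h" if "q \<in> ball 0 r" "\<pi> h = h" for q h
      using main[OF that] der_eq[OF V(2)[OF that(1)]] by simp
  qed (use r smZ ZN in auto)
qed

end

section \<open>Brackets and linear algebra for the Frobenius theorem\<close>

lemma lie_bracket_combination_in_span:
  fixes X :: "'i \<Rightarrow> 'p::euclidean_space \<Rightarrow> 'p"
  assumes "finite I"
    and X: "\<And>i. i \<in> I \<Longrightarrow> X i differentiable at p" "\<And>i. i \<in> I \<Longrightarrow> X i p \<in> span S"
    and a: "\<And>i. i \<in> I \<Longrightarrow> a i differentiable at p"
    and b: "\<And>i. i \<in> I \<Longrightarrow> b i differentiable at p"
    and invol: "\<And>i j. i \<in> I \<Longrightarrow> j \<in> I \<Longrightarrow> lie_bracket (X i) (X j) p \<in> span S"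
  shows "lie_bracket (\<lambda>z. \<Sum>i\<in>I. a i z *\<^sub>R X i z) (\<lambda>z. \<Sum>i\<in>I. b i z *\<^sub>R X i z) p \<in> span S"
proof -
  have dsum: "der (\<lambda>z. \<Sum>i\<in>I. c i z *\<^sub>R X i z) p v =
      (\<Sum>i\<in>I. c i p *\<^sub>R der (X i) p v) + (\<Sum>i\<in>I. der (c i) p v *\<^sub>R X i p)"
    if c: "\<And>i. i \<in> I \<Longrightarrow> c i differentiable at p" for c v
  proof -
    have "((\<lambda>z. \<Sum>i\<in>I. c i z *\<^sub>R X i z) has_derivative
        (\<lambda>v. \<Sum>i\<in>I. c i p *\<^sub>R der (X i) p v + der (c i) p v *\<^sub>R X i p)) (at p)"
      by (intro has_derivative_sum has_derivative_scaleR has_derivative_der X c)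
    from der_eq[OF this] show ?thesis by (simp add: sum.distrib)
  qed
  have da: "der (\<lambda>z. \<Sum>i\<in>I. a i z *\<^sub>R X i z) p v =
      (\<Sum>i\<in>I. a i p *\<^sub>R der (X i) p v) + (\<Sum>i\<in>I. der (a i) p v *\<^sub>R X i p)" for v
    by (rule dsum) (rule a)
  have db: "der (\<lambda>z. \<Sum>i\<in>I. b i z *\<^sub>R X i z) p v =
      (\<Sum>i\<in>I. b i p *\<^sub>R der (X i) p v) + (\<Sum>i\<in>I. der (b i) p v *\<^sub>R X i p)" for v
    by (rule dsum) (rule b)
  have lin: "linear (der (X i) p)" if "i \<in> I" for i
    using has_derivative_linear[OF has_derivative_der[OF X(1)[OF that]]] .
  let ?v = "\<Sum>i\<in>I. a i p *\<^sub>R X i p" and ?w = "\<Sum>i\<in>I. b i p *\<^sub>R X i p"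
  have 1: "(\<Sum>j\<in>I. b j p *\<^sub>R der (X j) p ?v) = (\<Sum>j\<in>I. \<Sum>i\<in>I. (a i p * b j p) *\<^sub>R der (X j) p (X i p))"
    by (intro sum.cong) (auto simp: linear_sum[OF lin] linear_cmul[OF lin] scaleR_sum_right mult.commute)
  have 2: "(\<Sum>i\<in>I. a i p *\<^sub>R der (X i) p ?w) = (\<Sum>j\<in>I. \<Sum>i\<in>I. (a i p * b j p) *\<^sub>R der (X i) p (X j p))"
    by (subst sum.swap) (auto intro!: sum.cong simp: linear_sum[OF lin] linear_cmul[OF lin] scaleR_sum_right)
  \<comment> \<open>By the product rule the coefficients multiply brackets of the
    \<open>X i\<close>, and derivatives of coefficients multiply the \<open>X i\<close> themselves;
    all these terms lie in the span.\<close>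
  have "lie_bracket (\<lambda>z. \<Sum>i\<in>I. a i z *\<^sub>R X i z) (\<lambda>z. \<Sum>i\<in>I. b i z *\<^sub>R X i z) p =
      (\<Sum>j\<in>I. \<Sum>i\<in>I. (a i p * b j p) *\<^sub>R lie_bracket (X i) (X j) p) +
      (\<Sum>i\<in>I. der (b i) p ?v *\<^sub>R X i p) - (\<Sum>i\<in>I. der (a i) p ?w *\<^sub>R X i p)"
    unfolding lie_bracket_def da db 1 2
    by (simp add: scaleR_diff_right sum_subtractf)
  also have "\<dots> \<in> span S"
    by (intro span_diff span_add span_sum span_scale X(2) invol)
  finally show ?thesis .
qed

lemma span_image_subset_combinations:
  assumes "finite I"
  shows "span (f ` I) \<subseteq> {v. \<exists>c. v = (\<Sum>i\<in>I. c i *\<^sub>R f i)}"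
proof (rule span_minimal)
  show "f ` I \<subseteq> {v. \<exists>c. v = (\<Sum>i\<in>I. c i *\<^sub>R f i)}"
  proof clarify
    fix i assume "i \<in> I"
    then have "(\<Sum>j\<in>I. (if j = i then 1 else 0) *\<^sub>R f j) = f i"
      using assms by (simp add: if_distrib[of "\<lambda>c. c *\<^sub>R _"] cong: if_cong)
    then show "\<exists>c. f i = (\<Sum>j\<in>I. c j *\<^sub>R f j)" by metis
  qed
  show "subspace {v. \<exists>c. v = (\<Sum>i\<in>I. c i *\<^sub>R f i)}"
  proof (rule subspaceI; clarify)
    show "\<exists>c. 0 = (\<Sum>i\<in>I. c i *\<^sub>R f i)" by (rule exI[of _ "\<lambda>_. 0"]) simp
    show "\<exists>e. (\<Sum>i\<in>I. c i *\<^sub>R f i) + (\<Sum>i\<in>I. d i *\<^sub>R f i) = (\<Sum>i\<in>I. e i *\<^sub>R f i)" for c d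
      by (rule exI[of _ "\<lambda>i. c i + d i"]) (simp add: scaleR_add_left sum.distrib)
    show "\<exists>d. k *\<^sub>R (\<Sum>i\<in>I. c i *\<^sub>R f i) = (\<Sum>i\<in>I. d i *\<^sub>R f i)" for k c
      by (rule exI[of _ "\<lambda>i. k * c i"]) (simp add: scaleR_sum_right)
  qed
qed

text \<open>This is the orthogonal projection onto the span of \<open>B\<close>; the norm bounds of
  \<open>splitting\<close> are the theorem of Pythagoras.\<close>

lemma orthogonal_splitting:
  fixes B :: "'p::euclidean_space set"
  assumes "finite B" "pairwise orthogonal B" "\<And>b. b \<in> B \<Longrightarrow> norm b = 1"
  shows "splitting (\<lambda>q. \<Sum>b\<in>B. (q \<bullet> b) *\<^sub>R b)"
    and "b \<in> B \<Longrightarrow> (\<Sum>b'\<in>B. (b \<bullet> b') *\<^sub>R b') = b"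
proof -
  define \<pi> where "\<pi> q = (\<Sum>b\<in>B. (q \<bullet> b) *\<^sub>R b)" for q
  have lin: "linear \<pi>"
    unfolding \<pi>_def by (intro linearI) (simp_all add: inner_add_left scaleR_add_left sum.distrib scaleR_sum_right)
  have on: "b \<bullet> b' = (if b = b' then 1 else 0)" if "b \<in> B" "b' \<in> B" for b b'
    using assms(2,3) that by (auto simp: pairwise_def orthogonal_def dot_square_norm)
  have inner: "\<pi> q \<bullet> b = q \<bullet> b" if "b \<in> B" for q b
    using that assms(1) unfolding \<pi>_def by (simp add: inner_sum_left on if_distrib cong: if_cong)
  have idem: "\<pi> (\<pi> q) = \<pi> q" for q
    unfolding \<pi>_def[of "\<pi> q"] by (simp add: inner cong: sum.cong) (simp add: \<pi>_def)
  have "\<pi> b = b" if "b \<in> B" for b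
    using that assms(1) unfolding \<pi>_def by (simp add: on if_distrib[of "\<lambda>c. c *\<^sub>R _"] cong: if_cong)
  then show "b \<in> B \<Longrightarrow> (\<Sum>b'\<in>B. (b \<bullet> b') *\<^sub>R b') = b" by (simp add: \<pi>_def)
  have orth: "orthogonal (\<pi> q) (q - \<pi> q)" for q
  proof -
    have "(q - \<pi> q) \<bullet> \<pi> q = (\<Sum>b\<in>B. (q \<bullet> b) * ((q - \<pi> q) \<bullet> b))"
      unfolding \<pi>_def[of q] by (simp add: inner_sum_right inner_sum_left)
    also have "\<dots> = 0" by (simp add: inner_diff_left inner)
    finally show ?thesis by (simp add: orthogonal_def inner_commute)
  qed
  have pyth: "(norm q)\<^sup>2 = (norm (\<pi> q))\<^sup>2 + (norm (q - \<pi> q))\<^sup>2" for q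
    using norm_add_Pythagorean[OF orth, of q] by simp
  have "(norm (\<pi> q))\<^sup>2 \<le> (norm q)\<^sup>2" for q
    using pyth[of q] zero_le_power2[of "norm (q - \<pi> q)"] by linarith
  then have "norm (\<pi> q) \<le> norm q" for q
    using power2_le_imp_le[OF _ norm_ge_zero] by blast
  moreover have "(norm (q - \<pi> q))\<^sup>2 \<le> (norm q)\<^sup>2" for q
    using pyth[of q] zero_le_power2[of "norm (\<pi> q)"] by linarith
  then have "norm (q - \<pi> q) \<le> norm q" for q
    using power2_le_imp_le[OF _ norm_ge_zero] by blast
  ultimately show "splitting (\<lambda>q. \<Sum>b\<in>B. (q \<bullet> b) *\<^sub>R b)"
    using lin idem unfolding \<pi>_def splitting_def by blast
qed

text \<open>The sum bounds the operator norm of \<open>M - id\<close>. A kernel vector satisfies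
  \<open>w = w - M w\<close> and would be shorter than itself unless it is 0.\<close>

lemma linear_near_id_inverse:
  fixes M :: "'p::euclidean_space \<Rightarrow> 'p"
  assumes "linear M" "(\<Sum>b\<in>Basis. norm (M b - b)) < 1"
  shows "\<exists>M'. linear M' \<and> (\<forall>x. M' (M x) = x) \<and> (\<forall>x. M (M' x) = x)"
proof -
  have "inj M"
  proof (rule linear_injective_0[OF assms(1), THEN iffD2], intro allI impI)
    fix w assume "M w = 0"
    have "w = (\<Sum>b\<in>Basis. (w \<bullet> b) *\<^sub>R b)" by (simp add: euclidean_representation)
    then have "w = (\<Sum>b\<in>Basis. (w \<bullet> b) *\<^sub>R b) - M w" using \<open>M w = 0\<close> by simp
    also have "\<dots> = (\<Sum>b\<in>Basis. (w \<bullet> b) *\<^sub>R (b - M b))"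
      by (subst linear_eq_sum_Basis[OF assms(1)]) (simp add: sum_subtractf scaleR_diff_right)
    also have "norm \<dots> \<le> (\<Sum>b\<in>Basis. norm w * norm (M b - b))"
      by (rule sum_norm_le) (simp add: Basis_le_norm mult_right_mono norm_minus_commute)
    also have "\<dots> = norm w * (\<Sum>b\<in>Basis. norm (M b - b))" by (simp add: sum_distrib_left)
    finally have "norm w * (1 - (\<Sum>b\<in>Basis. norm (M b - b))) \<le> 0" by (simp add: algebra_simps)
    then have "norm w \<le> 0" using assms(2) by (simp add: mult_le_0_iff)
    then show "w = 0" by simp
  qed
  then show ?thesis using linear_injective_isomorphism[OF assms(1)] by simp
qed

text \<open>The rank is prescribed at \<open>p0\<close> alone: it cannot exceed
  \<open>card I\<close> anywhere, and the graph over \<open>D p0\<close> shows that it does not drop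
  nearby. The values of \<open>h\<close> lie in the kernel of the projection, whose dimension is the
  corank.\<close>

theorem frobenius:
  fixes X :: "'i \<Rightarrow> 'p::euclidean_space \<Rightarrow> 'p"
  assumes "open N" "p0 \<in> N" "finite I"
    and smX: "\<And>i. i \<in> I \<Longrightarrow> smooth_on N (X i)"
    and rank: "dim ((\<lambda>i. X i p0) ` I) = card I"
    and invol: "\<And>p i j. p \<in> N \<Longrightarrow> i \<in> I \<Longrightarrow> j \<in> I \<Longrightarrow> lie_bracket (X i) (X j) p \<in> span ((\<lambda>i. X i p) ` I)"
  obtains U and h :: "'p \<Rightarrow> 'p" where "open U" "p0 \<in> U" "U \<subseteq> N" "smooth_on U h"
    "\<And>p v. p \<in> U \<Longrightarrow> der h p v = 0 \<longleftrightarrow> v \<in> span ((\<lambda>i. X i p) ` I)"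
proof -
  define D where "D p = span ((\<lambda>i. X i p) ` I)" for p
  obtain B where B: "B \<subseteq> D p0" "pairwise orthogonal B" "\<And>b. b \<in> B \<Longrightarrow> norm b = 1" "independent B"
    "card B = dim (D p0)" "span B = D p0"
    using orthonormal_basis_subspace[of "D p0"] by (auto simp: D_def)
  have "finite B" using B(4) by (rule independent_imp_finite)
  define \<pi> where "\<pi> q = (\<Sum>b\<in>B. (q \<bullet> b) *\<^sub>R b)" for q
  interpret splitting \<pi>
    unfolding \<pi>_def[abs_def] by (rule orthogonal_splitting[OF \<open>finite B\<close> B(2,3)])
  have \<pi>B: "\<pi> b = b" if "b \<in> B" for b
    unfolding \<pi>_def by (rule orthogonal_splitting(2)[OF \<open>finite B\<close> B(2,3) that])
  have \<pi>D: "\<pi> q \<in> D p0" for q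
    unfolding \<pi>_def B(6)[symmetric] by (intro span_sum span_scale span_base)
  have "\<exists>c. b = (\<Sum>i\<in>I. c i *\<^sub>R X i p0)" if "b \<in> B" for b
    using that B(1) span_image_subset_combinations[OF \<open>finite I\<close>] unfolding D_def by blast
  then obtain c where c: "\<And>b. b \<in> B \<Longrightarrow> b = (\<Sum>i\<in>I. c b i *\<^sub>R X i p0)" by metis
  define \<alpha> where "\<alpha> i w = (\<Sum>b\<in>B. (w \<bullet> b) * c b i)" for i w
  \<comment> \<open>An orthonormal basis of \<open>D p0\<close> is written in the \<open>X i\<close>
    at \<open>p0\<close> and continued with the same coefficients. Thus \<open>A p\<close> has
    values in \<open>D p\<close>, and \<open>A p0\<close> is the projection.\<close>
  define A where "A p w = (\<Sum>i\<in>I. \<alpha> i w *\<^sub>R X i p)" for p w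
  have bl\<alpha>: "bounded_linear (\<alpha> i)" for i
    unfolding \<alpha>_def linear_conv_bounded_linear[symmetric]
    by (intro linearI) (simp_all add: inner_add_left distrib_right sum.distrib sum_distrib_left mult.assoc)
  have linA: "linear (A p)" for p
    unfolding A_def using bl\<alpha>[THEN bounded_linear.linear]
    by (intro linearI) (simp_all add: linear_add linear_cmul scaleR_add_left sum.distrib scaleR_sum_right)
  have A0: "A p0 w = \<pi> w" for w
  proof -
    have "A p0 w = (\<Sum>b\<in>B. (w \<bullet> b) *\<^sub>R (\<Sum>i\<in>I. c b i *\<^sub>R X i p0))"
      unfolding A_def \<alpha>_def by (simp add: scaleR_sum_left scaleR_sum_right sum.swap[of _ I B])
    also have "\<dots> = \<pi> w" unfolding \<pi>_def using c by (intro sum.cong) auto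
    finally show ?thesis .
  qed
  have smA: "smooth_on N (\<lambda>p. A p w)" for w
    unfolding A_def by (intro smooth_on_sum smooth_on_scaleR smooth_on_const \<open>open N\<close> smX)
  \<comment> \<open>\<open>M p0\<close> is the identity, so \<open>M p\<close> is invertible near
    \<open>p0\<close>; its inverse will correct \<open>A p\<close> such that the projected frame is
    constant.\<close>
  define M where "M p w = \<pi> (A p w) + (w - \<pi> w)" for p w
  have linM: "linear (M p)" for p
    unfolding M_def using linear_proj linA
    by (intro linearI) (simp_all add: linear_add linear_cmul algebra_simps)
  have smM: "smooth_on N (\<lambda>p. M p w)" for w
    unfolding M_def
    by (intro smooth_on_add smooth_on_const \<open>open N\<close> smooth_on_linear_image[OF bounded_linear_proj] smA)
  define g where "g p = (\<Sum>b\<in>Basis. norm (M p b - b))" for p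
  define N1 where "N1 = N \<inter> g -` {..<1}"
  have "open N1"
  proof -
    have "continuous_on N g" unfolding g_def
      by (intro continuous_intros smooth_on_imp_continuous_on smM)
    then show ?thesis unfolding N1_def using \<open>open N\<close> by (rule continuous_open_preimage) simp
  qed
  have M0: "M p0 w = w" for w unfolding M_def by (simp add: A0 proj_proj)
  have "p0 \<in> N1" using assms(2) by (simp add: N1_def g_def M0)
  have "N1 \<subseteq> N" by (auto simp: N1_def)
  have ex: "\<exists>M'. linear M' \<and> (\<forall>x. M' (M p x) = x) \<and> (\<forall>x. M p (M' x) = x)" if "p \<in> N1" for p
  proof -
    have "(\<Sum>b\<in>Basis. norm (M p b - b)) < 1" using that by (simp add: N1_def g_def)
    from linear_near_id_inverse[OF linM this] show ?thesis .
  qed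
  define M' where "M' p = (SOME M'. linear M' \<and> (\<forall>x. M' (M p x) = x) \<and> (\<forall>x. M p (M' x) = x))" for p
  have "linear (M' p) \<and> (\<forall>x. M' p (M p x) = x) \<and> (\<forall>x. M p (M' p x) = x)" if "p \<in> N1" for p
    unfolding M'_def by (rule someI_ex[OF ex[OF that]])
  then have M': "\<And>p. p \<in> N1 \<Longrightarrow> linear (M' p)"
    "\<And>p x. p \<in> N1 \<Longrightarrow> M' p (M p x) = x" "\<And>p x. p \<in> N1 \<Longrightarrow> M p (M' p x) = x"
    by simp_all
  have smM': "smooth_on N1 (\<lambda>p. M' p w)" for w
    unfolding smooth_on_def
    by (intro allI Ck_on_inverse_linear[OF \<open>open N1\<close> linM M'] smooth_onD smooth_on_subset[OF smM \<open>N1 \<subseteq> N\<close>])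
  \<comment> \<open>\<open>Y p w\<close> is the vector of \<open>D p\<close> lying above
    \<open>\<pi> w\<close>: this is \<open>D p\<close> as a graph over \<open>D p0\<close>.\<close>
  define Y where "Y p w = A p (M' p (\<pi> w))" for p w
  have linY: "linear (Y p)" if "p \<in> N1" for p
    unfolding Y_def using linear_proj linA M'(1)[OF that]
    by (intro linearI) (simp_all add: linear_add linear_cmul)
  have smY: "smooth_on N1 (\<lambda>p. Y p w)" for w
    unfolding Y_def
    by (rule smooth_on_linear_apply[OF \<open>open N1\<close> linA smooth_on_subset[OF smA \<open>N1 \<subseteq> N\<close>] smM'])
  have YD: "Y p w \<in> D p" for p w
    unfolding Y_def A_def D_def by (intro span_sum span_scale span_base imageI)
  have \<pi>Y: "\<pi> (Y p w) = \<pi> w" if "p \<in> N1" for p w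
  proof -
    let ?u = "M' p (\<pi> w)"
    have e: "\<pi> (Y p w) + (?u - \<pi> ?u) = \<pi> w"
      using M'(3)[OF that, of "\<pi> w"] by (simp add: M_def Y_def)
    from arg_cong[OF this, of \<pi>] show ?thesis
      using linear_proj by (simp add: linear_add linear_diff proj_proj)
  qed
  \<comment> \<open>\<open>Y p\<close> maps \<open>D p0\<close> injectively into \<open>D p\<close>,
    which is spanned by \<open>card I\<close> vectors; equal dimensions make it onto.\<close>
  have DY: "v = Y p (\<pi> v)" if p: "p \<in> N1" and v: "v \<in> D p" for p v
  proof -
    have inj: "inj_on (Y p) (D p0)"
    proof (rule inj_onI)
      fix x y assume xy: "x \<in> D p0" "y \<in> D p0" "Y p x = Y p y"
      have proj_id: "\<pi> x = x" if "x \<in> D p0" for x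
        using that unfolding B(6)[symmetric]
        by (induction rule: span_induct) (auto simp: \<pi>B linear_0[OF linear_proj] subspace_def linear_add[OF linear_proj] linear_cmul[OF linear_proj])
      show "x = y" using \<pi>Y[OF p, of x] \<pi>Y[OF p, of y] xy proj_id by metis
    qed
    have "subspace (Y p ` D p0)"
      using linY[OF p] unfolding D_def by (intro linear_subspace_image subspace_span)
    moreover have "Y p ` D p0 \<subseteq> D p" using YD by blast
    moreover have "dim (D p) \<le> dim (Y p ` D p0)"
    proof -
      have "dim (D p) \<le> card ((\<lambda>i. X i p) ` I)"
        unfolding D_def dim_span by (intro dim_le_card') (simp add: \<open>finite I\<close>)
      also have "\<dots> \<le> card I" by (rule card_image_le[OF \<open>finite I\<close>])
      also have "\<dots> = dim (D p0)" using rank by (simp add: D_def)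
      also have "\<dots> = dim (Y p ` D p0)"
        using inj linY[OF p] by (intro dim_image_eq[symmetric]) (simp_all add: D_def span_span)
      finally show ?thesis .
    qed
    ultimately have "Y p ` D p0 = D p"
      by (intro subspace_dim_equal) (auto simp: D_def)
    then obtain w where "v = Y p w" using v by blast
    then have "\<pi> v = \<pi> w" using \<pi>Y[OF p] by simp
    then have "Y p (\<pi> v) = Y p w" unfolding Y_def by (simp add: proj_proj)
    then show ?thesis using \<open>v = Y p w\<close> by simp
  qed
  \<comment> \<open>The bracket of two frame fields lies in \<open>D p\<close>, and
    \<open>\<pi>\<close> annihilates it because \<open>\<pi> (Y z h)\<close> is constant in
    \<open>z\<close>; on \<open>D p\<close> the projection is injective.\<close>
  have comm: "der (\<lambda>z. Y z h) p (Y p w) = der (\<lambda>z. Y z w) p (Y p h)" if p: "p \<in> N1" for p h w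
  proof -
    have Ysum: "Y z w = (\<Sum>i\<in>I. \<alpha> i (M' z (\<pi> w)) *\<^sub>R X i z)" for z w
      by (simp add: Y_def A_def)
    let ?L = "lie_bracket (\<lambda>z. Y z w) (\<lambda>z. Y z h) p"
    have diff: "(\<lambda>z. \<alpha> i (M' z (\<pi> w))) differentiable at p" for i w
      using smooth_on_has_derivative[OF smooth_on_linear_image[OF bl\<alpha> \<open>open N1\<close> smM'] p]
      by (auto simp: differentiable_def)
    have "?L \<in> D p" unfolding Ysum D_def
    proof (rule lie_bracket_combination_in_span[OF \<open>finite I\<close>])
      show "X i differentiable at p" if "i \<in> I" for i
        using smooth_on_has_derivative[OF smX[OF that]] p \<open>N1 \<subseteq> N\<close> by (auto simp: differentiable_def)
      show "lie_bracket (X i) (X j) p \<in> span ((\<lambda>i. X i p) ` I)" if "i \<in> I" "j \<in> I" for i j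
        using invol[OF _ that] p \<open>N1 \<subseteq> N\<close> by blast
    qed (use diff in \<open>auto intro: span_base\<close>)
    moreover have "\<pi> (der (\<lambda>z. Y z h) p v) = 0" for h v
    proof -
      have "((\<lambda>z. \<pi> (Y z h)) has_derivative (\<lambda>v. \<pi> (der (\<lambda>z. Y z h) p v))) (at p)"
        by (rule bounded_linear.has_derivative[OF bounded_linear_proj smooth_on_has_derivative[OF smY p]])
      then have "((\<lambda>z. \<pi> h) has_derivative (\<lambda>v. \<pi> (der (\<lambda>z. Y z h) p v))) (at p)"
        using has_derivative_cong_open[OF \<open>open N1\<close> p, of "\<lambda>z. \<pi> (Y z h)" "\<lambda>z. \<pi> h"] \<pi>Y by simp
      from has_derivative_unique[OF this has_derivative_const] show ?thesis by (simp add: fun_eq_iff)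
    qed
    then have "\<pi> ?L = 0" unfolding lie_bracket_def using linear_proj by (simp add: linear_diff)
    ultimately have "?L = Y p 0" using DY[OF p, of ?L] by simp
    then show ?thesis using linear_0[OF linY[OF p]] by (simp add: lie_bracket_def)
  qed
  obtain r \<Gamma> where \<Gamma>: "r > 0" "smooth_on (ball 0 r) \<Gamma>" "\<Gamma> ` ball 0 r \<subseteq> N1"
    "\<And>q. q \<in> ball 0 r \<Longrightarrow> \<pi> q = 0 \<Longrightarrow> \<Gamma> q = p0 + q"
    "\<And>q h. q \<in> ball 0 r \<Longrightarrow> \<pi> h = h \<Longrightarrow> der \<Gamma> q h = Y (\<Gamma> q) h"
    using commuting_frame_chart[OF \<open>open N1\<close> \<open>p0 \<in> N1\<close> linY smY comm] by metis
  have \<Gamma>0: "\<Gamma> 0 = p0" using \<Gamma>(1) \<Gamma>(4)[of 0] linear_0[OF linear_proj] by simp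
  \<comment> \<open>On the range of \<open>\<pi>\<close> the derivative is the frame at
    \<open>p0\<close>; on the kernel \<open>\<Gamma>\<close> is a translation.\<close>
  have "der \<Gamma> 0 v = v" for v
  proof -
    have d\<Gamma>: "(\<Gamma> has_derivative der \<Gamma> 0) (at 0)"
      using smooth_on_has_derivative[OF \<Gamma>(2)] \<Gamma>(1) by simp
    have "der \<Gamma> 0 (\<pi> v) = Y p0 (\<pi> v)" using \<Gamma>(1) \<Gamma>(5)[of 0 "\<pi> v"] \<Gamma>0 by (simp add: proj_proj)
    also have "\<dots> = \<pi> v"
      using M'(2)[OF \<open>p0 \<in> N1\<close>, of "\<pi> v"] by (simp add: M0 Y_def A0 proj_proj)
    finally have 1: "der \<Gamma> 0 (\<pi> v) = \<pi> v" .
    define h where "h = v - \<pi> v"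
    have \<pi>h: "\<pi> (t *\<^sub>R h) = 0" for t
      using linear_proj by (simp add: h_def linear_diff linear_cmul proj_proj)
    have "der \<Gamma> 0 h = h"
      by (rule has_derivative_affine_direction[OF d\<Gamma> open_ball[of 0 r]])
         (use \<Gamma>(1) \<Gamma>(4) \<Gamma>0 \<pi>h in auto)
    then show ?thesis using 1 linear_add[OF has_derivative_linear[OF d\<Gamma>], of "\<pi> v" h] by (simp add: h_def)
  qed
  then have "inj (der \<Gamma> 0)" by (intro injI) simp
  then obtain U0 where U0: "open U0" "0 \<in> U0" "U0 \<subseteq> ball 0 r" "diffeo_on U0 \<Gamma>"
    using smooth_local_diffeo[OF open_ball \<Gamma>(2), of 0] \<Gamma>(1) by auto
  define \<Theta> where "\<Theta> = inv_into U0 \<Gamma>"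
  define U where "U = \<Gamma> ` U0"
  have U: "open U" "smooth_on U \<Theta>" "p0 \<in> U" "U \<subseteq> N1"
    using U0 \<Gamma>(3) \<Gamma>0 unfolding U_def \<Theta>_def diffeo_on_def by (auto intro: image_eqI[of _ _ 0])
  \<comment> \<open>In the chart the distribution consists of the directions in the range of
    \<open>\<pi>\<close>, so the complementary coordinates are first integrals.\<close>
  define h where "h p = \<Theta> p - \<pi> (\<Theta> p)" for p
  have smh: "smooth_on U h"
    unfolding h_def
    by (intro smooth_on_diff U smooth_on_linear_image[OF bounded_linear_proj])
  have "der h p v = 0 \<longleftrightarrow> v \<in> D p" if "p \<in> U" for p v
  proof -
    obtain q where q: "q \<in> U0" "p = \<Gamma> q" using \<open>p \<in> U\<close> by (auto simp: U_def)
    have q': "q \<in> ball 0 r" using q U0 by blast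
    have pN1: "p \<in> N1" using that U by blast
    have inv: "der \<Theta> p (der \<Gamma> q w) = w" "der \<Gamma> q (der \<Theta> p w) = w" for w
      using diffeo_on_derivative_inverse[OF U0(4) q(1)] q(2) by (simp_all add: \<Theta>_def)
    have "(h has_derivative (\<lambda>v. der \<Theta> p v - \<pi> (der \<Theta> p v))) (at p)"
      unfolding h_def using smooth_on_has_derivative[OF U(2) that]
      by (intro has_derivative_diff bounded_linear.has_derivative[OF bounded_linear_proj])
    then have dh: "der h p v = der \<Theta> p v - \<pi> (der \<Theta> p v)" by (simp add: der_eq)
    show ?thesis
    proof
      assume "der h p v = 0"
      then have "\<pi> (der \<Theta> p v) = der \<Theta> p v" using dh by simp
      then have "v = Y p (der \<Theta> p v)" using \<Gamma>(5)[OF q'] inv(2)[of v] q(2) by metis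
      then show "v \<in> D p" using YD by metis
    next
      assume "v \<in> D p"
      then have "v = der \<Gamma> q (\<pi> v)" using DY[OF pN1] \<Gamma>(5)[OF q' proj_proj, of v] q(2) by simp
      then have "der \<Theta> p v = \<pi> v" using inv(1) by metis
      then show "der h p v = 0" using dh by (simp add: proj_proj)
    qed
  qed
  with that[of U h] U \<open>N1 \<subseteq> N\<close> smh show ?thesis by (auto simp: D_def)
qed

section \<open>From the block form to the distribution\<close>

text \<open>Differentiating \<open>der g q (u q) = 0\<close> trades \<open>der g\<close> of a
  derivative of \<open>u\<close> for a second derivative of \<open>g\<close>; the two
  second-derivative terms in the bracket cancel by symmetry. It serves for the kernel of
  \<open>f\<close> and, in block form, for the shifted coordinates outside
  \<open>x_bu\<close>.\<close>

lemma lie_bracket_in_kernel: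
  fixes g :: "'p::euclidean_space \<Rightarrow> 'q::euclidean_space"
  assumes "open N" "p \<in> N" and g: "smooth_on N g" and v: "smooth_on N v" and w: "smooth_on N w"
    and "\<And>q. q \<in> N \<Longrightarrow> der g q (v q) = 0" "\<And>q. q \<in> N \<Longrightarrow> der g q (w q) = 0"
  shows "der g p (lie_bracket v w p) = 0"
proof -
  have lin: "linear (der g q)" if "q \<in> N" for q using smooth_on_linear_der[OF g that] .
  have sym: "der (\<lambda>q. der g q a) p b = der (\<lambda>q. der g q b) p a" for a b
    using second_derivative_symmetric[OF assms(1) smooth_onD[OF g] assms(2)] .
  have dg: "((\<lambda>q. der g q b) has_derivative der (\<lambda>q. der g q b) p) (at p)" for b
    using smooth_on_has_derivative[OF smooth_on_der[OF g] assms(2)] .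
  have Leibniz: "der (\<lambda>q. der g q (u p)) p k + der g p (der u p k) = 0"
    if u: "smooth_on N u" "\<And>q. q \<in> N \<Longrightarrow> der g q (u q) = 0" for u k
  proof -
    have du: "(u has_derivative der u p) (at p)" using smooth_on_has_derivative[OF u(1) assms(2)] .
    \<comment> \<open>The basis expansion separates the two occurrences of \<open>q\<close> in
      \<open>der g q (u q)\<close>, so the product rule applies term by term.\<close>
    have "((\<lambda>q. \<Sum>b\<in>Basis. (u q \<bullet> b) *\<^sub>R der g q b) has_derivative
        (\<lambda>k. \<Sum>b\<in>Basis. (u p \<bullet> b) *\<^sub>R der (\<lambda>q. der g q b) p k + (der u p k \<bullet> b) *\<^sub>R der g p b)) (at p)"
      by (intro has_derivative_sum has_derivative_scaleR dg
           bounded_linear.has_derivative[OF bounded_linear_inner_left du])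
    moreover have "(\<Sum>b\<in>Basis. (u q \<bullet> b) *\<^sub>R der g q b) = 0" if "q \<in> N" for q
      using linear_eq_sum_Basis[OF lin[OF that], of "u q"] u(2)[OF that] by simp
    ultimately have "((\<lambda>q. 0) has_derivative
        (\<lambda>k. \<Sum>b\<in>Basis. (u p \<bullet> b) *\<^sub>R der (\<lambda>q. der g q b) p k + (der u p k \<bullet> b) *\<^sub>R der g p b)) (at p)"
      using has_derivative_cong_open[OF assms(1,2), of "\<lambda>q. \<Sum>b\<in>Basis. (u q \<bullet> b) *\<^sub>R der g q b" "\<lambda>q. 0"] by simp
    from has_derivative_unique[OF this has_derivative_const]
    have "(\<Sum>b\<in>Basis. (u p \<bullet> b) *\<^sub>R der (\<lambda>q. der g q b) p k) + (\<Sum>b\<in>Basis. (der u p k \<bullet> b) *\<^sub>R der g p b) = 0"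
      by (simp add: fun_eq_iff sum.distrib)
    moreover have "(\<Sum>b\<in>Basis. (u p \<bullet> b) *\<^sub>R der (\<lambda>q. der g q b) p k) = der (\<lambda>q. der g q (u p)) p k"
      unfolding sym[of _ k] by (rule linear_eq_sum_Basis[OF has_derivative_linear[OF dg], symmetric])
    moreover have "(\<Sum>b\<in>Basis. (der u p k \<bullet> b) *\<^sub>R der g p b) = der g p (der u p k)"
      by (rule linear_eq_sum_Basis[OF lin[OF assms(2)], symmetric])
    ultimately show ?thesis by simp
  qed
  have "der g p (der w p (v p)) = der g p (der v p (w p))"
    using Leibniz[OF w assms(7), of "v p"] Leibniz[OF v assms(6), of "w p"] sym[of "w p" "v p"]
    by (metis add_left_cancel)
  then show ?thesis unfolding lie_bracket_def using lin[OF assms(2)] by (simp add: linear_diff)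
qed

section \<open>Fibres of the kernel and input distributions\<close>

lemma kernel_dist_eq:
  fixes f :: "(real^'n) \<times> (real^'m) \<Rightarrow> real^'n"
  assumes "f differentiable at p"
  shows "kernel_dist f p = {w. der f p w = 0}"
proof -
  have "der (\<lambda>q. f q $ i) p = (\<lambda>w. der f p w $ i)" for i
    by (rule der_eq[OF bounded_linear.has_derivative[OF bounded_linear_vec_nth has_derivative_der[OF assms]]])
  then show ?thesis by (simp add: kernel_dist_def vec_eq_iff)
qed

lemma input_dist_eq: "input_dist p = {v. fst v = (0::real^'n)}" for p :: "(real^'n) \<times> (real^'m)"
proof
  show "input_dist p \<subseteq> {v. fst v = 0}"
    unfolding input_dist_def by (rule span_minimal) (auto intro!: subspaceI)
  show "{v. fst v = 0} \<subseteq> input_dist p"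
  proof
    fix v :: "(real^'n) \<times> (real^'m)" assume "v \<in> {v. fst v = 0}"
    then have "v = (\<Sum>j\<in>UNIV. snd v $ j *\<^sub>R (0, axis j 1))"
      using basis_expansion[of "snd v"]
      by (simp add: prod_eq_iff fst_sum snd_sum scalar_mult_eq_scaleR)
    also have "\<dots> \<in> input_dist p"
      unfolding input_dist_def by (intro span_sum span_scale span_base) auto
    finally show "v \<in> input_dist p" .
  qed
qed

lemma bounded_linear_coord_part: "bounded_linear (coord_part I)"
  unfolding linear_conv_bounded_linear[symmetric] coord_part_def
  by (intro linearI) (simp_all add: vec_eq_iff)

lemma dim_input_axes: "dim ((\<lambda>j. (0::real^'n, axis j (1::real))) ` (J :: 'm::finite set)) = card J"
proof -
  have "inj_on (\<lambda>j. (0::real^'n, axis j (1::real) :: real^'m)) J"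
    by (auto intro!: inj_onI simp: axis_eq_axis)
  moreover have "independent ((\<lambda>j. (0::real^'n, axis j (1::real))) ` J)"
    by (rule independent_mono[OF independent_Basis]) (auto simp: Basis_prod_def axis_in_Basis_iff)
  ultimately show ?thesis by (simp add: dim_eq_card_independent card_image)
qed

text \<open>\<open>Ubu\<close> is spanned by the fields of the new inputs with index in
  \<open>Iu\<close>. Changing such an input moves only the shifted coordinates in
  \<open>Ibu\<close>; together with the kernel of \<open>f\<close> these fields fill the common
  kernel of all other shifted coordinates.\<close>

lemma transformable_imp_distribution:
  fixes f :: "(real^'n) \<times> (real^'m) \<Rightarrow> real^'n"
  assumes "open E" and smf: "smooth_on E f" and "transformable_near mv mu X E f p0"
  shows "\<exists>S Ubu. open S \<and> p0 \<in> S \<and> S \<subseteq> E \<and> distribution_on S mu Ubu \<and>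
    (\<forall>p\<in>S. Ubu p \<subseteq> input_dist p) \<and>
    (\<forall>p\<in>S. bracket_dist S Ubu (sum_dist Ubu (kernel_dist f)) p \<subseteq> sum_dist Ubu (kernel_dist f) p)"
proof -
  obtain W G and \<phi>x :: "real^'n \<Rightarrow> real^'n"
    and \<Phi> :: "(real^'n) \<times> (real^'m) \<Rightarrow> (real^'n) \<times> (real^'m)"
    where W: "diffeo_on W \<phi>x"
    and G: "G \<subseteq> E" "p0 \<in> G" "fst ` G \<subseteq> W" "f ` G \<subseteq> W" "diffeo_on G \<Phi>"
    and bf: "in_block_form mv mu (\<Phi> ` G) (\<lambda>q. \<phi>x (f (inv_into G \<Phi> q)))"
    and \<Phi>: "\<And>q. fst (\<Phi> q) = \<phi>x (fst q)"
    using assms(3) unfolding transformable_near_def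
    by (elim exE conjE) (rule that, assumption+, simp add: case_prod_unfold)
  from bf obtain Ia Ibv Ibu Iv Iu \<sigma> T fa where
    I: "Ia \<union> Ibv \<union> Ibu = UNIV" "Ia \<inter> Ibv = {}" "Ia \<inter> Ibu = {}" "Ibv \<inter> Ibu = {}"
      "Iv \<union> Iu = UNIV" "Iv \<inter> Iu = {}" "card Iu = mu" "bij_betw \<sigma> Iv Ibv" "bij_betw \<sigma> Iu Ibu"
    and block': "\<forall>(x, w)\<in>\<Phi> ` G. (x, coord_part Iv w) \<in> T \<and>
      (\<forall>i\<in>Ia. \<phi>x (f (inv_into G \<Phi> (x, w))) $ i = fa (x, coord_part Iv w) $ i) \<and>
      (\<forall>j\<in>Iv. \<phi>x (f (inv_into G \<Phi> (x, w))) $ \<sigma> j = w $ j) \<and>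
      (\<forall>j\<in>Iu. \<phi>x (f (inv_into G \<Phi> (x, w))) $ \<sigma> j = w $ j)"
    unfolding in_block_form_def by (elim exE conjE) (rule that, assumption+)
  have block: "(\<forall>i\<in>Ia. \<phi>x (f (inv_into G \<Phi> (x, w))) $ i = fa (x, coord_part Iv w) $ i)"
      "(\<forall>j\<in>Iv. \<phi>x (f (inv_into G \<Phi> (x, w))) $ \<sigma> j = w $ j)"
      "(\<forall>j\<in>Iu. \<phi>x (f (inv_into G \<Phi> (x, w))) $ \<sigma> j = w $ j)"
    if "(x, w) \<in> \<Phi> ` G" for x w
    using bspec[OF block' that] by simp_all
  have "open G" and "inj_on \<Phi> G" and "open (\<Phi> ` G)" and smPhi: "smooth_on G \<Phi>"
    and sm_inv: "smooth_on (\<Phi> ` G) (inv_into G \<Phi>)"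
    using G(5) by (auto simp: diffeo_on_def)
  have "open W" and smphi: "smooth_on W \<phi>x" using W by (auto simp: diffeo_on_def)
  have smfG: "smooth_on G f" using smf G(1) by (rule smooth_on_subset)
  define \<psi> where "\<psi> p = \<phi>x (f p)" for p
  have smpsi: "smooth_on G \<psi>"
    unfolding \<psi>_def by (rule smooth_on_compose[OF \<open>open G\<close> \<open>open W\<close> G(4) smfG smphi])
  define g where "g y = \<psi> (inv_into G \<Phi> y)" for y
  have smg: "smooth_on (\<Phi> ` G) g"
    unfolding g_def using \<open>inj_on \<Phi> G\<close>
    by (intro smooth_on_compose[OF \<open>open (\<Phi> ` G)\<close> \<open>open G\<close> _ sm_inv smpsi]) auto
  \<comment> \<open>The coordinate field of the new input \<open>j\<close>, expressed in the
    original coordinates.\<close>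
  define \<Xi> where "\<Xi> j p = der (inv_into G \<Phi>) (\<Phi> p) (0, axis j 1)" for j p
  have smXi: "smooth_on G (\<Xi> j)" for j
    unfolding \<Xi>_def
    by (rule smooth_on_compose[OF \<open>open G\<close> \<open>open (\<Phi> ` G)\<close> subset_refl smPhi smooth_on_der[OF sm_inv]])
  have \<sigma>UN: "i \<in> Ia \<or> (\<exists>j. i = \<sigma> j)" for i
    using I(1,8,9) by (auto simp: bij_betw_def)
  have \<sigma>inj: "\<sigma> j = \<sigma> k \<longleftrightarrow> j = k" for j k
    using I(4-6,8,9) by (auto simp: bij_betw_def inj_on_def) (metis Un_iff UNIV_I disjoint_iff image_eqI)+
  have \<sigma>Ia: "\<sigma> j \<notin> Ia" for j
  proof -
    have "j \<in> Iv \<or> j \<in> Iu" using I(5) by blast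
    then show ?thesis using I(2,3,8,9) unfolding bij_betw_def by blast
  qed
  have \<sigma>Iu: "\<sigma> j \<in> Ibu" if "j \<in> Iu" for j using I(9) that by (auto simp: bij_betw_def)
  have gIa: "g (x, w) $ i = fa (x, coord_part Iv w) $ i" if "(x, w) \<in> \<Phi> ` G" "i \<in> Ia" for x w i
    using block(1)[OF that(1)] that(2) by (simp add: g_def \<psi>_def)
  have g\<sigma>: "g (x, w) $ \<sigma> j = w $ j" if "(x, w) \<in> \<Phi> ` G" for x w j
    using block(2,3)[OF that] I(5) unfolding g_def \<psi>_def by blast
  \<comment> \<open>Along the input direction \<open>j\<close> in \<open>Iu\<close> the argument
    \<open>coord_part Iv w\<close> of \<open>fa\<close> does not change, so \<open>g\<close> is
    affine there.\<close>
  have psiXi: "der \<psi> p (\<Xi> j p) = axis (\<sigma> j) 1" if p: "p \<in> G" and j: "j \<in> Iu" for p j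
  proof -
    have \<Phi>p: "\<Phi> p \<in> \<Phi> ` G" "inv_into G \<Phi> (\<Phi> p) = p" using p \<open>inj_on \<Phi> G\<close> by auto
    have "(g has_derivative (\<lambda>v. der \<psi> p (der (inv_into G \<Phi>) (\<Phi> p) v))) (at (\<Phi> p))"
      unfolding g_def
      using has_derivative_compose[OF smooth_on_has_derivative[OF sm_inv \<Phi>p(1)], of \<psi> "der \<psi> p"]
        smooth_on_has_derivative[OF smpsi p] \<Phi>p(2) by simp
    then show ?thesis unfolding \<Xi>_def
    proof (rule has_derivative_affine_direction[OF _ \<open>open (\<Phi> ` G)\<close> \<Phi>p(1)])
      fix t :: real assume t: "\<Phi> p + t *\<^sub>R (0, axis j 1) \<in> \<Phi> ` G"
      obtain x w where xw: "\<Phi> p = (x, w)" by (cases "\<Phi> p")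
      have in1: "(x, w) \<in> \<Phi> ` G" and in2: "(x, w + t *\<^sub>R axis j 1) \<in> \<Phi> ` G"
        using t \<Phi>p(1) unfolding xw by simp_all
      have cp: "coord_part Iv (w + t *\<^sub>R axis j 1) = coord_part Iv w"
        using j I(6) by (auto simp: coord_part_def vec_eq_iff axis_def)
      show "g (\<Phi> p + t *\<^sub>R (0, axis j 1)) = g (\<Phi> p) + t *\<^sub>R axis (\<sigma> j) 1"
      proof (subst vec_eq_iff, rule allI)
        fix i
        consider "i \<in> Ia" | k where "i = \<sigma> k" using \<sigma>UN by blast
        then show "g (\<Phi> p + t *\<^sub>R (0, axis j 1)) $ i = (g (\<Phi> p) + t *\<^sub>R axis (\<sigma> j) 1) $ i"
        proof cases
          case 1
          then have "(axis (\<sigma> j) 1 :: real^'n) $ i = 0" using \<sigma>Ia by (auto simp: axis_def)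
          then show ?thesis using gIa[OF in1 1] gIa[OF in2 1] by (simp add: xw cp)
        next
          case 2
          then have "(axis (\<sigma> j) 1 :: real^'n) $ i = (axis j 1 :: real^'m) $ k"
            by (simp add: axis_def \<sigma>inj)
          then show ?thesis using g\<sigma>[OF in1] g\<sigma>[OF in2] 2 by (simp add: xw)
        qed
      qed
    qed
  qed
  define Ubu where "Ubu p = span ((\<lambda>j. \<Xi> j p) ` Iu)" for p
  \<comment> \<open>The shifted coordinates outside \<open>x_bu\<close>; the kernel of their
    differential will be identified with the sum distribution.\<close>
  define \<chi>g where "\<chi>g p = coord_part (- Ibu) (\<psi> p)" for p
  have smchi: "smooth_on G \<chi>g"
    unfolding \<chi>g_def by (rule smooth_on_linear_image[OF bounded_linear_coord_part \<open>open G\<close> smpsi])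
  have derchi: "der \<chi>g p v = coord_part (- Ibu) (der \<psi> p v)" if "p \<in> G" for p v
    unfolding \<chi>g_def
    using der_eq[OF bounded_linear.has_derivative[OF bounded_linear_coord_part smooth_on_has_derivative[OF smpsi that]]]
    by simp
  have cp_linear: "linear (coord_part J)" for J :: "'n set"
    using bounded_linear_coord_part bounded_linear.linear by blast
  have derpsi0: "der \<psi> p v = 0 \<longleftrightarrow> der f p v = 0" if p: "p \<in> G" for p v
  proof -
    have fp: "f p \<in> W" using p G(4) by blast
    have "(\<psi> has_derivative (\<lambda>v. der \<phi>x (f p) (der f p v))) (at p)"
      unfolding \<psi>_def
      by (rule has_derivative_compose[OF smooth_on_has_derivative[OF smfG p] smooth_on_has_derivative[OF smphi fp]])
    then have "der \<psi> p v = der \<phi>x (f p) (der f p v)" by (simp add: der_eq)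
    then show ?thesis
      using diffeo_on_derivative_inverse(1)[OF W fp, of "der f p v"] linear_0[OF smooth_on_linear_der[OF smphi fp]]
        diffeo_on_derivative_inverse(1)[OF W fp, of 0] by metis
  qed
  have XiD: "der \<chi>g p (\<Xi> j p) = 0" if "p \<in> G" "j \<in> Iu" for p j
    using derchi[OF that(1)] psiXi[OF that] \<sigma>Iu[OF that(2)] by (auto simp: coord_part_def vec_eq_iff axis_def)
  have UbuD: "der \<chi>g p v = 0" if p: "p \<in> G" and "v \<in> Ubu p" for p v
  proof -
    have "Ubu p \<subseteq> {v. der \<chi>g p v = 0}"
      unfolding Ubu_def using XiD[OF p] smooth_on_linear_der[OF smchi p]
      by (intro span_minimal linear_subspace_kernel) auto
    then show ?thesis using that by blast
  qed
  have sum_eq: "sum_dist Ubu (kernel_dist f) p = {v. der \<chi>g p v = 0}" if p: "p \<in> G" for p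
  proof -
    have ker: "kernel_dist f p = {w. der f p w = 0}"
      using smooth_on_has_derivative[OF smfG p] by (intro kernel_dist_eq) (auto simp: differentiable_def)
    show ?thesis
    proof (intro equalityI subsetI)
      fix v assume "v \<in> sum_dist Ubu (kernel_dist f) p"
      then obtain a b where ab: "v = a + b" "a \<in> Ubu p" "der f p b = 0"
        unfolding sum_dist_def ker by blast
      then have "der \<psi> p b = 0" using derpsi0[OF p] by blast
      then have "der \<chi>g p b = 0" using derchi[OF p, of b] linear_0[OF cp_linear] by simp
      then show "v \<in> {v. der \<chi>g p v = 0}"
        using UbuD[OF p ab(2)] linear_add[OF smooth_on_linear_der[OF smchi p]] by (simp add: ab(1))
    next
      fix v assume "v \<in> {v. der \<chi>g p v = 0}"
      then have v: "coord_part (- Ibu) (der \<psi> p v) = 0" using derchi[OF p] by simp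
      \<comment> \<open>\<open>a\<close> reproduces the \<open>Ibu\<close> components of
        \<open>der \<psi> p v\<close>. The other components vanish, so \<open>v - a\<close> lies in
        the kernel of \<open>f\<close>.\<close>
      define a where "a = (\<Sum>j\<in>Iu. (der \<psi> p v $ \<sigma> j) *\<^sub>R \<Xi> j p)"
      have lin: "linear (der \<psi> p)" using smooth_on_linear_der[OF smpsi p] .
      have "der \<psi> p a = (\<Sum>j\<in>Iu. (der \<psi> p v $ \<sigma> j) *\<^sub>R axis (\<sigma> j) 1)"
        unfolding a_def using psiXi[OF p] by (simp add: linear_sum[OF lin] linear_cmul[OF lin])
      also have "\<dots> = der \<psi> p v"
      proof (subst vec_eq_iff, rule allI)
        fix i
        show "(\<Sum>j\<in>Iu. (der \<psi> p v $ \<sigma> j) *\<^sub>R axis (\<sigma> j) 1) $ i = der \<psi> p v $ i"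
        proof (cases "i \<in> Ibu")
          case True
          then obtain k where k: "k \<in> Iu" "i = \<sigma> k" using I(9) by (auto simp: bij_betw_def)
          have "(\<Sum>j\<in>Iu. der \<psi> p v $ \<sigma> j * (axis (\<sigma> j) 1 :: real^'n) $ i) = (\<Sum>j\<in>Iu. if j = k then der \<psi> p v $ \<sigma> j else 0)"
            by (intro sum.cong) (auto simp: axis_def k \<sigma>inj)
          then show ?thesis using k by simp
        next
          case False
          then have "der \<psi> p v $ i = 0" using v by (auto simp: coord_part_def vec_eq_iff split: if_splits)
          moreover have "(\<Sum>j\<in>Iu. der \<psi> p v $ \<sigma> j * (axis (\<sigma> j) 1 :: real^'n) $ i) = 0"
            using False \<sigma>Iu by (intro sum.neutral) (auto simp: axis_def)
          ultimately show ?thesis by simp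
        qed
      qed
      finally have "der \<psi> p (v - a) = 0" using lin by (simp add: linear_diff)
      then have "der f p (v - a) = 0" using derpsi0[OF p] by blast
      moreover have "a \<in> Ubu p"
        unfolding a_def Ubu_def by (intro span_sum span_scale span_base) auto
      ultimately show "v \<in> sum_dist Ubu (kernel_dist f) p"
        unfolding sum_dist_def ker by (intro CollectI exI[of _ a] exI[of _ "v - a"]) auto
    qed
  qed
  have dimU: "dim (Ubu p) = mu" if p: "p \<in> G" for p
  proof -
    let ?L = "der (inv_into G \<Phi>) (\<Phi> p)"
    have lin: "linear ?L" using smooth_on_linear_der[OF sm_inv] p by blast
    have "inj ?L" using diffeo_on_derivative_inverse(2)[OF G(5) p] by (metis injI)
    have "Ubu p = span (?L ` (\<lambda>j. (0, axis j 1)) ` Iu)"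
      unfolding Ubu_def \<Xi>_def by (simp add: image_image)
    then have "dim (Ubu p) = dim ((\<lambda>j. (0::real^'n, axis j (1::real))) ` Iu)"
      using dim_image_eq[OF lin] \<open>inj ?L\<close> by (simp add: inj_on_subset)
    then show ?thesis using I(7) by (simp add: dim_input_axes)
  qed
  obtain e where e: "bij_betw e {..<mu} Iu"
    using I(7) ex_bij_betw_nat_finite[of Iu] by (auto simp: atLeast0LessThan)
  have "(\<lambda>i. \<Xi> (e i) q) ` {..<mu} = (\<lambda>j. \<Xi> j q) ` e ` {..<mu}" for q by (simp add: image_image)
  then have frame: "Ubu q = span ((\<lambda>i. \<Xi> (e i) q) ` {..<mu})" for q
    using e unfolding Ubu_def bij_betw_def by simp
  have "distribution_on G mu Ubu"
    unfolding distribution_on_def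
  proof (intro conjI ballI dimU)
    fix p assume "p \<in> G"
    then show "\<exists>N X. open N \<and> p \<in> N \<and> N \<subseteq> G \<and> (\<forall>i<mu. smooth_on N (X i)) \<and>
        (\<forall>q\<in>N. Ubu q = span ((\<lambda>i. X i q) ` {..<mu}))"
      using \<open>open G\<close> smXi frame by (intro exI[of _ G] exI[of _ "\<lambda>i. \<Xi> (e i)"] conjI allI impI ballI) auto
  qed
  moreover have "Ubu p \<subseteq> input_dist p" if p: "p \<in> G" for p
  proof -
    have p': "fst p \<in> W" using p G(3) by blast
    \<comment> \<open>The state part of \<open>\<Phi>\<close> depends on the state only, so a
      direction that leaves the new state fixed also leaves the old one fixed.\<close>
    have "fst (\<Xi> j p) = 0" for j
    proof -
      have "((\<lambda>q. fst (\<Phi> q)) has_derivative (\<lambda>v. fst (der \<Phi> p v))) (at p)"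
        by (rule has_derivative_fst[OF smooth_on_has_derivative[OF smPhi p]])
      moreover have "((\<lambda>q. \<phi>x (fst q)) has_derivative (\<lambda>v. der \<phi>x (fst p) (fst v))) (at p)"
        by (rule has_derivative_compose[OF has_derivative_fst[OF has_derivative_ident] smooth_on_has_derivative[OF smphi p']])
      moreover have "(\<lambda>q. fst (\<Phi> q)) = (\<lambda>q. \<phi>x (fst q))" by (auto simp: \<Phi>)
      ultimately have "(\<lambda>v. fst (der \<Phi> p v)) = (\<lambda>v. der \<phi>x (fst p) (fst v))"
        using has_derivative_unique by metis
      then have "der \<phi>x (fst p) (fst (\<Xi> j p)) = fst (der \<Phi> p (\<Xi> j p))" by metis
      also have "\<dots> = 0" unfolding \<Xi>_def by (simp add: diffeo_on_derivative_inverse(2)[OF G(5) p])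
      finally show ?thesis
        using diffeo_on_derivative_inverse(1)[OF W p', of "fst (\<Xi> j p)"]
          diffeo_on_derivative_inverse(1)[OF W p', of 0] linear_0[OF smooth_on_linear_der[OF smphi p']] by metis
    qed
    then show ?thesis
      unfolding input_dist_eq Ubu_def by (intro span_minimal) (auto intro!: subspaceI)
  qed
  moreover have "bracket_dist G Ubu (sum_dist Ubu (kernel_dist f)) p \<subseteq> sum_dist Ubu (kernel_dist f) p"
    if p: "p \<in> G" for p
    unfolding bracket_dist_def sum_eq[OF p]
  proof (rule span_minimal)
    show "subspace {v. der \<chi>g p v = 0}"
      by (rule linear_subspace_kernel[OF smooth_on_linear_der[OF smchi p]])
    show "{lie_bracket v w p |v w N. open N \<and> p \<in> N \<and> N \<subseteq> G \<and> vector_field_in N Ubu v \<and>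
        vector_field_in N (sum_dist Ubu (kernel_dist f)) w} \<subseteq> {v. der \<chi>g p v = 0}"
    proof
      fix z assume "z \<in> {lie_bracket v w p |v w N. open N \<and> p \<in> N \<and> N \<subseteq> G \<and> vector_field_in N Ubu v \<and>
        vector_field_in N (sum_dist Ubu (kernel_dist f)) w}"
      then obtain v w N where z: "z = lie_bracket v w p" and N: "open N" "p \<in> N" "N \<subseteq> G"
        and v: "vector_field_in N Ubu v" and w: "vector_field_in N (sum_dist Ubu (kernel_dist f)) w"
        by blast
      have "der \<chi>g p (lie_bracket v w p) = 0"
      proof (rule lie_bracket_in_kernel[OF N(1,2) smooth_on_subset[OF smchi N(3)]])
        show "der \<chi>g q (v q) = 0" if "q \<in> N" for q
          using v that N(3) by (intro UbuD) (auto simp: vector_field_in_def)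
        show "der \<chi>g q (w q) = 0" if "q \<in> N" for q
          using w that N(3) sum_eq[of q] by (auto simp: vector_field_in_def)
      qed (use v w in \<open>auto simp: vector_field_in_def\<close>)
      then show "z \<in> {v. der \<chi>g p v = 0}" by (simp add: z)
    qed
  qed
  ultimately show ?thesis using \<open>open G\<close> G(1,2) by blast
qed

section \<open>From the distribution to the block form\<close>

lemma dim_kernel_surj:
  fixes A :: "'a::euclidean_space \<Rightarrow> 'b::euclidean_space"
  assumes "linear A" "surj A"
  shows "dim {v. A v = 0} + DIM('b) = DIM('a)"
proof -
  obtain g where g: "linear g" "A \<circ> g = id"
    using linear_surjective_right_inverse[OF assms] by blast
  have Ag: "A (g y) = y" for y using g(2) by (simp add: fun_eq_iff)
  have "inj g" using Ag by (metis injI)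
  let ?K = "{v. A v = 0}"
  have sub: "subspace ?K" "subspace (range g)"
    using linear_subspace_kernel[OF assms(1)] linear_subspace_image[OF g(1) subspace_UNIV] by auto
  have "{x + y | x y. x \<in> ?K \<and> y \<in> range g} = UNIV"
  proof -
    have "v \<in> {x + y | x y. x \<in> ?K \<and> y \<in> range g}" for v
      using assms(1) Ag by (intro CollectI exI[of _ "v - g (A v)"] exI[of _ "g (A v)"]) (simp add: linear_diff)
    then show ?thesis by blast
  qed
  moreover have "?K \<inter> range g = {0}"
    using Ag linear_0[OF g(1)] linear_0[OF assms(1)] by (auto intro: range_eqI[of _ _ 0])
  moreover have "dim (range g) = DIM('b)"
    using dim_image_eq[OF g(1), of UNIV] \<open>inj g\<close> by simp
  ultimately show ?thesis using dim_sums_Int[OF sub] by simp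
qed

text \<open>The kernel of \<open>der f p0\<close> has dimension \<open>CARD('m)\<close>, so a linear
  map that is injective on it completes \<open>f\<close> to a chart.\<close>

lemma submersion_chart:
  fixes f :: "(real^'n) \<times> (real^'m) \<Rightarrow> real^'n"
  assumes "open E" and f: "smooth_on E f" and "p0 \<in> E" and "surj (der f p0)"
  obtains U and \<kappa> :: "(real^'n) \<times> (real^'m) \<Rightarrow> real^'m"
  where "linear \<kappa>" "open U" "p0 \<in> U" "U \<subseteq> E" "diffeo_on U (\<lambda>p. (f p, \<kappa> p))"
proof -
  let ?K = "{v. der f p0 v = 0}"
  have lin: "linear (der f p0)" using smooth_on_linear_der[OF f assms(3)] .
  have "dim ?K = dim (UNIV :: (real^'m) set)"
    using dim_kernel_surj[OF lin assms(4)] by simp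
  then obtain \<kappa> :: "(real^'n) \<times> (real^'m) \<Rightarrow> real^'m" where \<kappa>: "linear \<kappa>" "inj_on \<kappa> ?K"
    using subspace_isomorphism[OF linear_subspace_kernel[OF lin] subspace_UNIV] by blast
  then have bl: "bounded_linear \<kappa>" by (simp add: linear_conv_bounded_linear)
  let ?F = "\<lambda>p. (f p, \<kappa> p)"
  have sm: "smooth_on E ?F"
    by (intro smooth_on_Pair assms smooth_on_bounded_linear bl)
  have "(?F has_derivative (\<lambda>v. (der f p0 v, \<kappa> v))) (at p0)"
    by (intro has_derivative_Pair smooth_on_has_derivative[OF f assms(3)] bounded_linear_imp_has_derivative bl)
  then have der: "der ?F p0 = (\<lambda>v. (der f p0 v, \<kappa> v))" by (rule der_eq)
  have "inj (der ?F p0)"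
  proof (rule linear_injective_0[OF smooth_on_linear_der[OF sm assms(3)], THEN iffD2], intro allI impI)
    fix v assume "der ?F p0 v = 0"
    then have "v \<in> ?K" "\<kappa> v = \<kappa> 0" by (simp_all add: der prod_eq_iff linear_0[OF \<kappa>(1)])
    then show "v = 0" using inj_onD[OF \<kappa>(2), of v 0] linear_0[OF lin] by simp
  qed
  from smooth_local_diffeo[OF assms(1) sm assms(3) this] that[OF \<kappa>(1)] show ?thesis by blast
qed

text \<open>In the chart \<open>(f, \<kappa>)\<close> the differential of \<open>h\<close> has no
  component along \<open>\<kappa>\<close>. Constancy along a fibre requires connectedness, which is
  ensured by taking for \<open>P\<close> the preimage of a product with a ball.\<close>

lemma factor_through_submersion:
  fixes f :: "(real^'n) \<times> (real^'m) \<Rightarrow> real^'n" and h :: "(real^'n) \<times> (real^'m) \<Rightarrow> 'c::euclidean_space"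
  assumes "open E" and f: "smooth_on E f" and "p0 \<in> E" and "surj (der f p0)"
    and h: "smooth_on E h" and ker: "\<And>p v. p \<in> E \<Longrightarrow> der f p v = 0 \<Longrightarrow> der h p v = 0"
  obtains P Q \<eta> where "open P" "p0 \<in> P" "P \<subseteq> E" "open Q" "f ` P \<subseteq> Q" "smooth_on Q \<eta>"
    "\<And>p. p \<in> P \<Longrightarrow> h p = \<eta> (f p)"
proof -
  obtain U and \<kappa> :: "(real^'n) \<times> (real^'m) \<Rightarrow> real^'m"
    where U: "linear \<kappa>" "open U" "p0 \<in> U" "U \<subseteq> E" and diffeo: "diffeo_on U (\<lambda>p. (f p, \<kappa> p))"
    by (rule submersion_chart[OF assms(1-4)])
  define F where "F p = (f p, \<kappa> p)" for p
  define \<Theta> where "\<Theta> = inv_into U F"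
  have diffeoF: "diffeo_on U F" using diffeo by (simp add: F_def[abs_def])
  then have FU: "open (F ` U)" "smooth_on U F" "inj_on F U" "smooth_on (F ` U) \<Theta>"
    by (auto simp: diffeo_on_def \<Theta>_def)
  have \<Theta>U: "\<Theta> y \<in> U" "F (\<Theta> y) = y" if "y \<in> F ` U" for y
    using that unfolding \<Theta>_def by (auto intro: inv_into_into f_inv_into_f)
  have "(f p0, \<kappa> p0) \<in> F ` U" using U(3) by (auto simp: F_def)
  then obtain A B where AB: "open A" "open B" "f p0 \<in> A" "\<kappa> p0 \<in> B" "A \<times> B \<subseteq> F ` U"
    using FU(1) unfolding open_prod_def by (metis mem_Sigma_iff)
  obtain e where e: "e > 0" "ball (\<kappa> p0) e \<subseteq> B" using AB(2,4) open_contains_ball by blast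
  define Q where "Q = A"
  define P where "P = U \<inter> F -` (A \<times> ball (\<kappa> p0) e)"
  have sub: "A \<times> ball (\<kappa> p0) e \<subseteq> F ` U" using AB(5) e(2) by blast
  \<comment> \<open>The values of \<open>h\<close> on the section of \<open>f\<close> where
    \<open>\<kappa>\<close> equals \<open>\<kappa> p0\<close>.\<close>
  define \<eta> where "\<eta> y = h (\<Theta> (y, \<kappa> p0))" for y
  have "open P" unfolding P_def
    using continuous_open_preimage[OF smooth_on_imp_continuous_on[OF FU(2)] U(2)] AB(1) open_Times by blast
  moreover have "p0 \<in> P" using U(3) AB(3) e(1) by (simp add: P_def F_def)
  moreover have "P \<subseteq> E" using U(4) by (auto simp: P_def)
  moreover have "f ` P \<subseteq> A" by (auto simp: P_def F_def)
  moreover have sm\<Theta>: "smooth_on (F ` U) (\<lambda>y. h (\<Theta> y))"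
    by (rule smooth_on_compose[OF FU(1) U(2) _ FU(4) smooth_on_subset[OF h U(4)]]) (rule image_subsetI, rule \<Theta>U)
  have "smooth_on A \<eta>" unfolding \<eta>_def
    by (rule smooth_on_compose[OF AB(1) FU(1) _ _ sm\<Theta>])
       (use sub e(1) in \<open>auto intro!: smooth_on_Pair smooth_on_id smooth_on_const AB(1)\<close>)
  moreover have "h p = \<eta> (f p)" if p: "p \<in> P" for p
  proof -
    have pU: "p \<in> U" and fp: "f p \<in> A" and \<kappa>p: "\<kappa> p \<in> ball (\<kappa> p0) e" using p by (auto simp: P_def F_def)
    have "((\<lambda>k. h (\<Theta> (f p, k))) has_derivative (\<lambda>v. 0)) (at k within ball (\<kappa> p0) e)"
      if k: "k \<in> ball (\<kappa> p0) e" for k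
    proof -
      have y: "(f p, k) \<in> F ` U" using sub fp k by blast
      let ?q = "\<Theta> (f p, k)"
      have q: "?q \<in> U" "F ?q = (f p, k)" using \<Theta>U[OF y] by auto
      have "((\<lambda>k. (f p, k)) has_derivative (\<lambda>v. (0, v))) (at k)"
        by (auto intro!: derivative_eq_intros)
      from has_derivative_compose[OF this smooth_on_has_derivative[OF FU(4) y]]
      have "((\<lambda>k. \<Theta> (f p, k)) has_derivative (\<lambda>v. der \<Theta> (f p, k) (0, v))) (at k)" .
      from has_derivative_compose[OF this smooth_on_has_derivative[OF h]] q(1) U(4)
      have D: "((\<lambda>k. h (\<Theta> (f p, k))) has_derivative (\<lambda>v. der h ?q (der \<Theta> (f p, k) (0, v)))) (at k)"
        by blast
      have "der f ?q (der \<Theta> (f p, k) (0, v)) = 0" for v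
      proof -
        have "(F has_derivative (\<lambda>v. (der f ?q v, \<kappa> v))) (at ?q)"
          unfolding F_def using q(1) U(1,4)
          by (intro has_derivative_Pair smooth_on_has_derivative[OF f] bounded_linear_imp_has_derivative)
             (auto simp: linear_conv_bounded_linear)
        then have "der F ?q = (\<lambda>v. (der f ?q v, \<kappa> v))" by (rule der_eq)
        moreover have "der F ?q (der \<Theta> (f p, k) (0, v)) = (0, v)"
          using diffeo_on_derivative_inverse(2)[OF diffeoF q(1)] q(2) by (simp add: \<Theta>_def)
        ultimately show ?thesis by simp
      qed
      then have "der h ?q (der \<Theta> (f p, k) (0, v)) = 0" for v using ker q(1) U(4) by blast
      then show ?thesis using D by (simp add: has_derivative_at_withinI)
    qed
    then obtain c where c: "\<And>k. k \<in> ball (\<kappa> p0) e \<Longrightarrow> h (\<Theta> (f p, k)) = c"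
      using has_derivative_zero_constant[OF convex_ball, of "\<kappa> p0" e "\<lambda>k. h (\<Theta> (f p, k))"] by blast
    have "\<Theta> (f p, \<kappa> p) = p" using FU(3) pU by (simp add: \<Theta>_def F_def[symmetric])
    then show ?thesis using c[OF \<kappa>p] c[of "\<kappa> p0"] e(1) by (simp add: \<eta>_def)
  qed
  ultimately show ?thesis using that AB(1) by blast
qed

text \<open>A chain of bases of \<open>\<Delta>\<close>, \<open>R\<close> and the whole space is
  sent to unit vectors. Indices hit by the basis of \<open>R\<close> belong to the shifted inputs,
  \<open>\<sigma>\<close> matches them with the inputs, and \<open>Iu\<close> marks those coming
  from \<open>\<Delta>\<close>; this fixes the index sets of the block form.\<close>

lemma adapted_coordinates:
  fixes \<Delta> R :: "(real^'n) set"
  assumes "subspace \<Delta>" "subspace R" "\<Delta> \<subseteq> R" "dim R = CARD('m::finite)"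
  obtains B :: "real^'n \<Rightarrow> real^'n" and \<sigma> :: "'m::finite \<Rightarrow> 'n" and Iu where "linear B" "inj B" "inj \<sigma>" "card Iu = dim \<Delta>"
    "\<And>v i. v \<in> \<Delta> \<Longrightarrow> i \<notin> \<sigma> ` Iu \<Longrightarrow> B v $ i = 0"
    "\<And>v i. v \<in> R \<Longrightarrow> i \<notin> range \<sigma> \<Longrightarrow> B v $ i = 0"
proof -
  obtain Bu where Bu: "Bu \<subseteq> \<Delta>" "independent Bu" "\<Delta> \<subseteq> span Bu" "card Bu = dim \<Delta>"
    by (rule basis_exists)
  obtain Br where Br: "Bu \<subseteq> Br" "Br \<subseteq> R" "independent Br" "R \<subseteq> span Br"
    using maximal_independent_subset_extend[of Bu R] Bu assms(3) by blast
  obtain Bn where Bn: "Br \<subseteq> Bn" "Bn \<subseteq> UNIV" "independent Bn" "UNIV \<subseteq> span Bn"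
    by (rule maximal_independent_subset_extend[OF subset_UNIV Br(3)])
  have fin: "finite Bn" "finite Br" "finite Bu"
    by (rule independent_imp_finite[OF Bn(3)], rule independent_imp_finite[OF Br(3)],
        rule independent_imp_finite[OF Bu(2)])
  have "card Br = CARD('m)" using basis_card_eq_dim[OF Br(2,4,3)] assms(4) by simp
  then obtain \<rho> where \<rho>: "bij_betw \<rho> (UNIV :: 'm set) Br"
    using finite_same_card_bij[OF finite_class.finite_UNIV fin(2)] by metis
  have "card Bn = CARD('n)" using basis_card_eq_dim[OF Bn(2,4,3)] by simp
  then obtain \<tau> where \<tau>: "bij_betw \<tau> Bn (UNIV :: 'n set)"
    using finite_same_card_bij[OF fin(1) finite_class.finite_UNIV] by metis
  have \<tau>_inj: "\<tau> b = \<tau> b' \<longleftrightarrow> b = b'" if "b \<in> Bn" "b' \<in> Bn" for b b'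
    using \<tau> that by (auto simp: bij_betw_def inj_on_def)
  obtain B where B: "linear B" "\<And>b. b \<in> Bn \<Longrightarrow> B b = (axis (\<tau> b) 1 :: real^'n)"
    using linear_independent_extend[OF Bn(3), of "\<lambda>b. axis (\<tau> b) 1"] by blast
  have zero: "B v $ i = 0" if v: "v \<in> span A" and A: "A \<subseteq> Bn" and i: "i \<notin> \<tau> ` A" for v i A
  proof -
    have "linear (\<lambda>v. B v $ i)"
      using B(1) by (intro linearI) (simp_all add: linear_add linear_cmul)
    moreover have "B b $ i = 0" if "b \<in> A" for b
      using i that B(2)[OF subsetD[OF A that]] by (auto simp: axis_def)
    ultimately have "span A \<subseteq> {v. B v $ i = 0}"
      by (intro span_minimal linear_subspace_kernel) auto
    then show ?thesis using v by blast
  qed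
  define \<sigma> where "\<sigma> j = \<tau> (\<rho> j)" for j
  define Iu where "Iu = \<rho> -` Bu"
  have \<rho>Iu: "\<rho> ` Iu = Bu" using \<rho> Br(1) by (auto simp: Iu_def bij_betw_def image_iff)
  have "inj \<rho>" "range \<rho> = Br" using \<rho> by (auto simp: bij_betw_def)
  have "surj B"
  proof -
    have "axis i 1 \<in> range B" for i
    proof -
      obtain b where "b \<in> Bn" "i = \<tau> b" using \<tau> by (auto simp: bij_betw_def)
      then show ?thesis using B(2) by (metis rangeI)
    qed
    then have "Basis \<subseteq> range B" by (auto simp: Basis_vec_def)
    then have "span Basis \<subseteq> range B"
      using linear_subspace_image[OF B(1) subspace_UNIV] by (intro span_minimal)
    then show ?thesis by auto
  qed
  then have "inj B" using linear_surjective_imp_injective[OF B(1)] by simp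
  moreover have "inj \<sigma>"
  proof (rule injI)
    fix j k assume "\<sigma> j = \<sigma> k"
    moreover have "\<rho> j \<in> Bn" "\<rho> k \<in> Bn" using \<open>range \<rho> = Br\<close> Bn(1) by auto
    ultimately have "\<rho> j = \<rho> k" using \<tau>_inj by (simp add: \<sigma>_def)
    then show "j = k" using \<open>inj \<rho>\<close> by (simp add: inj_eq)
  qed
  moreover have "card Iu = dim \<Delta>"
    using \<rho>Iu Bu(4) card_image[of \<rho> Iu] \<open>inj \<rho>\<close> by (metis inj_on_subset subset_UNIV)
  moreover have "B v $ i = 0" if "v \<in> \<Delta>" "i \<notin> \<sigma> ` Iu" for v i
    using that Bu(3) Br(1) Bn(1) \<rho>Iu by (intro zero[of v Bu]) (auto simp: \<sigma>_def)
  moreover have "B v $ i = 0" if "v \<in> R" "i \<notin> range \<sigma>" for v i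
    using that Br(4) Bn(1) \<open>range \<rho> = Br\<close> by (intro zero[of v Br]) (auto simp: \<sigma>_def)
  ultimately show ?thesis by (rule that[OF B(1)])
qed

text \<open>A linear right inverse \<open>g\<close> of \<open>A\<close> on its range gives
  \<open>L\<close> as \<open>C \<circ> g\<close>; by the kernel inclusion \<open>C\<close> does not
  see which preimage is chosen.\<close>

lemma linear_factor:
  fixes A :: "'a::euclidean_space \<Rightarrow> 'b::euclidean_space" and C :: "'a \<Rightarrow> 'c::euclidean_space"
  assumes "linear A" "linear C" "\<And>v. A v = 0 \<Longrightarrow> C v = 0"
  obtains L where "linear L" "\<forall>v. L (A v) = C v"
proof -
  obtain g where g: "linear g" "\<And>v. A (g (A v)) = A v"
    using linear_exists_right_inverse_on[OF assms(1) subspace_UNIV] by blast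
  have "C (g (A v)) = C v" for v
  proof -
    have "A (g (A v) - v) = 0" using g(2) assms(1) by (simp add: linear_diff)
    then have "C (g (A v) - v) = 0" by (rule assms(3))
    then show ?thesis using assms(2) by (simp add: linear_diff)
  qed
  then show ?thesis using that[of "C \<circ> g"] linear_compose[OF g(1) assms(2)] by simp
qed

section \<open>Gluing of local diffeomorphisms\<close>

lemma diffeo_on_cong:
  fixes f g :: "'a::euclidean_space \<Rightarrow> 'b::euclidean_space"
  assumes "\<And>x. x \<in> S \<Longrightarrow> f x = g x" "diffeo_on S f"
  shows "diffeo_on S g"
proof -
  have S: "open S" using assms(2) by (simp add: diffeo_on_def)
  have im: "f ` S = g ` S" using assms(1) by (rule image_cong[OF refl])
  have inj: "inj_on f S \<longleftrightarrow> inj_on g S" using assms(1) by (rule inj_on_cong)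
  have "inv_into S f y = inv_into S g y" if "y \<in> g ` S" for y
    using that assms inj im by (auto simp: diffeo_on_def inv_into_f_f inv_into_f_eq)
  then show ?thesis
    using assms(2) inj im smooth_on_cong[OF S assms(1)] smooth_on_cong[of "g ` S" "inv_into S f" "inv_into S g"]
    by (auto simp: diffeo_on_def)
qed

lemma diffeo_on_Un:
  fixes f :: "'a::euclidean_space \<Rightarrow> 'b::euclidean_space"
  assumes A: "diffeo_on A f" and B: "diffeo_on B f" and "f ` A \<inter> f ` B = {}"
  shows "diffeo_on (A \<union> B) f"
proof -
  have inj: "inj_on f (A \<union> B)"
    using A B assms(3) by (auto simp: diffeo_on_def inj_on_Un)
  have eq: "inv_into (A \<union> B) f y = inv_into C f y" if "y \<in> f ` C" "C = A \<or> C = B" for y C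
    using that inj A B by (auto simp: diffeo_on_def intro!: inv_into_f_eq)
  have "smooth_on (f ` C) (inv_into (A \<union> B) f)" if C: "C = A \<or> C = B" for C
    using smooth_on_cong[of "f ` C" "inv_into (A \<union> B) f" "inv_into C f"] eq[OF _ C] C A B
    by (auto simp: diffeo_on_def)
  then have "smooth_on (f ` A \<union> f ` B) (inv_into (A \<union> B) f)"
    using A B by (intro smooth_on_Un) (auto simp: diffeo_on_def)
  then show ?thesis
    using A B inj smooth_on_Un[of A B f] unfolding diffeo_on_def image_Un by blast
qed

text \<open>The state transformation is prescribed only near the shifted point; when the base point is
  different, it is completed there by a translation that avoids the image of the first piece.\<close>

lemma diffeo_prescribed_near:
  fixes \<phi> :: "'a::euclidean_space \<Rightarrow> 'a"
  assumes "diffeo_on Q \<phi>" "x1 \<in> Q" "open X" "x0 \<in> X" "x1 \<in> X"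
  obtains W \<phi>x Q' where "diffeo_on W \<phi>x" "W \<subseteq> X" "x0 \<in> W" "open Q'" "x1 \<in> Q'" "Q' \<subseteq> W" "Q' \<subseteq> Q"
    "\<forall>x\<in>Q'. \<phi>x x = \<phi> x"
proof (cases "x0 = x1")
  case True
  have "open (Q \<inter> X)" using assms by (auto simp: diffeo_on_def)
  with True that[of "Q \<inter> X" \<phi> "Q \<inter> X"] diffeo_on_subset[OF assms(1), of "Q \<inter> X"] assms
  show ?thesis by auto
next
  case False
  \<comment> \<open>Half the distance makes the pieces \<open>A\<close> and \<open>B\<close>
    disjoint.\<close>
  define d where "d = dist x0 x1 / 2"
  have "d > 0" using False by (simp add: d_def)
  have Q: "open Q" "smooth_on Q \<phi>" using assms(1) by (auto simp: diffeo_on_def)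
  obtain b :: 'a where b: "b \<in> Basis" using nonempty_Basis by blast
  \<comment> \<open>The translation carries \<open>x0\<close> to
    \<open>\<phi> x1 + 3 *\<^sub>R b\<close>. The images of the pieces lie in balls of radius 1
    whose centres are 3 apart, so they are disjoint.\<close>
  define c where "c = \<phi> x1 + 3 *\<^sub>R b - x0"
  define A where "A = (Q \<inter> \<phi> -` ball (\<phi> x1) 1) \<inter> (X \<inter> ball x1 d)"
  define B where "B = X \<inter> ball x0 (min d 1)"
  define \<phi>x where "\<phi>x x = (if x \<in> A then \<phi> x else x + c)" for x
  have "open A" unfolding A_def
    using continuous_open_preimage[OF smooth_on_imp_continuous_on[OF Q(2)] Q(1), of "ball (\<phi> x1) 1"] assms(3)
    by (auto intro!: open_Int)
  have "open B" using assms(3) by (auto simp: B_def)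
  have disj: "x \<notin> A" if "x \<in> B" for x
    using that dist_triangle[of x0 x1 x] by (auto simp: A_def B_def d_def dist_commute)
  have "diffeo_on A \<phi>"
    by (rule diffeo_on_subset[OF assms(1) \<open>open A\<close>]) (auto simp: A_def)
  then have "diffeo_on A \<phi>x" by (rule diffeo_on_cong[rotated]) (simp add: \<phi>x_def)
  moreover have "diffeo_on B \<phi>x"
  proof (rule diffeo_on_cong)
    have im: "(\<lambda>x. x + c) ` B = (\<lambda>y. y - c) -` B" by (force simp: image_iff)
    then have "open ((\<lambda>x. x + c) ` B)"
      using \<open>open B\<close> by (auto intro!: open_vimage continuous_intros)
    moreover have "inv_into B (\<lambda>x. x + c) y = y - c" if "y \<in> (\<lambda>x. x + c) ` B" for y
      using that by (auto intro!: inv_into_f_eq simp: inj_on_def)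
    ultimately show "diffeo_on B (\<lambda>x. x + c)"
      unfolding diffeo_on_def using \<open>open B\<close>
      by (auto simp: inj_on_def smooth_on_cong[of "(\<lambda>x. x + c) ` B" "inv_into B (\<lambda>x. x + c)" "\<lambda>y. y - c"]
          intro!: smooth_on_add smooth_on_diff smooth_on_const smooth_on_id)
  qed (simp add: \<phi>x_def disj)
  moreover have "\<phi>x ` A \<inter> \<phi>x ` B = {}"
  proof -
    have "\<phi>x x \<noteq> \<phi>x y" if "x \<in> A" "y \<in> B" for x y
    proof
      assume eq: "\<phi>x x = \<phi>x y"
      have 1: "norm (\<phi>x x - \<phi> x1) < 1"
        using that(1) by (simp add: \<phi>x_def A_def dist_norm norm_minus_commute)
      have "\<phi>x y - \<phi> x1 = (y - x0) + 3 *\<^sub>R b" using disj[OF that(2)] by (simp add: \<phi>x_def c_def)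
      moreover have "norm (y - x0) < 1" using that(2) by (simp add: B_def dist_norm norm_minus_commute)
      ultimately have "norm (3 *\<^sub>R b) < 2"
        using 1 eq norm_triangle_ineq4[of "\<phi>x y - \<phi> x1" "y - x0"] by simp
      then show False using b by simp
    qed
    then show ?thesis by blast
  qed
  ultimately have "diffeo_on (A \<union> B) \<phi>x" by (rule diffeo_on_Un)
  moreover have "x1 \<in> A" "x0 \<in> B" "A \<union> B \<subseteq> X" "A \<subseteq> Q"
    using assms \<open>d > 0\<close> by (auto simp: A_def B_def)
  ultimately show ?thesis using that[of "A \<union> B" \<phi>x A] \<open>open A\<close> by (auto simp: \<phi>x_def)
qed

section \<open>Input directions and first integrals of the sum distribution\<close>

lemma coord_part_add_compl: "coord_part I w + coord_part (- I) w = w"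
  by (simp add: coord_part_def vec_eq_iff)

text \<open>Brings the rank condition into the form in which it is applied: the kernel of
  \<open>f\<close> contains no nonzero input direction.\<close>

lemma derivative_input_inj:
  fixes f :: "(real^'n) \<times> (real^'m) \<Rightarrow> real^'n"
  assumes "f differentiable at (x, u)" "rank (jacobian (\<lambda>u'. f (x, u')) (at u)) = CARD('m)"
    and "der f (x, u) (0, b) = 0"
  shows "b = 0"
proof -
  have "((\<lambda>u. (x, u)) has_derivative (\<lambda>b. (0, b))) (at u)"
    by (auto intro!: derivative_eq_intros)
  from has_derivative_compose[OF this has_derivative_der[OF assms(1)]]
  have D: "((\<lambda>u'. f (x, u')) has_derivative (\<lambda>b. der f (x, u) (0, b))) (at u)" .
  then have "jacobian (\<lambda>u'. f (x, u')) (at u) = matrix (\<lambda>b. der f (x, u) (0, b))"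
    unfolding jacobian_def by (simp add: der_eq)
  moreover have "matrix (\<lambda>b. der f (x, u) (0, b)) *v c = der f (x, u) (0, c)" for c
    using matrix_works[of "\<lambda>b. der f (x, u) (0, b)" c] has_derivative_linear[OF D]
    by (simp add: linear_matrix_vector_mul_eq)
  moreover have "inj ((*v) (jacobian (\<lambda>u'. f (x, u')) (at u)))"
    using assms(2) full_rank_injective by blast
  ultimately have "inj (\<lambda>c. der f (x, u) (0, c))" by (simp add: inj_def)
  then show ?thesis using assms(3) linear_0[OF has_derivative_linear[OF D]] by (metis injD)
qed

text \<open>A frame of the sum is assembled from frames of \<open>Ubu\<close> and of the kernel of
  \<open>f\<close>. The differential of the map given by \<open>frobenius\<close> annihilates the
  kernel of \<open>f\<close>, so this map is locally a function \<open>\<eta>\<close> of the shifted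
  state.\<close>

lemma distribution_first_integrals:
  fixes f :: "(real^'n) \<times> (real^'m) \<Rightarrow> real^'n"
  assumes "open E" and smf: "smooth_on E f" and surj: "surj (der f p0)"
    and inj: "\<And>v. der f p0 v = 0 \<Longrightarrow> fst v = 0 \<Longrightarrow> v = 0"
    and S: "open S" "p0 \<in> S" "S \<subseteq> E"
    and dist: "distribution_on S mu Ubu" and sub: "\<And>p. p \<in> S \<Longrightarrow> Ubu p \<subseteq> input_dist p"
    and bracket: "\<And>p. p \<in> S \<Longrightarrow> bracket_dist S Ubu (sum_dist Ubu (kernel_dist f)) p
        \<subseteq> sum_dist Ubu (kernel_dist f) p"
  obtains U Q and \<eta> :: "real^'n \<Rightarrow> (real^'n) \<times> (real^'m)"
  where "open U" "p0 \<in> U" "U \<subseteq> S" "open Q" "f ` U \<subseteq> Q" "smooth_on Q \<eta>"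
    "\<forall>p\<in>U. \<forall>v. der \<eta> (f p) (der f p v) = 0 \<longleftrightarrow> v \<in> sum_dist Ubu (kernel_dist f) p"
proof -
  have p0E: "p0 \<in> E" using S by blast
  have diff: "f differentiable at p" if "p \<in> E" for p
    using smooth_on_has_derivative[OF smf that] by (auto simp: differentiable_def)
  have ker: "kernel_dist f p = {v. der f p v = 0}" if "p \<in> E" for p
    by (rule kernel_dist_eq[OF diff[OF that]])
  obtain N0 and Xf :: "nat \<Rightarrow> (real^'n) \<times> (real^'m) \<Rightarrow> (real^'n) \<times> (real^'m)" where
    N0: "open N0" "p0 \<in> N0" "N0 \<subseteq> S" and smXf0: "\<forall>i<mu. smooth_on N0 (Xf i)"
      and frame: "\<forall>q\<in>N0. Ubu q = span ((\<lambda>i. Xf i q) ` {..<mu})"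
    using bspec[OF conjunct2[OF dist[unfolded distribution_on_def]] S(2)]
    by (elim exE conjE) (rule that, assumption+)
  obtain U1 and \<kappa> :: "(real^'n) \<times> (real^'m) \<Rightarrow> real^'m"
    where U1: "linear \<kappa>" "open U1" "p0 \<in> U1" "U1 \<subseteq> E" "diffeo_on U1 (\<lambda>p. (f p, \<kappa> p))"
    by (rule submersion_chart[OF assms(1) smf p0E surj])
  define F where "F p = (f p, \<kappa> p)" for p
  have F: "diffeo_on U1 F" using U1(5) by (simp add: F_def[abs_def])
  then have smF: "smooth_on U1 F" "smooth_on (F ` U1) (inv_into U1 F)" "open (F ` U1)"
    by (auto simp: diffeo_on_def)
  \<comment> \<open>In the chart \<open>F\<close> the kernel of \<open>f\<close> is spanned by the
    last \<open>CARD('m)\<close> coordinate fields.\<close>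
  define Kf where "Kf j p = der (inv_into U1 F) (F p) (0, axis j 1)" for j p
  have smK: "smooth_on U1 (Kf j)" for j
    unfolding Kf_def
    by (rule smooth_on_compose[OF U1(2) smF(3) subset_refl smF(1) smooth_on_der[OF smF(2)]])
  have Kspan: "span (range (\<lambda>j. Kf j p)) = {v. der f p v = 0}" if p: "p \<in> U1" for p
  proof -
    let ?L = "der (inv_into U1 F) (F p)"
    have "(F has_derivative (\<lambda>v. (der f p v, \<kappa> v))) (at p)"
      unfolding F_def using p U1(1,4)
      by (intro has_derivative_Pair smooth_on_has_derivative[OF smf] bounded_linear_imp_has_derivative)
         (auto simp: linear_conv_bounded_linear)
    then have dF: "der F p = (\<lambda>v. (der f p v, \<kappa> v))" by (rule der_eq)
    have L: "?L (der f p v, \<kappa> v) = v" "der f p (?L w) = fst w" for v w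
      using diffeo_on_derivative_inverse[OF F p] unfolding dF by (simp_all add: prod_eq_iff)
    have linL: "linear ?L" using smooth_on_linear_der[OF smF(2)] p by blast
    have "span (range (\<lambda>j. Kf j p)) = ?L ` input_dist p"
      unfolding input_dist_def linear_span_image[OF linL, symmetric] Kf_def by (simp add: image_image)
    also have "\<dots> = {v. der f p v = 0}"
      unfolding input_dist_eq
    proof (intro equalityI subsetI)
      fix v assume "v \<in> {v. der f p v = 0}"
      then have "v = ?L (0, \<kappa> v)" using L(1)[of v] by simp
      then show "v \<in> ?L ` {v. fst v = 0}" by (rule image_eqI) simp
    qed (auto simp: L(2))
    finally show ?thesis .
  qed
  define N where "N = N0 \<inter> U1"
  have N: "open N" "p0 \<in> N" "N \<subseteq> S" "N \<subseteq> E" using N0 U1 S by (auto simp: N_def)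
  define X where "X = case_sum Xf Kf"
  \<comment> \<open>The sum type indexes both frames together, so that \<open>card I\<close> is
    \<open>mu + CARD('m)\<close>.\<close>
  define I :: "(nat + 'm) set" where "I = {..<mu} <+> UNIV"
  have image: "(\<lambda>i. X i p) ` I = (\<lambda>i. Xf i p) ` {..<mu} \<union> range (\<lambda>j. Kf j p)" for p
    unfolding X_def I_def Plus_def image_Un image_image by simp
  have sumD: "sum_dist Ubu (kernel_dist f) p = {a + b | a b. a \<in> Ubu p \<and> b \<in> {v. der f p v = 0}}"
    if "p \<in> E" for p
    unfolding sum_dist_def ker[OF that] ..
  have D: "span ((\<lambda>i. X i p) ` I) = sum_dist Ubu (kernel_dist f) p" if p: "p \<in> N" for p
  proof -
    have pp: "p \<in> N0" "p \<in> U1" "p \<in> E" using p N(4) by (auto simp: N_def)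
    show ?thesis unfolding image span_Un sumD[OF pp(3)] bspec[OF frame pp(1)] Kspan[OF pp(2)] ..
  qed
  have smXf: "smooth_on N (Xf i)" if "i < mu" for i
    by (rule smooth_on_subset[OF smXf0[rule_format, OF that]]) (simp add: N_def)
  have smKf: "smooth_on N (Kf j)" for j
    by (rule smooth_on_subset[OF smK]) (simp add: N_def)
  have smX: "smooth_on N (X i)" if "i \<in> I" for i
    using that smXf smKf by (auto simp: I_def X_def)
  have XU: "vector_field_in N Ubu (Xf i)" if "i < mu" for i
    unfolding vector_field_in_def
  proof (intro conjI ballI smXf[OF that])
    fix p assume "p \<in> N"
    then have "Ubu p = span ((\<lambda>i. Xf i p) ` {..<mu})" by (intro bspec[OF frame]) (simp add: N_def)
    then show "Xf i p \<in> Ubu p" using that by (auto intro: span_base)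
  qed
  have XK: "der f p (Kf j p) = 0" if "p \<in> N" for p j
    using Kspan[of p] that span_base[of "Kf j p" "range (\<lambda>j. Kf j p)"] by (auto simp: N_def)
  have XD: "vector_field_in N (sum_dist Ubu (kernel_dist f)) (X i)" if "i \<in> I" for i
    unfolding vector_field_in_def
  proof (intro conjI ballI smX[OF that])
    show "X i p \<in> sum_dist Ubu (kernel_dist f) p" if "p \<in> N" for p
      unfolding D[OF that, symmetric] by (intro span_base imageI \<open>i \<in> I\<close>)
  qed
  have half: "lie_bracket (X (Inl i)) (X j) p \<in> sum_dist Ubu (kernel_dist f) p"
    if "p \<in> N" "i < mu" "j \<in> I" for i j p
  proof -
    have "lie_bracket (X (Inl i)) (X j) p \<in> bracket_dist S Ubu (sum_dist Ubu (kernel_dist f)) p"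
      unfolding bracket_dist_def
      using XU[OF that(2)] XD[OF that(3)] N that(1)
      by (intro span_base CollectI exI[of _ "X (Inl i)"] exI[of _ "X j"] exI[of _ N]) (auto simp: X_def)
    then show ?thesis using bracket that(1) N(3) by blast
  qed
  \<comment> \<open>Brackets that involve a field of \<open>Ubu\<close> are covered by the
    hypothesis, up to a sign; brackets of two kernel fields stay in the kernel.\<close>
  have invol: "lie_bracket (X i) (X j) p \<in> span ((\<lambda>i. X i p) ` I)" if p: "p \<in> N" and ij: "i \<in> I" "j \<in> I" for p i j
  proof (cases i)
    case (Inl i')
    then have "i' < mu" using ij(1) by (auto simp: I_def)
    then show ?thesis unfolding Inl D[OF p] by (rule half[OF p _ ij(2)])
  next
    case i: (Inr i')
    show ?thesis
    proof (cases j)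
      case (Inl j')
      have "lie_bracket (X i) (X j) p = - lie_bracket (X j) (X i) p"
        by (simp add: lie_bracket_def)
      moreover have "j' < mu" using ij(2) Inl by (auto simp: I_def)
      then have "lie_bracket (X j) (X i) p \<in> span ((\<lambda>i. X i p) ` I)"
        unfolding Inl D[OF p] by (rule half[OF p _ ij(1)])
      ultimately show ?thesis using span_neg by metis
    next
      case (Inr j')
      have "der f p (lie_bracket (Kf i') (Kf j') p) = 0"
        by (rule lie_bracket_in_kernel[OF N(1) p smooth_on_subset[OF smf N(4)]])
           (use smKf XK in auto)
      then have "lie_bracket (Kf i') (Kf j') p \<in> span (range (\<lambda>j. Kf j p))"
        using Kspan[of p] p by (auto simp: N_def)
      also have "\<dots> \<subseteq> span ((\<lambda>i. X i p) ` I)" unfolding image by (intro span_mono) auto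
      finally show ?thesis by (simp add: i Inr X_def)
    qed
  qed
  \<comment> \<open>Input vectors annihilated by \<open>der f p0\<close> vanish, so the sum is
    direct and the dimensions add up.\<close>
  have rank: "dim ((\<lambda>i. X i p0) ` I) = card I"
  proof -
    let ?K = "{v. der f p0 v = 0}"
    have lin: "linear (der f p0)" using smooth_on_linear_der[OF smf p0E] .
    have "Ubu p0 \<inter> ?K = {0}"
    proof -
      have "0 \<in> Ubu p0" using frame N0(2) span_zero by auto
      then show ?thesis using sub[OF S(2)] inj linear_0[OF lin] by (auto simp: input_dist_eq)
    qed
    moreover have "subspace (Ubu p0)" using frame N0(2) by simp
    ultimately have "dim {a + b | a b. a \<in> Ubu p0 \<and> b \<in> ?K} = dim (Ubu p0) + dim ?K"
      using dim_sums_Int[of "Ubu p0" ?K] linear_subspace_kernel[OF lin] by simp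
    moreover have "dim ?K = CARD('m)" using dim_kernel_surj[OF lin surj] by simp
    moreover have "dim (Ubu p0) = mu" using dist S(2) by (simp add: distribution_on_def)
    moreover have "dim ((\<lambda>i. X i p0) ` I) = dim (span ((\<lambda>i. X i p0) ` I))" by simp
    ultimately show ?thesis
      unfolding D[OF N(2)] sumD[OF p0E] by (simp add: I_def card_Plus)
  qed
  have "finite I" by (simp add: I_def)
  obtain U2 and h :: "(real^'n) \<times> (real^'m) \<Rightarrow> (real^'n) \<times> (real^'m)" where
    U2: "open U2" "p0 \<in> U2" "U2 \<subseteq> N" "smooth_on U2 h"
      "\<And>p v. p \<in> U2 \<Longrightarrow> der h p v = 0 \<longleftrightarrow> v \<in> span ((\<lambda>i. X i p) ` I)"
    using frobenius[OF N(1,2) \<open>finite I\<close> smX rank invol] by blast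
  have hD: "der h p v = 0 \<longleftrightarrow> v \<in> sum_dist Ubu (kernel_dist f) p" if "p \<in> U2" for p v
    using U2(5)[OF that] D U2(3) that by blast
  have smf2: "smooth_on U2 f" using smooth_on_subset[OF smf] U2(3) N(4) by blast
  have "der h p v = 0" if p: "p \<in> U2" and "der f p v = 0" for p v
  proof -
    have "v \<in> span (range (\<lambda>j. Kf j p))" using Kspan[of p] that U2(3) by (auto simp: N_def)
    also have "\<dots> \<subseteq> span ((\<lambda>i. X i p) ` I)" unfolding image by (intro span_mono) auto
    finally show ?thesis using U2(5)[OF p] by blast
  qed
  then obtain P Q \<eta> where P: "open P" "p0 \<in> P" "P \<subseteq> U2" "open Q" "f ` P \<subseteq> Q" "smooth_on Q \<eta>"
    "\<And>p. p \<in> P \<Longrightarrow> h p = \<eta> (f p)"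
    using factor_through_submersion[OF U2(1) smf2 U2(2) surj U2(4)] by blast
  have dh: "der \<eta> (f p) (der f p v) = der h p v" if p: "p \<in> P" for p v
  proof -
    have "((\<lambda>q. \<eta> (f q)) has_derivative (\<lambda>v. der \<eta> (f p) (der f p v))) (at p)"
      using has_derivative_compose[OF smooth_on_has_derivative[OF smf2] smooth_on_has_derivative[OF P(6)]] p P(3,5)
      by blast
    then have "(h has_derivative (\<lambda>v. der \<eta> (f p) (der f p v))) (at p)"
      using has_derivative_cong_open[OF P(1) p, of h "\<lambda>q. \<eta> (f q)"] P(7) by simp
    from der_eq[OF this] show ?thesis by simp
  qed
  show ?thesis
  proof (rule that[OF P(1,2) _ P(4,5,6)])
    show "P \<subseteq> S" using P(3) U2(3) N(3) by blast
    show "\<forall>p\<in>P. \<forall>v. der \<eta> (f p) (der f p v) = 0 \<longleftrightarrow> v \<in> sum_dist Ubu (kernel_dist f) p"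
      using dh hD P(3) by (metis subset_iff)
  qed
qed


section \<open>Construction of the transformation\<close>

lemma coordinate_box_in_open:
  fixes w0 :: "real^'m"
  assumes "open C" "w0 \<in> C"
  obtains \<epsilon> where "\<epsilon> > 0" "{w. \<forall>j. \<bar>w $ j - w0 $ j\<bar> < \<epsilon>} \<subseteq> C"
proof -
  obtain e where e: "e > 0" "ball w0 e \<subseteq> C" using assms open_contains_ball by blast
  \<comment> \<open>The divisor stems from bounding the Euclidean norm by the sum of
    \<open>CARD('m)\<close> absolute values.\<close>
  have "w \<in> C" if "\<forall>j. \<bar>w $ j - w0 $ j\<bar> < e / CARD('m)" for w
  proof -
    have "norm (w - w0) \<le> (\<Sum>j\<in>UNIV. \<bar>(w - w0) $ j\<bar>)" by (rule norm_le_l1_cart)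
    also have "\<dots> < (\<Sum>j\<in>(UNIV::'m set). e / CARD('m))"
      using that by (intro sum_strict_mono) auto
    also have "\<dots> = e" by simp
    finally show ?thesis using e(2) by (auto simp: dist_norm norm_minus_commute)
  qed
  then show ?thesis using that[of "e / CARD('m)"] e(1) by auto
qed

text \<open>The new inputs are by definition the shifted coordinates with index in
  \<open>range \<sigma>\<close>, so those rows of the block form are automatic. The content is that
  the other shifted coordinates do not depend on the inputs in \<open>Iu\<close>: changing these
  inputs moves along \<open>Ubu\<close>, on which every shifted coordinate outside
  \<open>Ibu\<close> is stationary.\<close>

lemma distribution_imp_transformable:
  fixes f :: "(real^'n) \<times> (real^'m) \<Rightarrow> real^'n"
  assumes "open X" "open E" "fst ` E = X" and smf: "smooth_on E f" and "f ` E = X"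
    and submersion: "\<And>p. p \<in> E \<Longrightarrow> surj (der f p)"
    and inputs: "\<And>x u. (x, u) \<in> E \<Longrightarrow> rank (jacobian (\<lambda>u'. f (x, u')) (at u)) = CARD('m)"
    and S: "open S" "p0 \<in> S" "S \<subseteq> E"
    and dist: "distribution_on S mu Ubu" and sub: "\<And>p. p \<in> S \<Longrightarrow> Ubu p \<subseteq> input_dist p"
    and bracket: "\<And>p. p \<in> S \<Longrightarrow> bracket_dist S Ubu (sum_dist Ubu (kernel_dist f)) p
        \<subseteq> sum_dist Ubu (kernel_dist f) p"
  shows "transformable_near (CARD('m) - mu) mu X E f p0"
proof -
  let ?D = "sum_dist Ubu (kernel_dist f)"
  have p0E: "p0 \<in> E" using S by blast
  define x1 where "x1 = f p0"
  have inj_in: "v = 0" if "p \<in> E" "der f p v = 0" "fst v = 0" for p v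
  proof -
    have "snd v = 0"
      using derivative_input_inj[of f "fst p" "snd p" "snd v"] inputs[of "fst p" "snd p"] that
        smooth_on_has_derivative[OF smf that(1)] by (metis differentiable_def prod.collapse)
    then show ?thesis using that(3) by (simp add: prod_eq_iff)
  qed
  have linf: "linear (der f p)" if "p \<in> E" for p using smooth_on_linear_der[OF smf that] .
  have ker: "kernel_dist f p = {v. der f p v = 0}" if "p \<in> E" for p
    using smooth_on_has_derivative[OF smf that] by (intro kernel_dist_eq) (auto simp: differentiable_def)
  have UbuD: "v \<in> ?D p" if "p \<in> S" "v \<in> Ubu p" for p v
  proof -
    have "p \<in> E" using that(1) S(3) by blast
    then have "0 \<in> kernel_dist f p" using linear_0[OF linf] by (simp add: ker)
    then show ?thesis unfolding sum_dist_def using that(2) by (intro CollectI exI[of _ v] exI[of _ 0]) auto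
  qed
  have subU: "subspace (Ubu p)" and dimU: "dim (Ubu p) = mu" if "p \<in> S" for p
    using dist that unfolding distribution_on_def by (metis subspace_span, blast)
  obtain U Q and \<eta> :: "real^'n \<Rightarrow> (real^'n) \<times> (real^'m)" where
    U: "open U" "p0 \<in> U" "U \<subseteq> S" "open Q" "f ` U \<subseteq> Q" "smooth_on Q \<eta>"
    and \<eta>: "\<forall>p\<in>U. \<forall>v. der \<eta> (f p) (der f p v) = 0 \<longleftrightarrow> v \<in> ?D p"
    by (rule distribution_first_integrals[OF assms(2) smf submersion[OF p0E] inj_in[OF p0E] S dist sub bracket])
  have x1Q: "x1 \<in> Q" using U by (auto simp: x1_def)
  \<comment> \<open>Images at the single point \<open>x1\<close>: the linear coordinates
    \<open>B\<close> are adapted there, while \<open>\<eta>\<close> takes care of nearby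
    points.\<close>
  define \<Delta> where "\<Delta> = der f p0 ` Ubu p0"
  define R where "R = der f p0 ` {v. fst v = 0}"
  have sub_in: "subspace {v :: (real^'n) \<times> (real^'m). fst v = 0}"
    using input_dist_eq[of p0] unfolding input_dist_def by (metis subspace_span)
  have inj_on_in: "inj_on (der f p0) {v. fst v = 0}"
  proof (rule inj_onI)
    fix v w assume "v \<in> {v. fst v = 0}" "w \<in> {v. fst v = 0}" "der f p0 v = der f p0 w"
    then have "v - w = 0" using linf[OF p0E] by (intro inj_in[OF p0E]) (simp_all add: linear_diff)
    then show "v = w" by simp
  qed
  have Usub: "Ubu p0 \<subseteq> {v. fst v = 0}" using sub[OF S(2)] input_dist_eq by blast
  have "dim {v :: (real^'n) \<times> (real^'m). fst v = 0} = CARD('m)"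
    using input_dist_eq[of p0] dim_input_axes[of "UNIV :: 'm set"] unfolding input_dist_def
    by (metis dim_span)
  then have dimR: "dim R = CARD('m)"
    unfolding R_def using dim_image_eq[OF linf[OF p0E], of "{v. fst v = 0}"] inj_on_in sub_in
    by (metis span_eq_iff)
  have dim\<Delta>: "dim \<Delta> = mu"
    unfolding \<Delta>_def using dim_image_eq[OF linf[OF p0E], of "Ubu p0"] subU[OF S(2)] dimU[OF S(2)]
      inj_on_subset[OF inj_on_in Usub] by (metis span_eq_iff)
  obtain B :: "real^'n \<Rightarrow> real^'n" and \<sigma> :: "'m \<Rightarrow> 'n" and Iu where
    B: "linear B" "inj B" and \<sigma>: "inj \<sigma>" and Iu: "card Iu = dim \<Delta>"
    and B\<Delta>: "\<And>v i. v \<in> \<Delta> \<Longrightarrow> i \<notin> \<sigma> ` Iu \<Longrightarrow> B v $ i = 0"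
    and BR: "\<And>v i. v \<in> R \<Longrightarrow> i \<notin> range \<sigma> \<Longrightarrow> B v $ i = 0"
  proof (rule adapted_coordinates[of \<Delta> R])
    show "subspace \<Delta>" unfolding \<Delta>_def by (rule linear_subspace_image[OF linf[OF p0E] subU[OF S(2)]])
    show "subspace R" unfolding R_def by (rule linear_subspace_image[OF linf[OF p0E] sub_in])
    show "\<Delta> \<subseteq> R" unfolding \<Delta>_def R_def using Usub by (rule image_mono)
  qed (use dimR in auto)
  define Ibu where "Ibu = \<sigma> ` Iu"
  have cpl: "linear (coord_part J)" for J :: "'n set"
    using bounded_linear_coord_part bounded_linear.linear by blast
  \<comment> \<open>Kernel vectors of \<open>der \<eta> x1\<close> lie in \<open>\<Delta>\<close>,
    where the coordinates of \<open>B\<close> outside \<open>Ibu\<close> vanish; hence these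
    coordinates factor through \<open>der \<eta> x1\<close>.\<close>
  obtain L :: "(real^'n) \<times> (real^'m) \<Rightarrow> real^'n" where L: "linear L"
    and L\<eta>: "\<forall>w. L (der \<eta> x1 w) = (coord_part (- Ibu) \<circ> B) w"
  proof (rule linear_factor[OF smooth_on_linear_der[OF U(6) x1Q] linear_compose[OF B(1) cpl, of "- Ibu"]])
    fix w assume w: "der \<eta> x1 w = 0"
    obtain v where v: "w = der f p0 v" using submersion[OF p0E] by (metis surjD)
    then have "v \<in> ?D p0" using \<eta> U(2) w unfolding x1_def by blast
    then obtain a b where ab: "v = a + b" "a \<in> Ubu p0" "der f p0 b = 0"
      unfolding sum_dist_def ker[OF p0E] by blast
    then have "w \<in> \<Delta>" unfolding \<Delta>_def v using linf[OF p0E] by (simp add: linear_add)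
    then show "(coord_part (- Ibu) \<circ> B) w = 0"
      using B\<Delta> by (auto simp: coord_part_def vec_eq_iff Ibu_def)
  qed
  have bl: "bounded_linear B" "bounded_linear L" using B(1) L by (simp_all add: linear_conv_bounded_linear)
  \<comment> \<open>Outside \<open>Ibu\<close> the components are functions of the first integrals;
    inside, \<open>B\<close> supplies the missing ones. The choice of \<open>L\<close> makes the
    derivative at \<open>x1\<close> exactly \<open>B\<close>, hence invertible.\<close>
  define \<phi> where "\<phi> x = coord_part Ibu (B x) + L (\<eta> x)" for x
  have "smooth_on Q (\<lambda>x. coord_part Ibu (B x))"
    by (rule smooth_on_bounded_linear[OF U(4) bounded_linear_compose[OF bounded_linear_coord_part bl(1)]])
  then have sm\<phi>: "smooth_on Q \<phi>"
    unfolding \<phi>_def using U(4,6) by (intro smooth_on_add smooth_on_linear_image[OF bl(2)])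
  have "(\<phi> has_derivative (\<lambda>w. coord_part Ibu (B w) + L (der \<eta> x1 w))) (at x1)"
    unfolding \<phi>_def
    by (intro has_derivative_add bounded_linear.has_derivative[OF bl(2)] smooth_on_has_derivative[OF U(6) x1Q]
        bounded_linear_imp_has_derivative bounded_linear_compose[OF bounded_linear_coord_part bl(1)])
  then have der\<phi>: "der \<phi> x1 = B" by (simp add: der_eq L\<eta> coord_part_add_compl)
  obtain Q1 where Q1: "open Q1" "x1 \<in> Q1" "Q1 \<subseteq> Q" "diffeo_on Q1 \<phi>"
    by (rule smooth_local_diffeo[OF U(4) sm\<phi> x1Q]) (use B(2) der\<phi> in auto)
  obtain W \<phi>x Q' where W: "diffeo_on W \<phi>x" "W \<subseteq> X" "fst p0 \<in> W"
    and Q': "open Q'" "x1 \<in> Q'" "Q' \<subseteq> W" "Q' \<subseteq> Q1" "\<forall>x\<in>Q'. \<phi>x x = \<phi> x"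
  proof (rule diffeo_prescribed_near[OF Q1(4,2) assms(1), of "fst p0"])
    show "fst p0 \<in> X" "x1 \<in> X" using assms(3,5) p0E by (auto simp: x1_def)
  qed
  have "open W" and sm\<phi>x: "smooth_on W \<phi>x" using W(1) by (auto simp: diffeo_on_def)
  have "U \<subseteq> E" using U(3) S(3) by blast
  have smfU: "smooth_on U f" by (rule smooth_on_subset[OF smf \<open>U \<subseteq> E\<close>])
  define G0 where "G0 = (U \<inter> f -` Q') \<inter> fst -` W"
  have "open G0" unfolding G0_def
    using continuous_open_preimage[OF smooth_on_imp_continuous_on[OF smfU] U(1) Q'(1)]
      open_vimage[OF \<open>open W\<close> continuous_on_fst[OF continuous_on_id]] by blast
  have G0: "p0 \<in> G0" "G0 \<subseteq> U" "fst ` G0 \<subseteq> W" "f ` G0 \<subseteq> Q'"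
    using U(2) Q'(2) W(3) by (auto simp: G0_def x1_def)
  define \<psi> where "\<psi> p = \<phi>x (f p)" for p
  have smfG: "smooth_on G0 f" by (rule smooth_on_subset[OF smfU G0(2)])
  have sm\<psi>: "smooth_on G0 \<psi>"
    unfolding \<psi>_def using G0(4) Q'(3) by (intro smooth_on_compose[OF \<open>open G0\<close> \<open>open W\<close> _ smfG sm\<phi>x]) auto
  have der\<psi>: "der \<psi> p v = der \<phi> (f p) (der f p v)" if p: "p \<in> G0" for p v
  proof -
    have "f p \<in> Q" using p G0(4) Q'(4) Q1(3) by blast
    then have "((\<lambda>q. \<phi> (f q)) has_derivative (\<lambda>v. der \<phi> (f p) (der f p v))) (at p)"
      by (intro has_derivative_compose[OF smooth_on_has_derivative[OF smfG p] smooth_on_has_derivative[OF sm\<phi>]])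
    moreover have "\<psi> q = \<phi> (f q)" if "q \<in> G0" for q using Q'(5) G0(4) that by (auto simp: \<psi>_def)
    ultimately have "(\<psi> has_derivative (\<lambda>v. der \<phi> (f p) (der f p v))) (at p)"
      using has_derivative_cong_open[OF \<open>open G0\<close> p, of \<psi> "\<lambda>q. \<phi> (f q)"] by simp
    from der_eq[OF this] show ?thesis by simp
  qed
  \<comment> \<open>Outside \<open>Ibu\<close> the map \<open>\<phi>\<close> is a function of
    \<open>\<eta>\<close>, and \<open>?D p\<close> is the kernel of
    \<open>der \<eta> (f p) \<circ> der f p\<close>.\<close>
  have kill: "der \<psi> p v $ i = 0" if p: "p \<in> G0" and v: "v \<in> ?D p" and i: "i \<notin> Ibu" for p v i
  proof -
    have fp: "f p \<in> Q" using p G0(4) Q'(4) Q1(3) by blast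
    have "(\<phi> has_derivative (\<lambda>w. coord_part Ibu (B w) + L (der \<eta> (f p) w))) (at (f p))"
      unfolding \<phi>_def
      by (intro has_derivative_add bounded_linear.has_derivative[OF bl(2)] smooth_on_has_derivative[OF U(6) fp]
          bounded_linear_imp_has_derivative bounded_linear_compose[OF bounded_linear_coord_part bl(1)])
    then have "der \<psi> p v = coord_part Ibu (B (der f p v)) + L (der \<eta> (f p) (der f p v))"
      by (simp add: der\<psi>[OF p] der_eq)
    moreover have "der \<eta> (f p) (der f p v) = 0" using \<eta> p v G0(2) by blast
    ultimately show ?thesis using i linear_0[OF L] by (simp add: coord_part_def)
  qed
  define \<Sigma> :: "real^'n \<Rightarrow> real^'m" where "\<Sigma> y = (\<chi> j. y $ \<sigma> j)" for y
  have bl\<Sigma>: "bounded_linear \<Sigma>"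
    unfolding \<Sigma>_def linear_conv_bounded_linear[symmetric] by (intro linearI) (simp_all add: vec_eq_iff)
  define \<phi>u where "\<phi>u p = \<Sigma> (\<psi> p)" for p
  define \<Phi> where "\<Phi> = (\<lambda>(x, u). (\<phi>x x, \<phi>u (x, u)))"
  have \<Phi>: "\<Phi> p = (\<phi>x (fst p), \<Sigma> (\<psi> p))" for p by (simp add: \<Phi>_def \<phi>u_def case_prod_unfold)
  have sm\<Phi>: "smooth_on G0 \<Phi>"
  proof -
    have "smooth_on G0 (\<lambda>p. \<phi>x (fst p))"
      by (rule smooth_on_compose[OF \<open>open G0\<close> \<open>open W\<close> G0(3) smooth_on_bounded_linear[OF \<open>open G0\<close> bounded_linear_fst] sm\<phi>x])
    then have "smooth_on G0 (\<lambda>p. (\<phi>x (fst p), \<Sigma> (\<psi> p)))"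
      by (intro smooth_on_Pair \<open>open G0\<close> smooth_on_linear_image[OF bl\<Sigma>] sm\<psi>)
    then show ?thesis unfolding \<Phi>[abs_def, symmetric] by simp
  qed
  have der\<Phi>: "der \<Phi> p v = (der \<phi>x (fst p) (fst v), \<Sigma> (der \<psi> p v))" if p: "p \<in> G0" for p v
  proof -
    have "fst p \<in> W" using p G0(3) by blast
    then have "((\<lambda>p. (\<phi>x (fst p), \<Sigma> (\<psi> p))) has_derivative (\<lambda>v. (der \<phi>x (fst p) (fst v), \<Sigma> (der \<psi> p v)))) (at p)"
      by (intro has_derivative_Pair bounded_linear.has_derivative[OF bl\<Sigma>] smooth_on_has_derivative[OF sm\<psi> p]
          has_derivative_compose[OF has_derivative_fst[OF has_derivative_ident] smooth_on_has_derivative[OF sm\<phi>x]])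
    then have "(\<Phi> has_derivative (\<lambda>v. (der \<phi>x (fst p) (fst v), \<Sigma> (der \<psi> p v)))) (at p)"
      by (simp add: \<Phi>[abs_def])
    from der_eq[OF this] show ?thesis by simp
  qed
  have \<phi>x_inj: "a = 0" if "x \<in> W" "der \<phi>x x a = 0" for x a
    using diffeo_on_derivative_inverse(1)[OF W(1) that(1), of a] diffeo_on_derivative_inverse(1)[OF W(1) that(1), of 0]
      that(2) linear_0[OF smooth_on_linear_der[OF sm\<phi>x that(1)]] by metis
  \<comment> \<open>The state part is settled by \<open>\<phi>x\<close>. An input vector is sent by
    \<open>der f p0\<close> into \<open>R\<close>, where \<open>B\<close> has no components outside
    \<open>range \<sigma>\<close>, and \<open>\<Sigma>\<close> sees all the others.\<close>
  have "inj (der \<Phi> p0)"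
  proof (rule linear_injective_0[OF smooth_on_linear_der[OF sm\<Phi> G0(1)], THEN iffD2], intro allI impI)
    fix v assume "der \<Phi> p0 v = 0"
    then have "der \<phi>x (fst p0) (fst v) = 0" and 0: "\<Sigma> (der \<psi> p0 v) = 0"
      using der\<Phi>[OF G0(1)] by (simp_all add: prod_eq_iff)
    then have v: "fst v = 0" using \<phi>x_inj W(3) by blast
    have d: "der \<psi> p0 v = B (der f p0 v)" using der\<psi>[OF G0(1)] der\<phi> by (simp add: x1_def)
    have "der f p0 v \<in> R" using v by (auto simp: R_def)
    have "B (der f p0 v) $ i = 0" for i
    proof (cases "i \<in> range \<sigma>")
      case True
      then show ?thesis using 0 d by (auto simp: \<Sigma>_def vec_eq_iff)
    next
      case False
      then show ?thesis using BR \<open>der f p0 v \<in> R\<close> by blast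
    qed
    then have "B (der f p0 v) = B 0" by (simp add: vec_eq_iff linear_0[OF B(1)])
    then have "der f p0 v = 0" using B(2) by (simp add: inj_eq)
    then show "v = 0" using inj_in[OF p0E] v by blast
  qed
  then obtain G1 where G1: "open G1" "p0 \<in> G1" "G1 \<subseteq> G0" "diffeo_on G1 \<Phi>"
    using smooth_local_diffeo[OF \<open>open G0\<close> sm\<Phi> G0(1)] by blast
  obtain a0 w0 where aw: "\<Phi> p0 = (a0, w0)" by (cases "\<Phi> p0")
  have "(a0, w0) \<in> \<Phi> ` G1" using G1(2) aw by (metis image_eqI)
  moreover have "open (\<Phi> ` G1)" using G1(4) by (simp add: diffeo_on_def)
  ultimately obtain A C where AC: "open A" "open C" "a0 \<in> A" "w0 \<in> C" "A \<times> C \<subseteq> \<Phi> ` G1"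
    unfolding open_prod_def by (metis mem_Sigma_iff)
  obtain \<epsilon> where \<epsilon>: "\<epsilon> > 0" "{w. \<forall>j. \<bar>w $ j - w0 $ j\<bar> < \<epsilon>} \<subseteq> C"
    using coordinate_box_in_open[OF AC(2,4)] by blast
  \<comment> \<open>A box centred at \<open>w0\<close> is stable under moving coordinates towards
    those of \<open>w0\<close>, so the segments used below stay in the domain.\<close>
  define Cb where "Cb = {w. \<forall>j. \<bar>w $ j - w0 $ j\<bar> < \<epsilon>}"
  have "open Cb"
  proof -
    have "Cb = (\<Inter>j. {w. \<bar>w $ j - w0 $ j\<bar> < \<epsilon>})" by (auto simp: Cb_def)
    moreover have "open {w. \<bar>w $ j - w0 $ j\<bar> < \<epsilon>}" for j by (intro open_Collect_less continuous_intros)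
    ultimately show ?thesis by (simp add: open_INT)
  qed
  define Bx where "Bx = A \<times> Cb"
  have Bx: "open Bx" "Bx \<subseteq> \<Phi> ` G1" "\<Phi> p0 \<in> Bx"
    using AC \<epsilon> \<open>open Cb\<close> by (auto simp: Bx_def Cb_def aw open_Times)
  define G where "G = G1 \<inter> \<Phi> -` Bx"
  have smG1: "smooth_on G1 \<Phi>" using G1(4) by (simp add: diffeo_on_def)
  have "open G" unfolding G_def
    by (rule continuous_open_preimage[OF smooth_on_imp_continuous_on[OF smG1] G1(1) Bx(1)])
  have G: "p0 \<in> G" "G \<subseteq> G1" "G \<subseteq> G0" "\<Phi> ` G = Bx"
    using G1(2,3) Bx by (auto simp: G_def)
  have diffeoG: "diffeo_on G \<Phi>" by (rule diffeo_on_subset[OF G1(4) \<open>open G\<close> G(2)])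
  define g where "g q = \<phi>x (f (inv_into G \<Phi> q))" for q
  have sm_inv: "smooth_on Bx (inv_into G \<Phi>)" and injG: "inj_on \<Phi> G"
    using diffeoG G(4) by (auto simp: diffeo_on_def)
  have inv: "inv_into G \<Phi> y \<in> G" "\<Phi> (inv_into G \<Phi> y) = y" if "y \<in> Bx" for y
    using that G(4) inv_into_into[of y \<Phi> G] f_inv_into_f[of y \<Phi> G] by auto
  have smg: "smooth_on Bx g"
    unfolding g_def \<psi>_def[symmetric]
    by (rule smooth_on_compose[OF Bx(1) \<open>open G\<close> _ sm_inv smooth_on_subset[OF sm\<psi> G(3)]])
       (rule image_subsetI, rule inv)
  have g\<sigma>: "g (x, w) $ \<sigma> j = w $ j" if "(x, w) \<in> Bx" for x w j
  proof -
    have "\<Sigma> (\<psi> (inv_into G \<Phi> (x, w))) = w" using inv(2)[OF that] \<Phi> by (metis snd_conv)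
    then show ?thesis by (auto simp: g_def \<psi>_def \<Sigma>_def vec_eq_iff)
  qed
  \<comment> \<open>By \<open>kill\<close> the derivative of \<open>\<Phi>\<close> maps
    \<open>Ubu\<close> into the span of the input directions in \<open>Iu\<close>. Both have
    dimension \<open>mu\<close>, so every such direction comes from \<open>Ubu\<close>, and
    \<open>kill\<close> applies once more.\<close>
  have derg0: "der g y (0, u) $ i = 0"
    if y: "y \<in> Bx" and u: "\<And>j. j \<notin> Iu \<Longrightarrow> u $ j = 0" and i: "i \<notin> Ibu" for y u i
  proof -
    let ?p = "inv_into G \<Phi> y"
    have p: "?p \<in> G" "?p \<in> G0" "?p \<in> S" "fst ?p \<in> W"
      using inv(1)[OF y] G(3) G0(2,3) U(3) by auto
    define \<omega> where "\<omega> = der (inv_into G \<Phi>) y (0, u)"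
    have "(g has_derivative (\<lambda>v. der \<psi> ?p (der (inv_into G \<Phi>) y v))) (at y)"
      unfolding g_def \<psi>_def[symmetric]
      by (rule has_derivative_compose[OF smooth_on_has_derivative[OF sm_inv y] smooth_on_has_derivative[OF sm\<psi> p(2)]])
    then have dg: "der g y (0, u) = der \<psi> ?p \<omega>" by (simp add: der_eq \<omega>_def)
    have d\<omega>: "der \<Phi> ?p \<omega> = (0, u)"
      using diffeo_on_derivative_inverse(2)[OF diffeoG p(1)] inv(2)[OF y] by (simp add: \<omega>_def)
    have lin\<Phi>: "linear (der \<Phi> ?p)" using smooth_on_linear_der[OF sm\<Phi> p(2)] .
    have inj\<Phi>: "inj (der \<Phi> ?p)"
      using diffeo_on_derivative_inverse(1)[OF diffeoG p(1)] by (metis injI)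
    define Z where "Z = span ((\<lambda>j. (0::real^'n, axis j (1::real))) ` Iu)"
    have ZI: "(0, w) \<in> Z" if "\<And>j. j \<notin> Iu \<Longrightarrow> w $ j = 0" for w
    proof -
      have "(0, w) = (\<Sum>j\<in>Iu. w $ j *\<^sub>R (0::real^'n, axis j (1::real)))"
      proof -
        have "w = (\<Sum>j\<in>UNIV. w $ j *\<^sub>R axis j 1)"
          using basis_expansion[of w] by (simp add: scalar_mult_eq_scaleR)
        also have "\<dots> = (\<Sum>j\<in>Iu. w $ j *\<^sub>R axis j 1)"
          using that by (intro sum.mono_neutral_right) auto
        finally show ?thesis by (simp add: prod_eq_iff fst_sum snd_sum)
      qed
      also have "\<dots> \<in> Z" unfolding Z_def by (intro span_sum span_scale span_base imageI)
      finally show ?thesis .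
    qed
    have "der \<Phi> ?p ` Ubu ?p = Z"
    proof (rule subspace_dim_equal)
      show "subspace (der \<Phi> ?p ` Ubu ?p)" by (rule linear_subspace_image[OF lin\<Phi> subU[OF p(3)]])
      show "subspace Z" by (simp add: Z_def)
      show "der \<Phi> ?p ` Ubu ?p \<subseteq> Z"
      proof (rule image_subsetI)
        fix v assume v: "v \<in> Ubu ?p"
        then have "fst v = 0" using sub[OF p(3)] input_dist_eq by blast
        then have "der \<Phi> ?p v = (0, \<Sigma> (der \<psi> ?p v))"
          using der\<Phi>[OF p(2)] linear_0[OF smooth_on_linear_der[OF sm\<phi>x p(4)]] by simp
        moreover have "\<Sigma> (der \<psi> ?p v) $ j = 0" if "j \<notin> Iu" for j
        proof -
          have "\<sigma> j \<notin> Ibu" using that \<sigma> by (auto simp: Ibu_def inj_def)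
          then show ?thesis using kill[OF p(2) UbuD[OF p(3) v]] by (simp add: \<Sigma>_def)
        qed
        ultimately show "der \<Phi> ?p v \<in> Z" using ZI by simp
      qed
      have "dim (der \<Phi> ?p ` Ubu ?p) = mu"
        using dim_image_eq[OF lin\<Phi>, of "Ubu ?p"] inj\<Phi> dimU[OF p(3)] by (metis inj_on_subset subset_UNIV)
      moreover have "dim Z = mu" unfolding Z_def using Iu dim\<Delta> by (simp add: dim_input_axes)
      ultimately show "dim Z \<le> dim (der \<Phi> ?p ` Ubu ?p)" by simp
    qed
    moreover have "(0, u) \<in> Z" using u by (rule ZI)
    ultimately have "(0, u) \<in> der \<Phi> ?p ` Ubu ?p" by simp
    then obtain v where v: "(0, u) = der \<Phi> ?p v" "v \<in> Ubu ?p" by (rule imageE)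
    have "\<omega> = v" using injD[OF inj\<Phi>, of \<omega> v] d\<omega> v(1) by simp
    then show ?thesis unfolding dg using kill[OF p(2) UbuD[OF p(3) v(2)] i] by simp
  qed
  define Iv where "Iv = - Iu"
  \<comment> \<open>\<open>fa\<close> receives only the inputs in \<open>Iv\<close> and has to fill
    in the others; they are frozen at their values in \<open>w0\<close>.\<close>
  define merge where "merge w = coord_part Iv w + coord_part Iu w0" for w
  have merge: "merge w $ j = (if j \<in> Iu then w0 $ j else w $ j)" for w j
    by (simp add: merge_def coord_part_def Iv_def)
  have seg: "w + t *\<^sub>R (merge w - w) \<in> Cb" if w: "w \<in> Cb" and t: "t \<in> {0..1}" for w t
    unfolding Cb_def
  proof (intro CollectI allI)
    fix j
    have "\<bar>w $ j - w0 $ j\<bar> < \<epsilon>" using w by (simp add: Cb_def)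
    moreover have "\<bar>(1 - t) * (w $ j - w0 $ j)\<bar> \<le> \<bar>w $ j - w0 $ j\<bar>"
      using t by (simp add: abs_mult mult_left_le_one_le)
    moreover have "w $ j + t * (w0 $ j - w $ j) - w0 $ j = (1 - t) * (w $ j - w0 $ j)"
      by (simp add: algebra_simps)
    ultimately show "\<bar>(w + t *\<^sub>R (merge w - w)) $ j - w0 $ j\<bar> < \<epsilon>" by (simp add: merge)
  qed
  \<comment> \<open>The segment from \<open>w\<close> to \<open>merge w\<close> has a direction
    supported in \<open>Iu\<close>, so \<open>derg0\<close> makes the derivative vanish at every
    \<open>t\<close>.\<close>
  have const: "g (x, w) $ i = g (x, merge w) $ i" if xw: "(x, w) \<in> Bx" and i: "i \<notin> Ibu" for x w i
  proof -
    have pt: "(x, w + t *\<^sub>R (merge w - w)) \<in> Bx" if "t \<in> {0..1}" for t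
      using seg[OF _ that] xw by (auto simp: Bx_def)
    have "((\<lambda>t. g (x, w + t *\<^sub>R (merge w - w)) $ i) has_derivative (\<lambda>s. 0)) (at t within {0..1})"
      if t: "t \<in> {0..1}" for t
    proof -
      have "((\<lambda>t. (x, w + t *\<^sub>R (merge w - w))) has_derivative (\<lambda>s. (0, s *\<^sub>R (merge w - w)))) (at t)"
        by (auto intro!: derivative_eq_intros)
      from has_derivative_compose[OF this smooth_on_has_derivative[OF smg pt[OF t]]]
      have "((\<lambda>t. g (x, w + t *\<^sub>R (merge w - w)) $ i) has_derivative
          (\<lambda>s. der g (x, w + t *\<^sub>R (merge w - w)) (0, s *\<^sub>R (merge w - w)) $ i)) (at t)"
        by (rule bounded_linear.has_derivative[OF bounded_linear_vec_nth])
      moreover have "der g (x, w + t *\<^sub>R (merge w - w)) (0, s *\<^sub>R (merge w - w)) $ i = 0" for s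
        by (rule derg0[OF pt[OF t] _ i]) (simp add: merge)
      ultimately show ?thesis by (simp add: has_derivative_at_withinI)
    qed
    then have "\<exists>c. \<forall>t\<in>{0..1}. g (x, w + t *\<^sub>R (merge w - w)) $ i = c"
      by (intro has_derivative_zero_constant) auto
    then have "g (x, w + 0 *\<^sub>R (merge w - w)) $ i = g (x, w + 1 *\<^sub>R (merge w - w)) $ i"
      by (metis atLeastAtMost_iff order_refl zero_le_one)
    then show ?thesis by simp
  qed
  define fa where "fa q = g (fst q, merge (snd q))" for q
  \<comment> \<open>An open set that contains \<open>(x, coord_part Iv w)\<close> for every
    \<open>(x, w)\<close> in \<open>Bx\<close>, although such a point may itself lie outside
    \<open>Bx\<close>.\<close>
  define T where "T = {q. (fst q, merge (snd q)) \<in> Bx}"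
  have bl_cp: "bounded_linear (\<lambda>q :: (real^'n) \<times> (real^'m). coord_part Iv (snd q))"
    by (rule bounded_linear_compose[OF bounded_linear_coord_part bounded_linear_snd])
  have "open T" unfolding T_def merge_def
    by (intro open_Collect_mem_continuous Bx(1) continuous_intros linear_continuous_on[OF bl_cp])
  have "smooth_on T fa" unfolding fa_def
  proof (rule smooth_on_compose[OF \<open>open T\<close> Bx(1) _ _ smg])
    show "smooth_on T (\<lambda>q. (fst q, merge (snd q)))"
      unfolding merge_def
      by (intro smooth_on_Pair smooth_on_add \<open>open T\<close> smooth_on_const smooth_on_bounded_linear[OF \<open>open T\<close> bl_cp]
          smooth_on_bounded_linear[OF \<open>open T\<close> bounded_linear_fst])
  qed (auto simp: T_def)
  have merge_cp: "merge (coord_part Iv w) = merge w" for w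
    by (simp add: vec_eq_iff merge) (simp add: coord_part_def Iv_def)
  have "in_block_form (CARD('m) - mu) mu (\<Phi> ` G) (\<lambda>q. \<phi>x (f (inv_into G \<Phi> q)))"
    unfolding in_block_form_def G(4) g_def[symmetric]
  proof (intro exI conjI)
    show "- range \<sigma> \<union> \<sigma> ` Iv \<union> Ibu = UNIV" "- range \<sigma> \<inter> \<sigma> ` Iv = {}" "- range \<sigma> \<inter> Ibu = {}"
      "\<sigma> ` Iv \<inter> Ibu = {}" "Iv \<union> Iu = UNIV" "Iv \<inter> Iu = {}"
      using \<sigma> by (auto simp: Ibu_def Iv_def inj_def)
    show "card (- range \<sigma>) = CARD('n) - CARD('m)"
      using \<sigma> by (simp add: Compl_eq_Diff_UNIV card_Diff_subset card_image)
    show "card Iu = mu" using Iu dim\<Delta> by simp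
    then show "card Iv = CARD('m) - mu"
      by (simp add: Iv_def Compl_eq_Diff_UNIV card_Diff_subset)
    show "bij_betw \<sigma> Iv (\<sigma> ` Iv)" "bij_betw \<sigma> Iu Ibu"
      using \<sigma> by (auto simp: Ibu_def bij_betw_def intro: inj_on_subset)
    show "open T" "smooth_on T fa" by fact+
    show "\<forall>(x, w)\<in>Bx. (x, coord_part Iv w) \<in> T \<and>
        (\<forall>i\<in>- range \<sigma>. g (x, w) $ i = fa (x, coord_part Iv w) $ i) \<and>
        (\<forall>j\<in>Iv. g (x, w) $ \<sigma> j = w $ j) \<and> (\<forall>j\<in>Iu. g (x, w) $ \<sigma> j = w $ j)"
    proof (clarify, intro conjI ballI)
      fix x w assume xw: "(x, w) \<in> Bx"
      have "merge w \<in> Cb" using seg[of w 1] xw by (simp add: Bx_def)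
      then show "(x, coord_part Iv w) \<in> T" using xw by (simp add: T_def merge_cp Bx_def)
      show "g (x, w) $ \<sigma> j = w $ j" "g (x, w) $ \<sigma> j = w $ j" for j by (rule g\<sigma>[OF xw])+
      show "g (x, w) $ i = fa (x, coord_part Iv w) $ i" if "i \<in> - range \<sigma>" for i
        using const[OF xw, of i] that by (auto simp: fa_def merge_cp Ibu_def)
    qed
  qed
  moreover have "f ` G \<subseteq> W" "fst ` G \<subseteq> W" "G \<subseteq> E"
    using G(3) G0(2,3,4) Q'(3) \<open>U \<subseteq> E\<close> by blast+
  moreover have "f p0 \<in> W" using Q'(2,3) by (auto simp: x1_def)
  ultimately show ?thesis
    unfolding transformable_near_def using W G(1) diffeoG
    by (intro exI[of _ W] exI[of _ \<phi>x] exI[of _ G] exI[of _ \<phi>u] exI[of _ \<Phi>] conjI)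
       (simp_all only: \<Phi>_def)
qed

theorem lemma10:
  fixes X :: "(real^'n) set"
    and E :: "((real^'n) \<times> (real^'m)) set"
    and f :: "(real^'n) \<times> (real^'m) \<Rightarrow> real^'n"
    and mu mv :: nat
    and p0 :: "(real^'n) \<times> (real^'m)"
  assumes "open X" and "open E" and "fst ` E = X"
    and smooth: "smooth_on E f"
    and surjective: "f ` E = X"
    and submersion: "\<And>p. p \<in> E \<Longrightarrow> surj (frechet_derivative f (at p))"
    and no_redundant_inputs:
      "\<And>x u. (x, u) \<in> E \<Longrightarrow> rank (jacobian (\<lambda>u'. f (x, u')) (at u)) = CARD('m)"
    and "1 \<le> mu" and "mu \<le> CARD('m)" and "mv = CARD('m) - mu"
    and "p0 \<in> E"
  shows "(\<exists>S Ubu. open S \<and> p0 \<in> S \<and> S \<subseteq> E \<and>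
            distribution_on S mu Ubu \<and>
            (\<forall>p\<in>S. Ubu p \<subseteq> input_dist p) \<and>
            (\<forall>p\<in>S. bracket_dist S Ubu (sum_dist Ubu (kernel_dist f)) p
                     \<subseteq> sum_dist Ubu (kernel_dist f) p))
         \<longleftrightarrow> transformable_near mv mu X E f p0"
proof
  assume "\<exists>S Ubu. open S \<and> p0 \<in> S \<and> S \<subseteq> E \<and> distribution_on S mu Ubu \<and>
    (\<forall>p\<in>S. Ubu p \<subseteq> input_dist p) \<and>
    (\<forall>p\<in>S. bracket_dist S Ubu (sum_dist Ubu (kernel_dist f)) p \<subseteq> sum_dist Ubu (kernel_dist f) p)"
  then obtain S Ubu where S: "open S" "p0 \<in> S" "S \<subseteq> E" "distribution_on S mu Ubu"
    and "\<And>p. p \<in> S \<Longrightarrow> Ubu p \<subseteq> input_dist p"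
    and "\<And>p. p \<in> S \<Longrightarrow> bracket_dist S Ubu (sum_dist Ubu (kernel_dist f)) p \<subseteq> sum_dist Ubu (kernel_dist f) p"
    by blast
  then show "transformable_near mv mu X E f p0"
    unfolding assms(10)
    by (intro distribution_imp_transformable[OF assms(1-3) smooth surjective submersion no_redundant_inputs])
next
  assume "transformable_near mv mu X E f p0"
  then show "\<exists>S Ubu. open S \<and> p0 \<in> S \<and> S \<subseteq> E \<and> distribution_on S mu Ubu \<and>
    (\<forall>p\<in>S. Ubu p \<subseteq> input_dist p) \<and>
    (\<forall>p\<in>S. bracket_dist S Ubu (sum_dist Ubu (kernel_dist f)) p \<subseteq> sum_dist Ubu (kernel_dist f) p)"
    by (rule transformable_imp_distribution[OF assms(2) smooth])
qed

end
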